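(* Let $G$ be a simple graph with $m$ edges, $n$ nodes, and minimum degree $\delta$. Fix an arbitrary constant $\varepsilon\in(0,1]$. In $O(m\log n)$ time, one can randomly contract $G$ to a multigraph $\widehat G$ with $O(n/\delta)$ nodes and $O(n)$ edges such that, with high probability, $\widehat G$ preserves all non-trivial $(2-\varepsilon)$-min-cuts of $G$.
   Context: A cut of $G=(V,E)$ is given by $\emptyset\ne S\subsetneq V$; $C(S)$ is the set of edges with exactly one endpoint in $S$. $\lambda$ denotes the edge connectivity (minimum of $|C(S)|$). For $\alpha\ge1$, a cut is an $\alpha$-min-cut ($\alpha$-small) if $|C(S)|\le\alpha\lambda$. A cut is trivial (singleton) if one of its sides consists of exactly one vertex, otherwise non-trivial. Edges have identities, so contraction of an edge set $D$ yields a multigraph $G/D$ (self-loops removed) whose surviving edges are well defined; $G/D$ preserves a cut $C$ iff $C\cap D=\emptyset$. "With high probability" means with probability $1-O(n^{-\gamma})$ for any desired constant $\gamma\ge1$. *)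

theory Defs
  imports Complex_Main "HOL-Probability.Probability_Mass_Function"
begin

section \<open>Multigraphs, cuts and contractions\<close>

text \<open>Edges have identities: they are elements of their own type, and \<open>ends\<close> gives the set of
  endpoints.  Only the values of \<open>ends\<close> on \<open>edges\<close> matter.\<close>

record ('v, 'e) mgraph =
  nodes :: "'v set"
  edges :: "'e set"
  ends :: "'e \<Rightarrow> 'v set"

definition multigraph :: "('v, 'e) mgraph \<Rightarrow> bool" where
  "multigraph G \<longleftrightarrow> finite (nodes G) \<and> nodes G \<noteq> {} \<and> finite (edges G) \<and>
     (\<forall>e\<in>edges G. ends G e \<subseteq> nodes G \<and> card (ends G e) = 2)"

definition simple_graph :: "('v, 'e) mgraph \<Rightarrow> bool" where
  "simple_graph G \<longleftrightarrow> multigraph G \<and> inj_on (ends G) (edges G)"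

definition degree :: "('v, 'e) mgraph \<Rightarrow> 'v \<Rightarrow> nat" where
  "degree G v = card {e \<in> edges G. v \<in> ends G e}"

definition min_degree :: "('v, 'e) mgraph \<Rightarrow> nat" where
  "min_degree G = Min (degree G ` nodes G)"

definition is_cut :: "('v, 'e) mgraph \<Rightarrow> 'v set \<Rightarrow> bool" where
  "is_cut G S \<longleftrightarrow> S \<noteq> {} \<and> S \<subset> nodes G"

definition cut_edges :: "('v, 'e) mgraph \<Rightarrow> 'v set \<Rightarrow> 'e set" where
  "cut_edges G S = {e \<in> edges G. card (ends G e \<inter> S) = 1}"

text \<open>Meaningful for graphs with at least two nodes (otherwise there is no cut).\<close>

definition edge_connectivity :: "('v, 'e) mgraph \<Rightarrow> nat" where
  "edge_connectivity G = Min ((\<lambda>S. card (cut_edges G S)) ` {S. is_cut G S})"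

definition alpha_min_cut :: "real \<Rightarrow> ('v, 'e) mgraph \<Rightarrow> 'v set \<Rightarrow> bool" where
  "alpha_min_cut \<alpha> G S \<longleftrightarrow>
     is_cut G S \<and> real (card (cut_edges G S)) \<le> \<alpha> * real (edge_connectivity G)"

definition trivial_cut :: "('v, 'e) mgraph \<Rightarrow> 'v set \<Rightarrow> bool" where
  "trivial_cut G S \<longleftrightarrow> is_cut G S \<and> (card S = 1 \<or> card (nodes G - S) = 1)"

definition joined :: "('v, 'e) mgraph \<Rightarrow> 'e set \<Rightarrow> ('v \<times> 'v) set" where
  "joined G D = {(u, v). u \<in> nodes G \<and> v \<in> nodes G \<and>
     (u, v) \<in> {(x, y). \<exists>e\<in>D. x \<in> ends G e \<and> y \<in> ends G e}\<^sup>*}"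

text \<open>The nodes of \<open>G/D\<close> are the connected components of \<open>(nodes G, D)\<close>; the self-loops, which
  are dropped, are the edges both of whose endpoints lie in one component.  Surviving edges keep
  their identity.\<close>

definition contract :: "('v, 'e) mgraph \<Rightarrow> 'e set \<Rightarrow> ('v set, 'e) mgraph" where
  "contract G D =
     \<lparr>nodes = nodes G // joined G D,
      edges = {e \<in> edges G. card ((\<lambda>v. joined G D `` {v}) ` ends G e) = 2},
      ends = (\<lambda>e. (\<lambda>v. joined G D `` {v}) ` ends G e)\<rparr>"

definition preserves_cut :: "('v, 'e) mgraph \<Rightarrow> 'e set \<Rightarrow> 'v set \<Rightarrow> bool" where
  "preserves_cut G D S \<longleftrightarrow> cut_edges G S \<inter> D = {}"


section \<open>Randomized word RAM\<close>

text \<open>Structured programs over words \<open>{0..<B}\<close>, where \<open>B = 2 ^ w\<close> for word size \<open>w\<close>.  The memory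
  consists of registers and word-addressed arrays.  A program mentions only finitely many of them,
  by fixed numbers, so this is a word RAM up to a constant factor in time.\<close>

datatype operator = Add | Sub | Mul | Div | Mod | Less | Equal

datatype expr =
    Num nat
  | Reg nat
  | Cell nat expr
  | Op operator expr expr

record ram_state =
  regs :: "nat \<Rightarrow> nat"
  arrs :: "nat \<Rightarrow> nat \<Rightarrow> nat"

text \<open>Addition and multiplication wrap around; subtraction is truncated at 0, and division by 0
  follows the HOL convention.\<close>

fun apply_op :: "nat \<Rightarrow> operator \<Rightarrow> nat \<Rightarrow> nat \<Rightarrow> nat" where
  "apply_op B Add x y = (x + y) mod B"
| "apply_op B Sub x y = x - y"
| "apply_op B Mul x y = (x * y) mod B"
| "apply_op B Div x y = x div y"
| "apply_op B Mod x y = x mod y"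
| "apply_op B Less x y = (if x < y then 1 else 0)"
| "apply_op B Equal x y = (if x = y then 1 else 0)"

primrec eval_expr :: "nat \<Rightarrow> ram_state \<Rightarrow> expr \<Rightarrow> nat" where
  "eval_expr B s (Num k) = k mod B"
| "eval_expr B s (Reg x) = regs s x"
| "eval_expr B s (Cell a e) = arrs s a (eval_expr B s e)"
| "eval_expr B s (Op f e1 e2) = apply_op B f (eval_expr B s e1) (eval_expr B s e2)"

datatype instr =
    Assign nat expr
  | Store nat expr expr
  | Rand nat expr
  | If expr "instr list" "instr list"
  | While expr "instr list"

definition set_reg :: "nat \<Rightarrow> nat \<Rightarrow> ram_state \<Rightarrow> ram_state" where
  "set_reg x k s = s\<lparr>regs := (regs s)(x := k)\<rparr>"

definition set_cell :: "nat \<Rightarrow> nat \<Rightarrow> nat \<Rightarrow> ram_state \<Rightarrow> ram_state" where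
  "set_cell a i k s = s\<lparr>arrs := (arrs s)(a := (arrs s a)(i := k))\<rparr>"

text \<open>A configuration is the list of instructions still to be executed together with the memory;
  the empty list is the halted state.  Every step costs one time unit: the expressions occurring in
  a fixed program have bounded size.  \<open>Rand x e\<close> draws a uniform element of \<open>{0..k}\<close>, with \<open>k\<close>
  the value of \<open>e\<close>, independently of all earlier draws.\<close>

fun step :: "nat \<Rightarrow> instr list \<times> ram_state \<Rightarrow> (instr list \<times> ram_state) pmf" where
  "step B ([], s) = return_pmf ([], s)"
| "step B (Assign x e # cs, s) = return_pmf (cs, set_reg x (eval_expr B s e) s)"
| "step B (Store a i e # cs, s) =
     return_pmf (cs, set_cell a (eval_expr B s i) (eval_expr B s e) s)"
| "step B (Rand x e # cs, s) =
     map_pmf (\<lambda>k. (cs, set_reg x k s)) (pmf_of_set {0..eval_expr B s e})"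
| "step B (If e cs1 cs2 # cs, s) =
     return_pmf ((if eval_expr B s e \<noteq> 0 then cs1 else cs2) @ cs, s)"
| "step B (While e cs1 # cs, s) =
     return_pmf (if eval_expr B s e \<noteq> 0 then cs1 @ While e cs1 # cs else cs, s)"

primrec run :: "nat \<Rightarrow> nat \<Rightarrow> instr list \<times> ram_state \<Rightarrow> (instr list \<times> ram_state) pmf" where
  "run B 0 cfg = return_pmf cfg"
| "run B (Suc t) cfg = bind_pmf (step B cfg) (run B t)"


section \<open>Input and output conventions\<close>

text \<open>Nodes and edges of an input graph are numbered from 0.  Registers 0 and 1 hold the numbers of
  nodes and edges, arrays 0 and 1 the two endpoints of every edge (edges and their endpoints come
  in arbitrary order); the remaining memory is zero.\<close>

definition encodes_input :: "(nat, nat) mgraph \<Rightarrow> ram_state \<Rightarrow> bool" where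
  "encodes_input G s \<longleftrightarrow>
     nodes G = {..<regs s 0} \<and> edges G = {..<regs s 1} \<and>
     (\<forall>e\<in>edges G. ends G e = {arrs s 0 e, arrs s 1 e}) \<and>
     (\<forall>x. x \<ge> 2 \<longrightarrow> regs s x = 0) \<and>
     (\<forall>a i. a \<ge> 2 \<or> i \<notin> edges G \<longrightarrow> arrs s a i = 0)"

text \<open>The contracted edges are flagged in array 2.\<close>

definition contracted :: "(nat, nat) mgraph \<Rightarrow> ram_state \<Rightarrow> nat set" where
  "contracted G s = {e \<in> edges G. arrs s 2 e \<noteq> 0}"

text \<open>The multigraph \<open>H = G/D\<close> is written out in full.  Registers 2 and 3 hold its numbers of
  nodes and edges; array 3 maps every node of \<open>G\<close> to the number of the node of \<open>H\<close> containing it;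
  array 4 lists the identities of the edges of \<open>H\<close>, arrays 5 and 6 their endpoints in \<open>H\<close>.\<close>

definition encodes_output :: "(nat set, nat) mgraph \<Rightarrow> ram_state \<Rightarrow> bool" where
  "encodes_output H s \<longleftrightarrow>
     (\<exists>f. bij_betw f (nodes H) {..<regs s 2} \<and>
          (\<forall>X\<in>nodes H. \<forall>v\<in>X. arrs s 3 v = f X) \<and>
          bij_betw (arrs s 4) {..<regs s 3} (edges H) \<and>
          (\<forall>j<regs s 3. {arrs s 5 j, arrs s 6 j} = f ` ends H (arrs s 4 j)))"

end

theory Submission
  imports Defs "HOL-Probability.Product_PMF"
begin

text \<open>One sample contracts two random incident edges per node and, independently, every edge with
  probability \<open>1 / (2 * \<delta>)\<close>.  The picks leave \<open>O(n / \<delta>)\<close> components in expectation and the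
  additional edges reduce the number of surviving edges to \<open>O(n)\<close>.  A fixed non-trivial
  \<open>(2 - \<epsilon>)\<close>-min-cut meets every node in at most a \<open>1 - \<epsilon> / 2\<close> fraction of its edges, because
  moving the node to the other side must not beat the connectivity, and hence survives a sample
  with constant probability.  Of \<open>O(log n)\<close> samples, those with more than \<open>O(n)\<close> surviving edges
  are discarded, and an edge is contracted unless it survives in a constant fraction of the
  samples.  Every edge of a cut to be preserved passes this test with high probability, while only
  \<open>O(n)\<close> edges can pass it; and as the graph is simple, \<open>O(n)\<close> remaining edges leave
  \<open>O(n / \<delta>)\<close> nodes.\<close>

section \<open>Execution of RAM programs\<close>

text \<open>Whether a pick helps depends on the class it falls into, so the number of classes left
  cannot be bounded in a fixed order of the picks. They are revealed adaptively, always for a class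
  of at most \<open>\<delta> / 4\<close> nodes, and a potential bounds the number of classes that
  run out of picks. This is where two picks per node matter: a merge consumes one, so a class of x
  nodes whose picks have all led out still has 2 * x - (x - 1) = x + 1 of them, while one pick per
  node would leave a single one. Classes that stop by growing beyond \<open>\<delta> / 4\<close>
  nodes number at most 4 * n / \<delta>. The rate 1 / (2 * \<delta>) of the additional edges then
  turns O(n / \<delta>) classes into O(n) surviving edges. On the side of the program, all random
  numbers are drawn before any sample is evaluated. Randomness is confined to one loop of fixed
  running time, and everything after it is verified as a deterministic program for each fixed array
  of random numbers.\<close>

definition pexec :: "nat \<Rightarrow> instr list \<Rightarrow> ram_state \<Rightarrow> nat \<Rightarrow> ram_state pmf \<Rightarrow> bool" where
  "pexec B cs s t p \<longleftrightarrow> (\<forall>rest. run B t (cs @ rest, s) = map_pmf (Pair rest) p)"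

abbreviation exec :: "nat \<Rightarrow> instr list \<Rightarrow> ram_state \<Rightarrow> nat \<Rightarrow> ram_state \<Rightarrow> bool" where
  "exec B cs s t s' \<equiv> pexec B cs s t (return_pmf s')"

lemma run_add: "run B (t + u) cfg = bind_pmf (run B t cfg) (run B u)"
proof (induction t arbitrary: cfg)
  case (Suc t)
  then have "run B (t + u) = (\<lambda>c. bind_pmf (run B t c) (run B u))"
    by blast
  then show ?case
    by (simp add: bind_assoc_pmf)
qed (simp add: bind_return_pmf)

lemma run_halted: "run B t ([], s) = return_pmf ([], s)"
  by (induction t) (simp_all add: bind_return_pmf)

lemma pexec_Nil: "exec B [] s 0 s"
  by (simp add: pexec_def)

text \<open>Runs compose because \<open>pexec\<close> holds for every continuation. The step count
  is exact and common to all outcomes, so a randomized segment must take the same time whatever it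
  draws.\<close>

lemma pexec_append:
  assumes "pexec B cs1 s t1 p" and "\<And>s1. s1 \<in> set_pmf p \<Longrightarrow> pexec B cs2 s1 t2 (q s1)"
  shows "pexec B (cs1 @ cs2) s (t1 + t2) (bind_pmf p q)"
  unfolding pexec_def
proof
  fix rest
  have "run B (t1 + t2) ((cs1 @ cs2) @ rest, s) = bind_pmf p (\<lambda>s1. run B t2 (cs2 @ rest, s1))"
    using assms(1) by (simp add: run_add pexec_def bind_map_pmf)
  also have "\<dots> = bind_pmf p (\<lambda>s1. map_pmf (Pair rest) (q s1))"
    using assms(2) by (intro bind_pmf_cong) (simp_all add: pexec_def)
  finally show "run B (t1 + t2) ((cs1 @ cs2) @ rest, s) = map_pmf (Pair rest) (bind_pmf p q)"
    by (simp add: map_bind_pmf)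
qed

lemma pexec_append_det:
  assumes "exec B cs1 s t1 s1" and "pexec B cs2 s1 t2 q"
  shows "pexec B (cs1 @ cs2) s (t1 + t2) q"
  using pexec_append[OF assms(1), of cs2 t2 "\<lambda>_. q"] assms(2) by (simp add: bind_return_pmf)

lemma pexec_step:
  assumes "\<And>rest. step B (c # rest, s) = return_pmf (ds @ rest, s1)"
    and "pexec B (ds @ cs) s1 t p"
  shows "pexec B (c # cs) s (Suc t) p"
  using assms by (simp add: pexec_def bind_return_pmf)

lemma pexec_Assign:
  "pexec B cs (set_reg x (eval_expr B s e) s) t p \<Longrightarrow> pexec B (Assign x e # cs) s (Suc t) p"
  by (rule pexec_step[where ds = "[]"]) simp_all

lemma pexec_Store:
  "pexec B cs (set_cell a (eval_expr B s i) (eval_expr B s e) s) t p \<Longrightarrow>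
    pexec B (Store a i e # cs) s (Suc t) p"
  by (rule pexec_step[where ds = "[]"]) simp_all

lemma pexec_While_False:
  "eval_expr B s e = 0 \<Longrightarrow> pexec B cs s t p \<Longrightarrow> pexec B (While e cs1 # cs) s (Suc t) p"
  by (rule pexec_step[where ds = "[]"]) simp_all

lemma pexec_While_True:
  "eval_expr B s e \<noteq> 0 \<Longrightarrow> pexec B (cs1 @ While e cs1 # cs) s t p \<Longrightarrow>
    pexec B (While e cs1 # cs) s (Suc t) p"
  by (rule pexec_step[where ds = "cs1 @ [While e cs1]"]) simp_all

lemma pexec_Rand:
  assumes "\<And>k. k \<le> eval_expr B s e \<Longrightarrow> pexec B cs (set_reg x k s) t (p k)"
  shows "pexec B (Rand x e # cs) s (Suc t) (bind_pmf (pmf_of_set {0..eval_expr B s e}) p)"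
  unfolding pexec_def
proof
  fix rest
  let ?U = "pmf_of_set {0..eval_expr B s e}"
  have "run B (Suc t) ((Rand x e # cs) @ rest, s)
      = bind_pmf ?U (\<lambda>k. run B t (cs @ rest, set_reg x k s))"
    by (simp add: bind_map_pmf)
  also have "\<dots> = bind_pmf ?U (\<lambda>k. map_pmf (Pair rest) (p k))"
    using assms by (intro bind_pmf_cong) (simp_all add: pexec_def)
  finally show "run B (Suc t) ((Rand x e # cs) @ rest, s) = map_pmf (Pair rest) (bind_pmf ?U p)"
    by (simp add: map_bind_pmf)
qed

text \<open>Covers segments that reach a single state. A time bound suffices here, as the halted
  configuration absorbs excess time once the program has ended.\<close>

definition wp :: "nat \<Rightarrow> instr list \<Rightarrow> nat \<Rightarrow> (ram_state \<Rightarrow> bool) \<Rightarrow> ram_state \<Rightarrow> bool" where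
  "wp B cs T Q s \<longleftrightarrow> (\<exists>t\<le>T. \<exists>s'. exec B cs s t s' \<and> Q s')"

text \<open>An equivalence, like the rules after it, so that the simplifier can execute
  straight-line code symbolically.\<close>

lemma wp_Nil: "wp B [] T Q s \<longleftrightarrow> Q s"
proof
  assume "wp B [] T Q s"
  then obtain t s' where "exec B [] s t s'" "Q s'"
    unfolding wp_def by blast
  then have "run B t ([] @ [], s) = map_pmf (Pair []) (return_pmf s')"
    unfolding pexec_def by blast
  then show "Q s" using \<open>Q s'\<close> by (simp add: run_halted)
next
  assume "Q s" then show "wp B [] T Q s" unfolding wp_def using pexec_Nil by blast
qed

lemma wp_step:
  assumes step: "\<And>rest. step B (c # rest, s) = return_pmf (ds @ rest, s1)" and T: "0 < T"
  shows "wp B (c # cs) T Q s \<longleftrightarrow> wp B (ds @ cs) (T - 1) Q s1"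
proof
  assume "wp B (c # cs) T Q s"
  then obtain t s' where t: "t \<le> T" "exec B (c # cs) s t s'" "Q s'"
    unfolding wp_def by blast
  show "wp B (ds @ cs) (T - 1) Q s1"
  proof (cases t)
    case 0
    \<comment> \<open>Zero steps would have to leave exactly \<open>rest\<close>, but
      \<open>c # cs\<close> still stands in front of it.\<close>
    then show ?thesis using t(2) by (auto simp: pexec_def)
  next
    case (Suc t')
    then have "exec B (ds @ cs) s1 t' s'"
      using t(2) step by (simp add: pexec_def bind_return_pmf)
    moreover have "t' \<le> T - 1" using t(1) Suc by simp
    ultimately show ?thesis using t(3) unfolding wp_def by blast
  qed
next
  assume "wp B (ds @ cs) (T - 1) Q s1"
  then show "wp B (c # cs) T Q s"
    unfolding wp_def using pexec_step[OF step] T by (metis Suc_diff_1 Suc_le_mono)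
qed

lemma wp_Assign:
  "0 < T \<Longrightarrow> wp B (Assign x e # cs) T Q s \<longleftrightarrow> wp B cs (T - 1) Q (set_reg x (eval_expr B s e) s)"
  by (subst wp_step[where ds = "[]"]) auto

lemma wp_Store:
  "0 < T \<Longrightarrow> wp B (Store a i e # cs) T Q s \<longleftrightarrow>
    wp B cs (T - 1) Q (set_cell a (eval_expr B s i) (eval_expr B s e) s)"
  by (subst wp_step[where ds = "[]"]) auto

lemma wp_If:
  "0 < T \<Longrightarrow> wp B (If e cs1 cs2 # cs) T Q s \<longleftrightarrow>
    wp B ((if eval_expr B s e \<noteq> 0 then cs1 else cs2) @ cs) (T - 1) Q s"
  by (rule wp_step) simp_all

lemmas wp_simps = wp_Nil wp_Assign wp_Store wp_If

lemma wp_append: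
  assumes "wp B cs1 T1 Q1 s" and "\<And>s1. Q1 s1 \<Longrightarrow> wp B cs2 T2 Q s1" and "T1 + T2 \<le> T"
  shows "wp B (cs1 @ cs2) T Q s"
proof -
  obtain t1 s1 where 1: "t1 \<le> T1" "exec B cs1 s t1 s1" "Q1 s1"
    using assms(1) unfolding wp_def by blast
  obtain t2 s2 where 2: "t2 \<le> T2" "exec B cs2 s1 t2 s2" "Q s2"
    using assms(2)[OF 1(3)] unfolding wp_def by blast
  have "exec B (cs1 @ cs2) s (t1 + t2) s2"
    using 1(2) 2(2) by (rule pexec_append_det)
  moreover have "t1 + t2 \<le> T"
    using 1(1) 2(1) assms(3) by linarith
  ultimately show ?thesis
    unfolding wp_def using 2(3) by blast
qed

lemma wp_Cons:
  assumes "wp B [c] T1 Q1 s" and "\<And>s1. Q1 s1 \<Longrightarrow> wp B cs2 T2 Q s1" and "T1 + T2 \<le> T"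
  shows "wp B (c # cs2) T Q s"
  using wp_append[OF assms] by simp

lemma wp_mono:
  assumes "wp B cs T1 Q1 s" and "\<And>s1. Q1 s1 \<Longrightarrow> Q s1" and "T1 \<le> T"
  shows "wp B cs T Q s"
  using assms unfolding wp_def by (meson le_trans)

text \<open>Each round costs one step for the test and at most \<open>T\<close> for the body, and
  the final test costs one more; \<open>\<mu>\<close> bounds the number of rounds.\<close>

lemma wp_While:
  assumes inv: "I s" and bound: "Suc T * \<mu> s + 1 \<le> T'"
    and body: "\<And>s. I s \<Longrightarrow> eval_expr B s e \<noteq> 0 \<Longrightarrow> wp B cs T (\<lambda>s'. I s' \<and> \<mu> s' < \<mu> s) s"
    and exit: "\<And>s. I s \<Longrightarrow> eval_expr B s e = 0 \<Longrightarrow> Q s"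
  shows "wp B [While e cs] T' Q s"
  using inv bound
proof (induction "\<mu> s" arbitrary: s T' rule: less_induct)
  case (less s)
  show ?case
  proof (cases "eval_expr B s e = 0")
    case True
    have "exec B [While e cs] s (Suc 0) s"
      by (rule pexec_While_False[OF True pexec_Nil])
    then show ?thesis
      unfolding wp_def using exit[OF less.prems(1) True] less.prems(2)
      by (intro exI[of _ "Suc 0"] conjI exI[of _ s]) auto
  next
    case False
    obtain t1 s1 where 1: "t1 \<le> T" "exec B cs s t1 s1" "I s1" "\<mu> s1 < \<mu> s"
      using body[OF less.prems(1) False] unfolding wp_def by blast
    obtain t2 s2 where 2: "t2 \<le> Suc T * \<mu> s1 + 1" "exec B [While e cs] s1 t2 s2" "Q s2"
      using less.hyps[OF 1(4,3) order_refl] unfolding wp_def by blast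
    have ex: "exec B [While e cs] s (Suc (t1 + t2)) s2"
      by (rule pexec_While_True[OF False pexec_append_det[OF 1(2) 2(2)]])
    have "Suc T * Suc (\<mu> s1) \<le> Suc T * \<mu> s"
      using 1(4) by (intro mult_le_mono) auto
    then have "Suc (t1 + t2) \<le> T'"
      using 1(1) 2(1) less.prems(2) by simp
    then show ?thesis
      unfolding wp_def using ex 2(3) by blast
  qed
qed

definition frame :: "nat set \<Rightarrow> nat set \<Rightarrow> ram_state \<Rightarrow> ram_state \<Rightarrow> bool" where
  "frame X A s s' \<longleftrightarrow> (\<forall>x. x \<notin> X \<longrightarrow> regs s' x = regs s x) \<and> (\<forall>a. a \<notin> A \<longrightarrow> arrs s' a = arrs s a)"

lemma frame_refl [simp]: "frame X A s s"
  by (simp add: frame_def)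

lemma frame_arr: "frame X A s s' \<Longrightarrow> a \<notin> A \<Longrightarrow> arrs s' a = arrs s a"
  by (simp add: frame_def)

lemma frame_set_reg [simp]: "x \<in> X \<Longrightarrow> frame X A s s' \<Longrightarrow> frame X A s (set_reg x k s')"
  by (auto simp: frame_def set_reg_def)

lemma frame_set_cell [simp]: "a \<in> A \<Longrightarrow> frame X A s s' \<Longrightarrow> frame X A s (set_cell a i k s')"
  by (auto simp: frame_def set_cell_def)

lemma regs_set_reg [simp]: "regs (set_reg x k s) y = (if y = x then k else regs s y)"
  and arrs_set_reg [simp]: "arrs (set_reg x k s) = arrs s"
  and regs_set_cell [simp]: "regs (set_cell a i k s) = regs s"
  and arrs_set_cell [simp]:
    "arrs (set_cell a i k s) b = (if b = a then (arrs s b)(i := k) else arrs s b)"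
  by (simp_all add: set_reg_def set_cell_def)

section \<open>Expected number of surviving edges\<close>

lemma bij_betw_card_less:
  fixes S :: "nat set"
  assumes "finite S"
  shows "bij_betw (\<lambda>e. card {e' \<in> S. e' < e}) S {..<card S}"
proof -
  let ?r = "\<lambda>e. card {e' \<in> S. e' < e}"
  have mono: "?r e < ?r e'" if "e \<in> S" "e < e'" for e e'
    using assms that by (intro psubset_card_mono) auto
  have "inj_on ?r S"
    by (rule linorder_inj_onI) (auto dest: mono)
  moreover have "?r ` S \<subseteq> {..<card S}"
  proof
    fix k assume "k \<in> ?r ` S"
    then obtain e where "e \<in> S" "k = ?r e" by blast
    then show "k \<in> {..<card S}"
      using assms by (auto intro!: psubset_card_mono)
  qed
  ultimately show ?thesis
    by (simp add: bij_betw_def card_image card_subset_eq)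
qed

locale sgraph =
  fixes n m :: nat and a b :: "nat \<Rightarrow> nat"
  assumes a_less: "e < m \<Longrightarrow> a e < n" and b_less: "e < m \<Longrightarrow> b e < n"
    and a_neq_b: "e < m \<Longrightarrow> a e \<noteq> b e"
    and ends_inj: "e < m \<Longrightarrow> e' < m \<Longrightarrow> {a e, b e} = {a e', b e'} \<Longrightarrow> e = e'"
begin

definition inc :: "nat \<Rightarrow> nat \<Rightarrow> bool" where
  "inc v e \<longleftrightarrow> v = a e \<or> v = b e"

definition deg :: "nat \<Rightarrow> nat" where
  "deg v = card {e. e < m \<and> inc v e}"

text \<open>Position of \<open>e\<close> in the incidence list of \<open>v\<close> ordered by edge
  number. The program obtains it as a running degree counter.\<close>

definition rank :: "nat \<Rightarrow> nat \<Rightarrow> nat" where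
  "rank v e = card {e'. e' < e \<and> inc v e'}"

definition opp :: "nat \<Rightarrow> nat \<Rightarrow> nat" where
  "opp v e = (if a e = v then b e else a e)"

lemma rank_bij: "bij_betw (rank v) {e. e < m \<and> inc v e} {..<deg v}"
proof -
  let ?S = "{e. e < m \<and> inc v e}"
  have "bij_betw (\<lambda>e. card {e' \<in> ?S. e' < e}) ?S {..<card ?S}"
    by (rule bij_betw_card_less) simp
  also have "?this \<longleftrightarrow> bij_betw (rank v) ?S {..<card ?S}"
    by (intro bij_betw_cong) (auto simp: rank_def intro!: arg_cong[where f = card])
  finally show ?thesis
    by (simp add: deg_def)
qed

lemma rank_less: "e < m \<Longrightarrow> inc v e \<Longrightarrow> rank v e < deg v"
  using bij_betwE[OF rank_bij] by blast

text \<open>Simplicity enters here: an edge at \<open>v\<close> is determined by its other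
  endpoint.\<close>

lemma opp_inj: "inj_on (opp v) {e. e < m \<and> inc v e}"
  by (rule inj_onI, rule ends_inj) (auto simp: opp_def inc_def split: if_splits)

lemma opp_less: "e < m \<Longrightarrow> opp v e < n"
  by (simp add: opp_def a_less b_less)

lemma opp_neq: "e < m \<Longrightarrow> opp v e \<noteq> v"
  using a_neq_b[of e] by (auto simp: opp_def)

lemma deg_less:
  assumes "v < n" shows "deg v < n"
proof -
  have "card (opp v ` {e. e < m \<and> inc v e}) \<le> card ({..<n} - {v})"
    by (rule card_mono) (auto simp: opp_less opp_neq)
  then have "deg v \<le> card ({..<n} - {v})"
    by (simp add: card_image[OF opp_inj] deg_def)
  then show ?thesis
    using assms by simp
qed

text \<open>A partition of the nodes is given by a labelling \<open>\<pi>\<close>, whose fibres are the classes.\<close>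

definition conn :: "(nat \<Rightarrow> nat) \<Rightarrow> nat set \<Rightarrow> (nat \<times> nat) set" where
  "conn \<pi> D = ({(x, y). \<pi> x = \<pi> y} \<union> {(x, y). \<exists>e\<in>D. inc x e \<and> inc y e})\<^sup>*"

definition merge :: "(nat \<Rightarrow> nat) \<Rightarrow> nat \<Rightarrow> nat \<Rightarrow> nat \<Rightarrow> nat" where
  "merge \<pi> c d = (\<lambda>x. if \<pi> x = c then d else \<pi> x)"

lemma conn_mono: "D \<subseteq> D' \<Longrightarrow> conn \<pi> D \<subseteq> conn \<pi> D'"
  unfolding conn_def by (rule rtrancl_mono) auto

lemma conn_same: "\<pi> x = \<pi> y \<Longrightarrow> (x, y) \<in> conn \<pi> D"
  unfolding conn_def by blast

lemma conn_edge: "e \<in> D \<Longrightarrow> inc x e \<Longrightarrow> inc y e \<Longrightarrow> (x, y) \<in> conn \<pi> D"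
  unfolding conn_def by blast

lemma conn_trans: "(x, y) \<in> conn \<pi> D \<Longrightarrow> (y, z) \<in> conn \<pi> D \<Longrightarrow> (x, z) \<in> conn \<pi> D"
  unfolding conn_def by (rule rtrancl_trans)

text \<open>Identifying the two fibres is simulated by walking along \<open>e\<close>, so a path for
  the merged labelling becomes a path that may use \<open>e\<close>.\<close>

lemma conn_merge:
  assumes "inc v e" "inc w e"
  shows "conn (merge \<pi> (\<pi> v) (\<pi> w)) D \<subseteq> conn \<pi> (insert e D)"
proof -
  let ?E = "conn \<pi> (insert e D)"
  have vw: "(v, w) \<in> ?E" "(w, v) \<in> ?E"
    using assms by (auto intro: conn_edge)
  have 1: "(x, y) \<in> ?E" if same: "merge \<pi> (\<pi> v) (\<pi> w) x = merge \<pi> (\<pi> v) (\<pi> w) y" for x y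
  proof -
    consider "\<pi> x = \<pi> y" | "\<pi> x = \<pi> v" "\<pi> y = \<pi> w" | "\<pi> x = \<pi> w" "\<pi> y = \<pi> v"
      using same unfolding merge_def by metis
    then show ?thesis
    proof cases
      case 1
      then show ?thesis by (rule conn_same)
    next
      case 2
      then have "(x, v) \<in> ?E" "(w, y) \<in> ?E"
        by (simp_all add: conn_same)
      then show ?thesis
        using vw(1) by (meson conn_trans)
    next
      case 3
      then have "(x, w) \<in> ?E" "(v, y) \<in> ?E"
        by (simp_all add: conn_same)
      then show ?thesis
        using vw(2) by (meson conn_trans)
    qed
  qed
  have "conn (merge \<pi> (\<pi> v) (\<pi> w)) D \<subseteq> ?E\<^sup>*"
    unfolding conn_def[of "merge \<pi> (\<pi> v) (\<pi> w)"]
    by (rule rtrancl_mono) (use 1 in \<open>auto intro: conn_edge\<close>)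
  also have "?E\<^sup>* = ?E"
    by (simp add: conn_def)
  finally show ?thesis .
qed

end

section \<open>One random sample and the edges surviving it\<close>

locale sgraph_deg = sgraph +
  fixes \<delta> :: nat
  assumes \<delta>_pos: "1 \<le> \<delta>" and \<delta>_le: "v < n \<Longrightarrow> \<delta> \<le> deg v"
begin

text \<open>A sample is drawn coordinatewise: coordinates \<open>v\<close> and \<open>n + v\<close> are the two picks of node \<open>v\<close>
  among its incident edges, given by rank, and edge \<open>e\<close> is selected if coordinate \<open>2 * n + e\<close>,
  which ranges over \<open>2 * \<delta>\<close> values, is 0.\<close>

definition sel :: "nat \<Rightarrow> nat \<Rightarrow> nat set" where
  "sel j k = (if j < 2 * n then {e. e < m \<and> inc (j mod n) e \<and> rank (j mod n) e = k}
              else {e. e < m \<and> 2 * n + e = j \<and> k = 0})"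

definition bnd :: "nat \<Rightarrow> nat" where
  "bnd j = (if j < 2 * n then deg (j mod n) - 1 else 2 * \<delta> - 1)"

definition selected :: "nat set \<Rightarrow> (nat \<Rightarrow> nat) \<Rightarrow> nat set" where
  "selected U \<omega> = (\<Union>j\<in>U. sel j (\<omega> j))"

definition sample :: "nat set \<Rightarrow> (nat \<Rightarrow> nat) pmf" where
  "sample U = Pi_pmf U 0 (\<lambda>j. pmf_of_set {0..bnd j})"

text \<open>The coordinates in \<open>U\<close> are those not yet revealed; the revealed ones have been used to merge
  classes of the labelling \<open>\<pi>\<close>.\<close>

definition surviving :: "nat set \<Rightarrow> (nat \<Rightarrow> nat) \<Rightarrow> (nat \<Rightarrow> nat) \<Rightarrow> nat set" where
  "surviving U \<pi> \<omega> = {e. e < m \<and> 2 * n + e \<in> U \<and> (a e, b e) \<notin> conn \<pi> (selected U \<omega>)}"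

definition esurv :: "nat set \<Rightarrow> (nat \<Rightarrow> nat) \<Rightarrow> real" where
  "esurv U \<pi> = measure_pmf.expectation (sample U) (\<lambda>\<omega>. real (card (surviving U \<pi> \<omega>)))"

text \<open>The conditional expectation given that coordinate \<open>j\<close> takes the value
  \<open>k\<close>, the other coordinates being independent of it.\<close>

abbreviation esurv_given :: "nat set \<Rightarrow> nat \<Rightarrow> nat \<Rightarrow> (nat \<Rightarrow> nat) \<Rightarrow> real" where
  "esurv_given U j k \<pi> \<equiv>
     measure_pmf.expectation (sample U) (\<lambda>\<omega>. real (card (surviving (insert j U) \<pi> (fun_upd \<omega> j k))))"

lemma finite_sample [simp]: "finite U \<Longrightarrow> finite (set_pmf (sample U))"
  unfolding sample_def by (subst set_Pi_pmf) (auto intro: finite_PiE_dflt)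

lemma sample_insert:
  fixes f :: "_ \<Rightarrow> real"
  assumes "finite U" "j \<notin> U"
  shows "measure_pmf.expectation (sample (insert j U)) f
    = (\<Sum>k\<le>bnd j. measure_pmf.expectation (sample U) (\<lambda>\<omega>. f (fun_upd \<omega> j k))) / real (Suc (bnd j))"
    (is "_ = ?R")
proof -
  have "measure_pmf.expectation (sample (insert j U)) f
    = measure_pmf.expectation (pmf_of_set {0..bnd j} \<bind> (\<lambda>k. map_pmf (\<lambda>\<omega>. fun_upd \<omega> j k) (sample U))) f"
    using assms by (simp add: sample_def Pi_pmf_insert' map_pmf_def)
  also have "\<dots> = (\<Sum>k\<in>{0..bnd j}. measure_pmf.expectation (map_pmf (\<lambda>\<omega>. fun_upd \<omega> j k) (sample U)) f
      /\<^sub>R real (card {0..bnd j}))"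
    using assms by (subst pmf_expectation_bind_pmf_of_set) auto
  also have "\<dots> = ?R"
    by (simp add: sum_distrib_left atMost_atLeast0 divide_inverse mult.commute)
  finally show ?thesis .
qed

lemma expectation_mono:
  assumes "finite (set_pmf p)" "\<And>x. x \<in> set_pmf p \<Longrightarrow> f x \<le> (g x :: real)"
  shows "measure_pmf.expectation p f \<le> measure_pmf.expectation p g"
  using assms by (intro integral_mono_AE integrable_measure_pmf_finite AE_pmfI) auto

lemma finite_surviving [simp]: "finite (surviving U \<pi> \<omega>)"
  unfolding surviving_def by simp

lemma selected_insert:
  "j \<notin> U \<Longrightarrow> selected (insert j U) (fun_upd \<omega> j k) = sel j k \<union> selected U \<omega>"
  unfolding selected_def by (auto split: if_splits)

text \<open>Ignoring what a pick selects can only remove connections, and as a pick is not the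
  coordinate of an edge, no edge leaves the count.\<close>

lemma surviving_insert_pick:
  assumes "j \<notin> U" "j < 2 * n"
  shows "surviving (insert j U) \<pi> (fun_upd \<omega> j k) \<subseteq> surviving U \<pi> \<omega>"
  using conn_mono[of "selected U \<omega>" "sel j k \<union> selected U \<omega>" \<pi>] assms
  by (auto simp: surviving_def selected_insert)

text \<open>The selected edge is recorded by merging the classes of its ends. If \<open>j\<close> is
  the coordinate of an edge, that edge is \<open>e\<close> itself; its ends are connected now, so
  dropping \<open>j\<close> from the hidden coordinates loses nothing.\<close>

lemma surviving_insert_merge:
  assumes "j \<notin> U" "e \<in> sel j k" "inc v e" "inc w e"
  shows "surviving (insert j U) \<pi> (fun_upd \<omega> j k) \<subseteq> surviving U (merge \<pi> (\<pi> v) (\<pi> w)) \<omega>"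
proof -
  have "insert e (selected U \<omega>) \<subseteq> sel j k \<union> selected U \<omega>"
    using assms(2) by auto
  then have sub: "conn \<pi> (insert e (selected U \<omega>)) \<subseteq> conn \<pi> (sel j k \<union> selected U \<omega>)"
    by (rule conn_mono)
  have "(a e', b e') \<in> conn \<pi> (sel j k \<union> selected U \<omega>)" if "2 * n + e' = j" "e' < m" for e'
  proof -
    have "e' = e" using that assms(2) by (auto simp: sel_def split: if_splits)
    then show ?thesis
      using assms(2) by (intro conn_edge[of e]) (auto simp: inc_def)
  qed
  then show ?thesis
    using assms conn_merge[OF assms(3,4), of \<pi> "selected U \<omega>"] sub
    by (auto simp: surviving_def selected_insert)
qed

text \<open>Dropping the coordinate of \<open>e\<close> also stops counting \<open>e\<close>, hence
  the extra element unless its ends already share a class.\<close>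

lemma surviving_insert_edge:
  assumes "j \<notin> U" "j = 2 * n + e"
  shows "surviving (insert j U) \<pi> (fun_upd \<omega> j k) \<subseteq> insert e (surviving U \<pi> \<omega>)"
    and "\<pi> (a e) = \<pi> (b e) \<Longrightarrow> surviving (insert j U) \<pi> (fun_upd \<omega> j k) \<subseteq> surviving U \<pi> \<omega>"
  using conn_mono[of "selected U \<omega>" "sel j k \<union> selected U \<omega>" \<pi>] assms conn_same
  by (auto simp: surviving_def selected_insert)

section \<open>Edges passed over per merge of classes\<close>

definition classes :: "(nat \<Rightarrow> nat) \<Rightarrow> nat set" where
  "classes \<pi> = \<pi> ` {..<n}"

lemma finite_classes [simp]: "finite (classes \<pi>)"
  by (simp add: classes_def)

lemma classes_merge:
  assumes "v < n" "w < n" "\<pi> v \<noteq> \<pi> w"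
  shows "classes (merge \<pi> (\<pi> v) (\<pi> w)) = classes \<pi> - {\<pi> v}"
  using assms unfolding classes_def merge_def by (auto simp: image_iff)

lemma esurv_mono_insert:
  assumes "finite U" "j \<notin> U"
    and "\<And>k. k \<le> bnd j \<Longrightarrow> esurv_given U j k \<pi> \<le> f k"
  shows "esurv (insert j U) \<pi> \<le> (\<Sum>k\<le>bnd j. f k) / real (Suc (bnd j))"
  unfolding esurv_def sample_insert[OF assms(1,2)]
  using assms(3) by (intro divide_right_mono sum_mono) auto

lemma esurv_insert_le:
  assumes "finite U" "\<And>\<omega>. surviving (insert j U) \<pi> (fun_upd \<omega> j k) \<subseteq> surviving U \<pi>' \<omega>"
  shows "esurv_given U j k \<pi> \<le> esurv U \<pi>'"
  unfolding esurv_def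
  using assms by (intro expectation_mono) (auto intro!: card_mono)

text \<open>An edge between two classes is selected, and then merges them, with probability
  \<open>1 / (2 * \<delta>)\<close>; so an expected number of at most \<open>2 * \<delta>\<close> such edges are passed over
  per merge.  This is the sampling lemma of Karger, Klein and Tarjan.\<close>

lemma esurv_le_classes:
  assumes "finite U" "U \<subseteq> {..<2 * n + m}"
  shows "esurv U \<pi> \<le> 2 * real \<delta> * real (card (classes \<pi>))"
  using assms
proof (induction U arbitrary: \<pi> rule: finite_induct)
  case empty
  then show ?case by (simp add: esurv_def surviving_def)
next
  case (insert j U)
  note IH = insert.IH
  have U: "U \<subseteq> {..<2 * n + m}" using insert.prems by auto
  consider "j < 2 * n" | e where "j = 2 * n + e" "e < m" "\<pi> (a e) = \<pi> (b e)"
    | e where "j = 2 * n + e" "e < m" "\<pi> (a e) \<noteq> \<pi> (b e)"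
    using insert.prems by (metis insert_subset lessThan_iff linorder_not_less nat_le_iff_add nat_add_left_cancel_less)
  then show ?case
  proof cases
    case 1
    have "esurv (insert j U) \<pi> \<le> (\<Sum>k\<le>bnd j. esurv U \<pi>) / real (Suc (bnd j))"
      using insert.hyps 1 by (intro esurv_mono_insert esurv_insert_le surviving_insert_pick) auto
    then show ?thesis using IH[OF U, of \<pi>] by simp
  next
    case 2
    have "esurv (insert j U) \<pi> \<le> (\<Sum>k\<le>bnd j. esurv U \<pi>) / real (Suc (bnd j))"
      using insert.hyps 2 by (intro esurv_mono_insert esurv_insert_le surviving_insert_edge) auto
    then show ?thesis using IH[OF U, of \<pi>] by simp
  next
    case 3
    let ?\<mu> = "merge \<pi> (\<pi> (a e)) (\<pi> (b e))" and ?N = "real (card (classes \<pi>))"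
    have "esurv_given U j k \<pi>
      \<le> (if k = 0 then esurv U ?\<mu> else 1 + esurv U \<pi>)" for k
    proof (cases "k = 0")
      case True
      then show ?thesis
        using insert.hyps 3 esurv_insert_le[OF insert.hyps(1), of j \<pi> k ?\<mu>]
          surviving_insert_merge[OF insert.hyps(2), of e 0 "a e" "b e" \<pi>]
        by (auto simp: sel_def inc_def)
    next
      case False
      have "real (card (surviving (insert j U) \<pi> (fun_upd \<omega> j k))) \<le> 1 + real (card (surviving U \<pi> \<omega>))" for \<omega>
      proof -
        have "card (surviving (insert j U) \<pi> (fun_upd \<omega> j k)) \<le> card (insert e (surviving U \<pi> \<omega>))"
          using insert.hyps 3 by (intro card_mono surviving_insert_edge) auto
        also have "\<dots> \<le> 1 + card (surviving U \<pi> \<omega>)"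
          by (simp add: card_insert_if)
        finally show ?thesis by linarith
      qed
      then have "esurv_given U j k \<pi>
        \<le> measure_pmf.expectation (sample U) (\<lambda>\<omega>. 1 + real (card (surviving U \<pi> \<omega>)))"
        using insert.hyps(1) by (intro expectation_mono) auto
      also have "\<dots> = 1 + esurv U \<pi>"
        using insert.hyps(1) by (simp add: esurv_def integrable_measure_pmf_finite)
      finally show ?thesis using False by simp
    qed
    then have "esurv (insert j U) \<pi> \<le>
      (\<Sum>k\<le>bnd j. if k = 0 then esurv U ?\<mu> else 1 + esurv U \<pi>) / real (Suc (bnd j))"
      using insert.hyps by (intro esurv_mono_insert) auto
    also have "(\<Sum>k\<le>bnd j. if k = 0 then esurv U ?\<mu> else 1 + esurv U \<pi>)
      = esurv U ?\<mu> + real (bnd j) * (1 + esurv U \<pi>)"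
      by (subst sum.atMost_shift) simp
    also have "Suc (bnd j) = 2 * \<delta>"
      using 3 \<delta>_pos by (simp add: bnd_def)
    also have "real (bnd j) = 2 * real \<delta> - 1"
      using 3 \<delta>_pos by (simp add: bnd_def of_nat_diff)
    finally have le: "esurv (insert j U) \<pi> \<le> (esurv U ?\<mu> + (2 * real \<delta> - 1) * (1 + esurv U \<pi>)) / (2 * real \<delta>)"
      by simp
    have "\<pi> (a e) \<in> classes \<pi>"
      using 3 a_less by (auto simp: classes_def)
    then have "card (classes ?\<mu>) = card (classes \<pi>) - 1" "card (classes \<pi>) \<ge> 1"
      using 3 a_less b_less by (auto simp: classes_merge Suc_le_eq card_gt_0_iff)
    then have "real (card (classes ?\<mu>)) = ?N - 1"
      by simp
    then have "esurv U ?\<mu> \<le> 2 * real \<delta> * (?N - 1)"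
      using IH[OF U, of ?\<mu>] by simp
    moreover have "(2 * real \<delta> - 1) * (1 + esurv U \<pi>) \<le> (2 * real \<delta> - 1) * (1 + 2 * real \<delta> * ?N)"
      using IH[OF U, of \<pi>] \<delta>_pos by (intro mult_left_mono) auto
    \<comment> \<open>With N classes the left side is at most 2 * \<delta> * (N - 1) + (2 * \<delta>
      - 1) * (1 + 2 * \<delta> * N) = 4 * \<delta> * \<delta> * N - 1: the class lost by the merge
      pays for the edge that may be passed over.\<close>
    ultimately have "esurv U ?\<mu> + (2 * real \<delta> - 1) * (1 + esurv U \<pi>) \<le> (2 * real \<delta> * ?N) * (2 * real \<delta>)"
      by (simp add: algebra_simps)
    then have "(esurv U ?\<mu> + (2 * real \<delta> - 1) * (1 + esurv U \<pi>)) / (2 * real \<delta>)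
      \<le> (2 * real \<delta> * ?N) * (2 * real \<delta>) / (2 * real \<delta>)"
      by (rule divide_right_mono) simp
    with le show ?thesis
      using \<delta>_pos by simp
  qed
qed

text \<open>\<open>\<phi> x u\<close> bounds the expected number of classes that get stuck, that is, exhaust their picks
  while having at most \<open>\<delta> / 4\<close> nodes, and that stem from a class of \<open>x\<close> nodes with \<open>u\<close> hidden
  picks.  Such a class has seen \<open>x + 1 - u\<close> failures, picks that led back into the class;
  \<open>x < u\<close> means that there has been none.  A pick fails with probability at most \<open>x / \<delta>\<close>.\<close>

definition \<phi> :: "nat \<Rightarrow> nat \<Rightarrow> real" where
  "\<phi> x u = (if \<delta> < 4 * x then 0 else if x < u then 2 * real x / (2 ^ x * real \<delta>)
            else if u = 0 then 1 else 2 / 2 ^ u)"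

lemma \<phi>_nonneg: "0 \<le> \<phi> x u"
  by (simp add: \<phi>_def)

text \<open>A failure has probability at most \<open>x / \<delta>\<close>, here at most 1/4, and
  losing one hidden pick at most doubles \<open>\<phi>\<close>, so half of \<open>\<phi> x u\<close>
  covers it. Before the first failure \<open>u = x + 1\<close>, and the value 2 * x / (2 ^ x *
  \<delta>) is chosen to be exactly x / \<delta> times \<open>\<phi> x x\<close>.\<close>

lemma \<phi>_loss_le:
  assumes "1 \<le> x" "1 \<le> u" "u \<le> x + 1" "4 * x \<le> \<delta>"
  shows "real x / real \<delta> * \<phi> x (u - 1) \<le> (if u \<le> x then \<phi> x u / 2 else \<phi> x u)"
proof (cases "u \<le> x")
  case True
  have "\<phi> x (u - 1) \<le> 2 * \<phi> x u"
    using assms True by (cases u) (auto simp: \<phi>_def)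
  moreover have "real x / real \<delta> \<le> 1 / 4"
    using assms by (simp add: field_simps)
  ultimately have "real x / real \<delta> * \<phi> x (u - 1) \<le> 1 / 4 * (2 * \<phi> x u)"
    by (intro mult_mono) (auto simp: \<phi>_nonneg)
  then show ?thesis using True by simp
next
  case False
  then have "u = x + 1" using assms by simp
  then show ?thesis using assms by (simp add: \<phi>_def mult.commute)
qed

lemma \<phi>_loss:
  assumes "1 \<le> x" "1 \<le> u" "u \<le> x + 1" "4 * x \<le> \<delta>"
  shows "real x / real \<delta> * \<phi> x (u - 1) \<le> \<phi> x u"
  by (rule order_trans[OF \<phi>_loss_le[OF assms]]) (simp add: \<phi>_nonneg)

text \<open>A successful pick unites two classes and is spent, and the potential must still drop by
  the share reserved for failures. If \<open>u \<le> x\<close>, half of \<open>\<phi> x u\<close> is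
  left to pay for the union. If \<open>u = x + 1\<close>, all of \<open>\<phi> x u\<close> may go
  into the loss, so the other class alone has to pay.\<close>

lemma \<phi>_merge:
  assumes "1 \<le> x" "1 \<le> y" "1 \<le> u" "u \<le> x + 1" "v \<le> y + 1" "4 * x \<le> \<delta>"
  shows "\<phi> (x + y) (u - 1 + v) \<le> \<phi> x u + \<phi> y v - real x / real \<delta> * \<phi> x (u - 1)"
proof (cases "\<delta> < 4 * (x + y)")
  case True
  then show ?thesis
    using \<phi>_loss[OF assms(1,3,4,6)] \<phi>_nonneg[of y v] by (simp add: \<phi>_def[of "x + y"])
next
  case small: False
  show ?thesis
  proof (cases "u \<le> x")
    case ux: True
    have "\<phi> (x + y) (u - 1 + v) \<le> \<phi> y v + \<phi> x u / 2"
    proof (cases "v \<le> y")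
      case True
      have "\<phi> (x + y) (u - 1 + v) \<le> \<phi> y v"
      proof (cases "v = 0")
        case True
        have "(2::real) / 2 ^ (u - 1) \<le> 1" if "u \<ge> 2"
          using that by (cases "u - 1") (auto simp: field_simps)
        then show ?thesis using True small ux assms
          by (cases "u = 1") (auto simp: \<phi>_def)
      next
        case False
        have "(2::real) / 2 ^ (u - 1 + v) \<le> 2 / 2 ^ v"
          by (intro divide_left_mono power_increasing) auto
        moreover have "\<not> x + y < u - 1 + v"
          using True ux assms by linarith
        ultimately show ?thesis using True False small by (simp add: \<phi>_def)
      qed
      then show ?thesis using \<phi>_nonneg[of x u] by simp
    next
      case False
      then have v: "v = y + 1" using assms by simp
      \<comment> \<open>The \<open>y + 1\<close> hidden picks of the other class outnumber the spent
        one by \<open>y \<ge> 1\<close>, which halves the potential.\<close>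
      have "(2::real) / 2 ^ (u + y) \<le> 2 / 2 ^ (u + 1)"
        using assms by (intro divide_left_mono power_increasing) auto
      then have "\<phi> (x + y) (u + y) \<le> \<phi> x u / 2"
        using small ux assms by (simp add: \<phi>_def)
      moreover have "u - 1 + v = u + y" using v assms by simp
      ultimately show ?thesis using \<phi>_nonneg[of y v] by simp
    qed
    then show ?thesis
      using \<phi>_loss_le[OF assms(1,3,4,6)] ux by simp
  next
    case False
    then have u: "u = x + 1" using assms by simp
    have "\<phi> (x + y) (x + v) \<le> \<phi> y v"
    proof (cases "v \<le> y")
      case True
      show ?thesis
      proof (cases "v = 0")
        case True
        have "(2::real) / 2 ^ x \<le> 1"
          using assms by (cases x) auto
        then show ?thesis using True small assms by (simp add: \<phi>_def)
      next
        case False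
        have "(2::real) / 2 ^ (x + v) \<le> 2 / 2 ^ v"
          by (intro divide_left_mono power_increasing) auto
        then show ?thesis using True False small assms by (simp add: \<phi>_def)
      qed
    next
      case False
      then have v: "v = y + 1" using assms by simp
      \<comment> \<open>Neither class has failed yet. The claim then amounts to
        \<open>x + y \<le> y * 2 ^ x\<close>, which follows from this and
        \<open>y \<ge> 1\<close>.\<close>
      have "x + 1 \<le> 2 ^ x"
        by (induction x) auto
      then have "y * (x + 1) \<le> y * 2 ^ x" by (rule mult_le_mono2)
      moreover have "x + y \<le> y * (x + 1)" using assms by simp
      ultimately have "x + y \<le> y * 2 ^ x" by linarith
      then have "real (x + y) \<le> real (y * 2 ^ x)" by (simp only: of_nat_le_iff)
      then have "2 * real (x + y) / (2 ^ (x + y) * real \<delta>) \<le> 2 * real (y * 2 ^ x) / (2 ^ (x + y) * real \<delta>)"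
        by (intro divide_right_mono mult_left_mono) auto
      also have "\<dots> = 2 * real y / (2 ^ y * real \<delta>)"
        by (simp add: power_add field_simps)
      finally show ?thesis using v small assms by (simp add: \<phi>_def)
    qed
    then show ?thesis
      using \<phi>_loss_le[OF assms(1,3,4,6)] u by simp
  qed
qed

section \<open>The total potential over all classes\<close>

definition csize :: "(nat \<Rightarrow> nat) \<Rightarrow> nat \<Rightarrow> nat" where
  "csize \<pi> c = card {x. x < n \<and> \<pi> x = c}"

definition hidden :: "nat set \<Rightarrow> (nat \<Rightarrow> nat) \<Rightarrow> nat \<Rightarrow> nat" where
  "hidden U \<pi> c = card {j \<in> U. j < 2 * n \<and> \<pi> (j mod n) = c}"

definition \<Phi> :: "nat set \<Rightarrow> (nat \<Rightarrow> nat) \<Rightarrow> real" where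
  "\<Phi> U \<pi> = (\<Sum>c\<in>classes \<pi>. \<phi> (csize \<pi> c) (hidden U \<pi> c))"

lemma hidden_insert:
  assumes "finite U" "j \<notin> U" "j < 2 * n"
  shows "hidden (insert j U) \<pi> c = (if \<pi> (j mod n) = c then Suc (hidden U \<pi> c) else hidden U \<pi> c)"
proof -
  have "{i \<in> insert j U. i < 2 * n \<and> \<pi> (i mod n) = c} =
    (if \<pi> (j mod n) = c then insert j {i \<in> U. i < 2 * n \<and> \<pi> (i mod n) = c}
     else {i \<in> U. i < 2 * n \<and> \<pi> (i mod n) = c})"
    using assms by auto
  then show ?thesis
    using assms by (simp add: hidden_def)
qed

lemma csize_merge:
  "c \<noteq> d \<Longrightarrow> k \<noteq> c \<Longrightarrow> csize (merge \<pi> c d) k = (if k = d then csize \<pi> c + csize \<pi> d else csize \<pi> k)"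
proof -
  assume "c \<noteq> d" "k \<noteq> c"
  then have "{x. x < n \<and> merge \<pi> c d x = k} =
    (if k = d then {x. x < n \<and> \<pi> x = c} \<union> {x. x < n \<and> \<pi> x = d} else {x. x < n \<and> \<pi> x = k})"
    by (auto simp: merge_def)
  moreover have "card ({x. x < n \<and> \<pi> x = c} \<union> {x. x < n \<and> \<pi> x = d})
      = card {x. x < n \<and> \<pi> x = c} + card {x. x < n \<and> \<pi> x = d}"
    using \<open>c \<noteq> d\<close> by (intro card_Un_disjoint) auto
  ultimately show ?thesis
    unfolding csize_def by (cases "k = d") (simp_all only: if_True if_False refl)
qed

lemma hidden_merge:
  "finite U \<Longrightarrow> c \<noteq> d \<Longrightarrow> k \<noteq> c \<Longrightarrow>
    hidden U (merge \<pi> c d) k = (if k = d then hidden U \<pi> c + hidden U \<pi> d else hidden U \<pi> k)"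
proof -
  assume "finite U" "c \<noteq> d" "k \<noteq> c"
  then have "{j \<in> U. j < 2 * n \<and> merge \<pi> c d (j mod n) = k} =
    (if k = d then {j \<in> U. j < 2 * n \<and> \<pi> (j mod n) = c} \<union> {j \<in> U. j < 2 * n \<and> \<pi> (j mod n) = d}
     else {j \<in> U. j < 2 * n \<and> \<pi> (j mod n) = k})"
    by (auto simp: merge_def)
  moreover have "card ({j \<in> U. j < 2 * n \<and> \<pi> (j mod n) = c} \<union> {j \<in> U. j < 2 * n \<and> \<pi> (j mod n) = d})
      = card {j \<in> U. j < 2 * n \<and> \<pi> (j mod n) = c} + card {j \<in> U. j < 2 * n \<and> \<pi> (j mod n) = d}"
    using \<open>c \<noteq> d\<close> \<open>finite U\<close> by (intro card_Un_disjoint) auto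
  ultimately show ?thesis
    unfolding hidden_def by (cases "k = d") (simp_all only: if_True if_False refl)
qed

lemma csize_pos: "c \<in> classes \<pi> \<Longrightarrow> 1 \<le> csize \<pi> c"
  by (auto simp: classes_def csize_def Suc_le_eq card_gt_0_iff)

lemma \<Phi>_insert:
  assumes "finite U" "j \<notin> U" "j < 2 * n" "c = \<pi> (j mod n)" "c \<in> classes \<pi>"
  shows "\<Phi> (insert j U) \<pi> = \<Phi> U \<pi> + \<phi> (csize \<pi> c) (Suc (hidden U \<pi> c)) - \<phi> (csize \<pi> c) (hidden U \<pi> c)"
proof -
  have "\<Phi> (insert j U) \<pi> = \<phi> (csize \<pi> c) (Suc (hidden U \<pi> c))
      + (\<Sum>k\<in>classes \<pi> - {c}. \<phi> (csize \<pi> k) (hidden (insert j U) \<pi> k))"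
    unfolding \<Phi>_def using assms by (subst sum.remove[OF _ assms(5)]) (simp_all add: hidden_insert)
  also have "(\<Sum>k\<in>classes \<pi> - {c}. \<phi> (csize \<pi> k) (hidden (insert j U) \<pi> k))
      = (\<Sum>k\<in>classes \<pi> - {c}. \<phi> (csize \<pi> k) (hidden U \<pi> k))"
    using assms by (intro sum.cong) (auto simp: hidden_insert)
  also have "\<dots> = \<Phi> U \<pi> - \<phi> (csize \<pi> c) (hidden U \<pi> c)"
    unfolding \<Phi>_def by (subst sum.remove[OF _ assms(5)]) simp_all
  finally show ?thesis by simp
qed

lemma \<Phi>_merge:
  assumes "finite U" "v < n" "w < n" "c = \<pi> v" "d = \<pi> w" "c \<noteq> d"
  shows "\<Phi> U (merge \<pi> c d) = \<Phi> U \<pi> - \<phi> (csize \<pi> c) (hidden U \<pi> c) - \<phi> (csize \<pi> d) (hidden U \<pi> d)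
    + \<phi> (csize \<pi> c + csize \<pi> d) (hidden U \<pi> c + hidden U \<pi> d)"
proof -
  have c: "c \<in> classes \<pi>" and d: "d \<in> classes \<pi> - {c}"
    using assms by (auto simp: classes_def)
  have "\<Phi> U (merge \<pi> c d) = (\<Sum>k\<in>classes \<pi> - {c}. \<phi> (if k = d then csize \<pi> c + csize \<pi> d else csize \<pi> k)
     (if k = d then hidden U \<pi> c + hidden U \<pi> d else hidden U \<pi> k))"
    unfolding \<Phi>_def using assms
    by (auto simp: classes_merge csize_merge hidden_merge intro!: sum.cong)
  also have "\<dots> = \<phi> (csize \<pi> c + csize \<pi> d) (hidden U \<pi> c + hidden U \<pi> d)
      + (\<Sum>k\<in>classes \<pi> - {c} - {d}. \<phi> (csize \<pi> k) (hidden U \<pi> k))"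
    by (subst sum.remove[OF _ d]) (auto intro!: sum.cong)
  also have "(\<Sum>k\<in>classes \<pi> - {c} - {d}. \<phi> (csize \<pi> k) (hidden U \<pi> k))
      = \<Phi> U \<pi> - \<phi> (csize \<pi> c) (hidden U \<pi> c) - \<phi> (csize \<pi> d) (hidden U \<pi> d)"
    unfolding \<Phi>_def by (subst sum.remove[OF _ c], simp, subst sum.remove[OF _ d]) simp_all
  finally show ?thesis by simp
qed

lemma sum_csize: "(\<Sum>c\<in>classes \<pi>. csize \<pi> c) = n"
proof -
  have "(\<Sum>c\<in>classes \<pi>. csize \<pi> c) = card (\<Union>c\<in>classes \<pi>. {x. x < n \<and> \<pi> x = c})"
    unfolding csize_def by (subst card_UN_disjoint) auto
  also have "(\<Union>c\<in>classes \<pi>. {x. x < n \<and> \<pi> x = c}) = {..<n}"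
    by (auto simp: classes_def)
  finally show ?thesis by simp
qed

text \<open>Hidden picks of a small class are revealed one at a time, in an order that depends on the
  outcomes so far; the potential \<open>\<Phi>\<close> does not increase in expectation.\<close>

lemma esurv_le_potential:
  assumes "finite U" "U \<subseteq> {..<2 * n + m}" "\<And>c. c \<in> classes \<pi> \<Longrightarrow> hidden U \<pi> c \<le> csize \<pi> c + 1"
  shows "esurv U \<pi> \<le> 2 * real \<delta> * (\<Phi> U \<pi> + 4 * real n / real \<delta>)"
  using assms
proof (induction "card U" arbitrary: U \<pi> rule: less_induct)
  case less
  show ?case
  proof (cases "\<exists>j\<in>U. j < 2 * n \<and> 4 * csize \<pi> (\<pi> (j mod n)) \<le> \<delta>")
    case False
    \<comment> \<open>No small class has a hidden pick left: each class is either stuck, with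
      \<open>\<phi>\<close> equal to 1, or has more than \<delta> / 4 nodes. Summing bounds the
      number of classes, to which \<open>esurv_le_classes\<close> applies.\<close>
    have "1 \<le> \<phi> (csize \<pi> c) (hidden U \<pi> c) + 4 / real \<delta> * real (csize \<pi> c)" if "c \<in> classes \<pi>" for c
    proof (cases "\<delta> < 4 * csize \<pi> c")
      case True
      then show ?thesis using \<delta>_pos by (simp add: \<phi>_def field_simps)
    next
      case small: False
      then have "{j \<in> U. j < 2 * n \<and> \<pi> (j mod n) = c} = {}"
        using False by auto
      then have "hidden U \<pi> c = 0"
        by (simp add: hidden_def)
      then show ?thesis using small by (simp add: \<phi>_def)
    qed
    then have "(\<Sum>c\<in>classes \<pi>. 1) \<le> (\<Sum>c\<in>classes \<pi>. \<phi> (csize \<pi> c) (hidden U \<pi> c) + 4 / real \<delta> * real (csize \<pi> c))"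
      by (rule sum_mono)
    also have "\<dots> = \<Phi> U \<pi> + 4 / real \<delta> * real n"
      unfolding sum.distrib \<Phi>_def sum_distrib_left[symmetric] of_nat_sum[symmetric] sum_csize by simp
    finally have "real (card (classes \<pi>)) \<le> \<Phi> U \<pi> + 4 * real n / real \<delta>"
      by simp
    then have "2 * real \<delta> * real (card (classes \<pi>)) \<le> 2 * real \<delta> * (\<Phi> U \<pi> + 4 * real n / real \<delta>)"
      by (intro mult_left_mono) auto
    then show ?thesis
      using esurv_le_classes[OF less.prems(1,2), of \<pi>] by linarith
  next
    case True
    then obtain j where j: "j \<in> U" "j < 2 * n" "4 * csize \<pi> (\<pi> (j mod n)) \<le> \<delta>" by blast
    define V where "V = U - {j}"
    have V: "finite V" "j \<notin> V" "U = insert j V" "V \<subseteq> {..<2 * n + m}" "card V < card U"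
      using j less.prems card_gt_0_iff[of U] by (auto simp: V_def)
    define v where "v = j mod n"
    define c where "c = \<pi> v"
    define x where "x = csize \<pi> c"
    define u where "u = hidden V \<pi> c"
    have v: "v < n" using j by (simp add: v_def)
    have c: "c \<in> classes \<pi>" using v by (auto simp: classes_def c_def)
    have x: "1 \<le> x" "4 * x \<le> \<delta>" using csize_pos[OF c] j by (auto simp: x_def c_def v_def)
    have hU: "hidden U \<pi> k = (if c = k then Suc (hidden V \<pi> k) else hidden V \<pi> k)" for k
      using hidden_insert[OF V(1,2) j(2), of \<pi> k] V(3) by (simp add: c_def v_def)
    have u: "u \<le> x"
      using less.prems(3)[OF c] hU[of c] by (simp add: u_def x_def)
    have \<Phi>U: "\<Phi> U \<pi> = \<Phi> V \<pi> + \<phi> x (Suc u) - \<phi> x u"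
      using \<Phi>_insert[OF V(1,2) j(2) _ c] V(3) by (simp add: c_def v_def x_def u_def)
    \<comment> \<open>An upper bound for the contribution of failures to the expected potential. It
      is taken off the bound \<open>R\<close> of every outcome; the amount that failures add on top
      of \<open>R\<close> averages to at most \<open>2 * \<delta> * loss\<close> again.\<close>
    define loss where "loss = real x / real \<delta> * \<phi> x u"
    have loss: "loss \<le> \<phi> x (Suc u)"
      using \<phi>_loss[of x "Suc u"] x u by (simp add: loss_def)
    define ed where "ed k = inv_into {e. e < m \<and> inc v e} (rank v) k" for k
    have ed: "ed k < m" "inc v (ed k)" "rank v (ed k) = k" if "k < deg v" for k
    proof -
      have "k \<in> rank v ` {e. e < m \<and> inc v e}"
        using that rank_bij[of v] by (simp add: bij_betw_def)
      then show "ed k < m" "inc v (ed k)" "rank v (ed k) = k"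
        using inv_into_into[of k "rank v" "{e. e < m \<and> inc v e}"]
        by (auto simp: ed_def f_inv_into_f)
    qed
    \<comment> \<open>The failures: picks whose edge leads back into the class of
      \<open>v\<close>.\<close>
    define K where "K = {k. k < deg v \<and> \<pi> (opp v (ed k)) = c}"
    define R where "R = 2 * real \<delta> * (\<Phi> U \<pi> + 4 * real n / real \<delta> - loss)"
    have step: "esurv_given V j k \<pi>
        \<le> R + (if k \<in> K then 2 * real \<delta> * \<phi> x u else 0)" if k: "k < deg v" for k
    proof (cases "k \<in> K")
      case True
      have "esurv_given V j k \<pi>
        \<le> esurv V \<pi>"
        using V j by (intro esurv_insert_le surviving_insert_pick)
      also have "\<dots> \<le> 2 * real \<delta> * (\<Phi> V \<pi> + 4 * real n / real \<delta>)"
      proof (rule less.hyps[OF V(5,1,4)])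
        show "hidden V \<pi> k \<le> csize \<pi> k + 1" if "k \<in> classes \<pi>" for k
          using less.prems(3)[OF that] hU[of k] by (simp split: if_splits)
      qed
      also have "\<dots> \<le> R + 2 * real \<delta> * \<phi> x u"
        using mult_left_mono[OF loss, of "2 * real \<delta>"] by (simp add: R_def \<Phi>U algebra_simps)
      finally show ?thesis using True by simp
    next
      case False
      define w where "w = opp v (ed k)"
      define d where "d = \<pi> w"
      have w: "w < n" using ed[OF k] by (simp add: w_def opp_less)
      have cd: "c \<noteq> d" using False k by (auto simp: K_def w_def d_def)
      have d: "d \<in> classes \<pi>" using w by (auto simp: classes_def d_def)
      have incw: "inc w (ed k)" by (auto simp: w_def opp_def inc_def)
      let ?\<mu> = "merge \<pi> c d"
      have "ed k \<in> sel j k"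
        using ed[OF k] j by (simp add: sel_def v_def)
      then have "esurv_given V j k \<pi>
        \<le> esurv V ?\<mu>"
        unfolding c_def d_def using V ed[OF k] incw by (intro esurv_insert_le surviving_insert_merge) auto
      also have "\<dots> \<le> 2 * real \<delta> * (\<Phi> V ?\<mu> + 4 * real n / real \<delta>)"
      proof (rule less.hyps[OF V(5,1,4)])
        show "hidden V ?\<mu> k \<le> csize ?\<mu> k + 1" if "k \<in> classes ?\<mu>" for k
        proof -
          have k: "k \<in> classes \<pi>" "k \<noteq> c"
            using that classes_merge[OF v w, of \<pi>] cd by (auto simp: c_def d_def)
          show ?thesis
            using less.prems(3)[OF k(1)] hU[of k] less.prems(3)[OF c] hU[of c] k(2)
            by (cases "k = d") (simp_all add: hidden_merge[OF V(1) cd] csize_merge[OF cd])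
        qed
      qed
      also have "\<Phi> V ?\<mu> \<le> \<Phi> U \<pi> - loss"
      proof -
        have "1 \<le> csize \<pi> d" "hidden V \<pi> d \<le> csize \<pi> d + 1"
          using csize_pos[OF d] less.prems(3)[OF d] hU[of d] cd by auto
        then have "\<phi> (x + csize \<pi> d) (u + hidden V \<pi> d) \<le> \<phi> x (Suc u) + \<phi> (csize \<pi> d) (hidden V \<pi> d) - loss"
          using \<phi>_merge[of x "csize \<pi> d" "Suc u" "hidden V \<pi> d"] x u by (simp add: loss_def)
        moreover have "\<Phi> V ?\<mu> = \<Phi> V \<pi> - \<phi> x u - \<phi> (csize \<pi> d) (hidden V \<pi> d)
          + \<phi> (x + csize \<pi> d) (u + hidden V \<pi> d)"
          using \<Phi>_merge[OF V(1) v w c_def d_def cd] by (simp add: x_def u_def)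
        ultimately show ?thesis
          using \<Phi>U by linarith
      qed
      then have "2 * real \<delta> * (\<Phi> V ?\<mu> + 4 * real n / real \<delta>) \<le> R"
        unfolding R_def by (intro mult_left_mono) auto
      finally show ?thesis using False by simp
    qed
    have "\<delta> \<le> deg v" using v by (rule \<delta>_le)
    then have dv: "Suc (bnd j) = deg v" "0 < deg v"
      using j \<delta>_pos by (auto simp: bnd_def v_def)
    have "esurv U \<pi> \<le> (\<Sum>k\<le>bnd j. R + (if k \<in> K then 2 * real \<delta> * \<phi> x u else 0)) / real (Suc (bnd j))"
      unfolding V(3) by (intro esurv_mono_insert V step) (use dv in auto)
    also have "{..bnd j} = {..<deg v}"
      using dv by auto
    also have "(\<Sum>k<deg v. R + (if k \<in> K then 2 * real \<delta> * \<phi> x u else 0))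
      = real (deg v) * R + (\<Sum>k<deg v. if k \<in> K then 2 * real \<delta> * \<phi> x u else 0)"
      by (simp add: sum.distrib)
    also have "(\<Sum>k<deg v. if k \<in> K then 2 * real \<delta> * \<phi> x u else 0) = real (card K) * (2 * real \<delta> * \<phi> x u)"
    proof -
      have "{..<deg v} \<inter> K = K" by (auto simp: K_def)
      then show ?thesis by (simp flip: sum.inter_restrict)
    qed
    also have "Suc (bnd j) = deg v" by (rule dv)
    finally have "esurv U \<pi> \<le> R + real (card K) / real (deg v) * (2 * real \<delta> * \<phi> x u)"
      using dv by (simp add: add_divide_distrib)
    also have "real (card K) / real (deg v) \<le> real x / real \<delta>"
    proof (rule frac_le)
      \<comment> \<open>In a simple graph different ranks lead to different neighbours, so at most
        \<open>x\<close> picks end in a class of \<open>x\<close> nodes.\<close>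
      have "inj_on (\<lambda>k. opp v (ed k)) {k. k < deg v}"
      proof (rule inj_onI)
        fix k k' assume *: "k \<in> {k. k < deg v}" "k' \<in> {k. k < deg v}" "opp v (ed k) = opp v (ed k')"
        then have "ed k = ed k'"
          using inj_onD[OF opp_inj, of v "ed k" "ed k'"] ed by auto
        then show "k = k'" using * ed by (metis mem_Collect_eq)
      qed
      then have "inj_on (\<lambda>k. opp v (ed k)) K"
        by (rule inj_on_subset) (auto simp: K_def)
      then have "card K \<le> card {y. y < n \<and> \<pi> y = c}"
        by (rule card_inj_on_le) (auto simp: K_def opp_less ed)
      then show "real (card K) \<le> real x" by (simp add: x_def csize_def)
    qed (use \<open>\<delta> \<le> deg v\<close> \<delta>_pos in auto)
    then have "real (card K) / real (deg v) * (2 * real \<delta> * \<phi> x u) \<le> real x / real \<delta> * (2 * real \<delta> * \<phi> x u)"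
      by (intro mult_right_mono) (auto simp: \<phi>_nonneg)
    also have "\<dots> = 2 * real \<delta> * loss"
      by (simp add: loss_def)
    finally show ?thesis
      by (simp add: R_def algebra_simps)
  qed
qed

lemma esurv_le: "esurv {..<2 * n + m} id \<le> 10 * real n"
proof -
  have cl: "classes id = {..<n}" by (simp add: classes_def)
  have cs: "csize id c = 1" if "c < n" for c
  proof -
    have "{x. x < n \<and> id x = c} = {c}" using that by auto
    then show ?thesis by (simp add: csize_def)
  qed
  have hd: "hidden {..<2 * n + m} id c = 2" if "c < n" for c
  proof -
    have "j = c \<or> j = n + c" if "j < 2 * n" "j mod n = c" for j
    proof (cases "j < n")
      case False
      then have "j mod n = j - n"
        using that by (simp add: le_mod_geq)
      then show ?thesis using that False by simp
    qed (use that in simp)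
    then have "{j \<in> {..<2 * n + m}. j < 2 * n \<and> id (j mod n) = c} = {c, n + c}"
      using that by auto
    then show ?thesis using that by (simp add: hidden_def)
  qed
  \<comment> \<open>A single node with two hidden picks has potential \<open>\<phi> 1 2\<close>,
    which is 1 / \<delta>, or 0 if \<delta> < 4. Together with the term 4 * n / \<delta> for large
    classes this gives the factor 2 * (1 + 4) = 10.\<close>
  have "\<Phi> {..<2 * n + m} id \<le> (\<Sum>c<n. 1 / real \<delta>)"
    unfolding \<Phi>_def cl by (intro sum_mono) (simp add: cs hd \<phi>_def)
  then have "\<Phi> {..<2 * n + m} id \<le> real n / real \<delta>" by simp
  then have "2 * real \<delta> * (\<Phi> {..<2 * n + m} id + 4 * real n / real \<delta>) \<le> 2 * real \<delta> * (real n / real \<delta> + 4 * real n / real \<delta>)"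
    by (intro mult_left_mono) auto
  also have "\<dots> = 10 * real n"
    using \<delta>_pos by (simp add: field_simps)
  finally show ?thesis
    using esurv_le_potential[of "{..<2 * n + m}" id] by (force simp: cl cs hd)
qed

end

section \<open>Surviving cuts and repeated samples\<close>

text \<open>Turns a product of survival probabilities into the exponential of a sum; it is
  \<open>1 + y \<le> exp y\<close> at \<open>y = x / (1 - x)\<close>.\<close>

lemma exp_le_one_minus:
  fixes x \<eta> :: real
  assumes "0 \<le> x" "x \<le> 1 - \<eta>" "0 < \<eta>"
  shows "exp (- (x / \<eta>)) \<le> 1 - x"
proof -
  have pos: "0 < 1 - x" using assms by simp
  have "1 / (1 - x) = 1 + x / (1 - x)"
    using pos by (simp add: field_simps)
  also have "\<dots> \<le> exp (x / (1 - x))" by (rule exp_ge_add_one_self)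
  also have "x / (1 - x) \<le> x / \<eta>"
    using assms by (intro divide_left_mono) auto
  finally have "1 / (1 - x) \<le> exp (x / \<eta>)" by simp
  then show ?thesis
    using pos by (simp add: exp_minus field_simps)
qed

context sgraph
begin

lemma sum_incident:
  assumes "C \<subseteq> {..<m}"
  shows "(\<Sum>v<n. card {e \<in> C. inc v e}) = 2 * card C"
proof -
  have fin: "finite C" using assms finite_subset by auto
  have "(\<Sum>v<n. card {e \<in> C. inc v e}) = (\<Sum>v<n. \<Sum>e\<in>C. if inc v e then 1 else 0)"
    using fin by (simp add: sum.If_cases Int_def)
  also have "\<dots> = (\<Sum>e\<in>C. \<Sum>v<n. if inc v e then 1 else 0)"
    by (rule sum.swap)
  also have "\<dots> = (\<Sum>e\<in>C. 2)"
  proof (rule sum.cong)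
    fix e assume "e \<in> C"
    then have "e < m" using assms by auto
    then have "{..<n} \<inter> {v. inc v e} = {a e, b e}"
      using a_less b_less by (auto simp: inc_def)
    then show "(\<Sum>v<n. if inc v e then 1 else 0) = (2::nat)"
      using a_neq_b[OF \<open>e < m\<close>] by (simp add: sum.If_cases)
  qed simp
  finally show ?thesis by simp
qed

lemma conn_id_respects:
  assumes "(x, y) \<in> conn id D" "\<And>e. e \<in> D \<Longrightarrow> a e \<in> S \<longleftrightarrow> b e \<in> S"
  shows "x \<in> S \<longleftrightarrow> y \<in> S"
  using assms(1) unfolding conn_def
  by (induction rule: rtrancl_induct) (use assms(2) in \<open>auto simp: inc_def\<close>)

end

context sgraph_deg
begin

text \<open>Since the graph is simple, a class none of whose nodes has many incident edges outside \<open>D\<close>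
  contains many neighbours of each of its nodes.\<close>

lemma card_quotient_le:
  assumes r: "equiv {..<n} r" and D: "D \<subseteq> {..<m}" "\<And>e. e \<in> D \<Longrightarrow> (a e, b e) \<in> r"
  shows "real (card ({..<n} // r)) \<le> 2 / real \<delta> * (2 * real (card ({..<m} - D)) + real n)"
proof -
  define f where "f v = card {e \<in> {..<m} - D. inc v e}" for v
  \<comment> \<open>A charging argument: every class collects total weight at least 1 from its
    nodes. For any \<open>v\<close> in \<open>X\<close>, its edges in \<open>D\<close> lead to
    distinct nodes of \<open>X\<close>, so \<open>\<delta> \<le> f v + card X\<close>.\<close>
  have "1 \<le> (\<Sum>v\<in>X. 2 / real \<delta> * (real (f v) + 1))" if "X \<in> {..<n} // r" for X
  proof -
    have X: "X \<subseteq> {..<n}" "X \<noteq> {}"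
      using in_quotient_imp_subset[OF r that] in_quotient_imp_non_empty[OF r that] by auto
    have finX: "finite X" using X(1) finite_subset by auto
    obtain v where v: "v \<in> X" using X by auto
    have "\<delta> \<le> f v + card {e \<in> D. inc v e}"
    proof -
      have "{e. e < m \<and> inc v e} = {e \<in> {..<m} - D. inc v e} \<union> {e \<in> D. inc v e}"
        using D by auto
      then have "deg v \<le> f v + card {e \<in> D. inc v e}"
        unfolding deg_def f_def by (metis card_Un_le)
      then show ?thesis using \<delta>_le[of v] v X by auto
    qed
    also have "card {e \<in> D. inc v e} \<le> card X"
    proof (rule card_inj_on_le)
      show "inj_on (opp v) {e \<in> D. inc v e}"
        by (rule inj_on_subset[OF opp_inj]) (use D in auto)
      show "opp v ` {e \<in> D. inc v e} \<subseteq> X"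
      proof
        fix y assume "y \<in> opp v ` {e \<in> D. inc v e}"
        then obtain e where e: "e \<in> D" "inc v e" "y = opp v e" by auto
        then have "(v, y) = (a e, b e) \<or> (v, y) = (b e, a e)"
          by (auto simp: inc_def opp_def)
        then have "(v, y) \<in> r"
          using D(2)[OF e(1)] r by (auto simp: equiv_def sym_def)
        then show "y \<in> X"
          using in_quotient_imp_closed[OF r that v] by blast
      qed
    qed (rule finX)
    finally have "\<delta> \<le> f v + card X" by simp
    also have "\<dots> \<le> (\<Sum>v\<in>X. f v) + card X"
      using finX v by (simp add: member_le_sum)
    also have "\<dots> = (\<Sum>v\<in>X. f v + 1)"
      by (simp only: sum.distrib card_eq_sum)
    finally have "real \<delta> \<le> (\<Sum>v\<in>X. real (f v) + 1)"
      by (simp add: add.commute flip: of_nat_le_iff[where ?'a = real])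
    then have "real \<delta> * 1 \<le> 2 * (\<Sum>v\<in>X. real (f v) + 1)"
      using \<delta>_pos by simp
    then show ?thesis
      unfolding sum_distrib_left[symmetric] using \<delta>_pos by (simp add: le_divide_eq)
  qed
  then have "(\<Sum>X\<in>{..<n} // r. 1) \<le> (\<Sum>X\<in>{..<n} // r. \<Sum>v\<in>X. 2 / real \<delta> * (real (f v) + 1))"
    by (rule sum_mono)
  also have "\<dots> = (\<Sum>v\<in>\<Union>({..<n} // r). 2 / real \<delta> * (real (f v) + 1))"
  proof -
    have "\<forall>X\<in>{..<n} // r. finite X"
      using in_quotient_imp_subset[OF r] finite_subset[OF _ finite_lessThan] by blast
    moreover have "\<forall>X\<in>{..<n} // r. \<forall>Y\<in>{..<n} // r. X \<noteq> Y \<longrightarrow> X \<inter> Y = {}"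
      using quotient_disj[OF r] by blast
    ultimately show ?thesis
      by (simp add: sum.Union_disjoint comp_def)
  qed
  also have "\<Union>({..<n} // r) = {..<n}"
    by (rule Union_quotient[OF r])
  also have "(\<Sum>v<n. 2 / real \<delta> * (real (f v) + 1)) = 2 / real \<delta> * (real (\<Sum>v<n. f v) + real n)"
    by (subst sum_distrib_left[symmetric]) (simp add: sum.distrib)
  also have "(\<Sum>v<n. f v) = 2 * card ({..<m} - D)"
    unfolding f_def by (rule sum_incident) auto
  finally show ?thesis by simp
qed

section \<open>A sparse edge set is avoided with constant probability\<close>

abbreviation coords :: "nat set" where
  "coords \<equiv> {..<2 * n + m}"

lemma measure_uniform:
  "measure_pmf.prob (pmf_of_set {0..k}) (- A) = 1 - real (card ({0..k::nat} \<inter> A)) / real (Suc k)"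
proof -
  have "measure_pmf.prob (pmf_of_set {0..k}) (- A) = 1 - measure_pmf.prob (pmf_of_set {0..k}) A"
    using measure_pmf.prob_compl[of A "pmf_of_set {0..k}"] by (simp add: Compl_eq_Diff_UNIV)
  then show ?thesis by (simp add: measure_pmf_of_set)
qed

text \<open>The coordinates are independent, so the probability is a product. A pick at
  \<open>v\<close> hits \<open>C\<close> with probability at most \<open>1 - \<eta>\<close> and
  contributes an exponent of at most c(v) / (\<eta> * \<delta>), with c(v) the number of edges of
  \<open>C\<close> at \<open>v\<close>. Two picks per node add up to 4 * card C / (\<eta> *
  \<delta>), the edge coordinates to card C / \<delta>, and \<open>card C \<le> 2 * \<delta>\<close>
  yields 8 / \<eta> + 2.\<close>

lemma prob_avoid:
  assumes C: "C \<subseteq> {..<m}" "real (card C) \<le> 2 * real \<delta>" and \<eta>: "0 < \<eta>"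
    and sparse: "\<And>v. v < n \<Longrightarrow> real (card {e \<in> C. inc v e}) \<le> (1 - \<eta>) * real (deg v)"
  shows "exp (- (8 / \<eta> + 2)) \<le> measure_pmf.prob (sample coords) {\<omega>. selected coords \<omega> \<inter> C = {}}"
proof -
  define c where "c v = card {e \<in> C. inc v e}" for v
  define A where "A j = {k. sel j k \<inter> C \<noteq> {}}" for j
  define g where "g j = (if j < 2 * n then real (c (j mod n)) / (\<eta> * real \<delta>)
    else if j - 2 * n \<in> C then 1 / real \<delta> else 0)" for j
  have "{\<omega>. selected coords \<omega> \<inter> C = {}} = Pi coords (\<lambda>j. - A j)"
    by (auto simp: selected_def A_def Pi_def)
  then have prob: "measure_pmf.prob (sample coords) {\<omega>. selected coords \<omega> \<inter> C = {}}
    = (\<Prod>j\<in>coords. measure_pmf.prob (pmf_of_set {0..bnd j}) (- A j))"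
    unfolding sample_def by (simp add: measure_Pi_pmf_Pi)
  have coord: "exp (- g j) \<le> measure_pmf.prob (pmf_of_set {0..bnd j}) (- A j)" if "j \<in> coords" for j
  proof (cases "j < 2 * n")
    case True
    define v where "v = j mod n"
    have v: "v < n" using True by (simp add: v_def)
    have d: "0 < deg v" "\<delta> \<le> deg v" using \<delta>_le[OF v] \<delta>_pos by auto
    have "{0..bnd j} \<inter> A j = rank v ` {e \<in> C. inc v e}"
    proof -
      have "{0..bnd j} = {..<deg v}" using True d by (auto simp: bnd_def v_def)
      moreover have "A j = rank v ` {e \<in> C. inc v e}"
        using C True by (auto simp: A_def sel_def v_def)
      moreover have "rank v ` {e \<in> C. inc v e} \<subseteq> {..<deg v}"
        using C by (auto intro!: rank_less)
      ultimately show ?thesis by auto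
    qed
    moreover have "inj_on (rank v) {e \<in> C. inc v e}"
      by (rule inj_on_subset[OF bij_betw_imp_inj_on[OF rank_bij]]) (use C in auto)
    ultimately have "card ({0..bnd j} \<inter> A j) = c v"
      by (simp add: card_image c_def)
    moreover have "Suc (bnd j) = deg v"
      using True d by (simp add: bnd_def v_def)
    ultimately have p: "measure_pmf.prob (pmf_of_set {0..bnd j}) (- A j) = 1 - real (c v) / real (deg v)"
      by (simp add: measure_uniform)
    have "exp (- (real (c v) / real (deg v) / \<eta>)) \<le> 1 - real (c v) / real (deg v)"
      using sparse[OF v] d \<eta> by (intro exp_le_one_minus) (auto simp: c_def field_simps)
    moreover have "real (c v) / real (deg v) / \<eta> \<le> g j"
    proof -
      have "real (c v) / (\<eta> * real (deg v)) \<le> real (c v) / (\<eta> * real \<delta>)"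
        using \<eta> d \<delta>_pos by (intro divide_left_mono mult_left_mono) auto
      then show ?thesis using True by (simp add: g_def v_def mult.commute)
    qed
    ultimately show ?thesis
      unfolding p by (meson exp_le_cancel_iff le_imp_neg_le order_trans)
  next
    case False
    define e where "e = j - 2 * n"
    have e: "j = 2 * n + e" "e < m" using that False by (auto simp: e_def)
    have A: "A j = (if e \<in> C then {0} else {})"
      using e by (auto simp: A_def sel_def)
    show ?thesis
    proof (cases "e \<in> C")
      case True
      have "measure_pmf.prob (pmf_of_set {0..bnd j}) (- A j) = 1 - 1 / (2 * real \<delta>)"
      proof -
        have "{0..bnd j} \<inter> A j = {0}" using True by (auto simp: A)
        then have "card ({0..bnd j} \<inter> A j) = 1" by simp
        moreover have "Suc (bnd j) = 2 * \<delta>" using e \<delta>_pos by (simp add: bnd_def)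
        ultimately show ?thesis by (simp add: measure_uniform)
      qed
      \<comment> \<open>The same estimate with 1/2 for \<open>\<eta>\<close>, as an edge coordinate
        hits with probability 1 / (2 * \<delta>) \<le> 1/2.\<close>
      moreover have "exp (- ((1 / (2 * real \<delta>)) / (1 / 2))) \<le> 1 - 1 / (2 * real \<delta>)"
        using \<delta>_pos by (intro exp_le_one_minus) (auto simp: field_simps)
      ultimately show ?thesis
        using True e by (simp add: g_def)
    next
      case False
      then have "g j = 0" using e by (simp add: g_def)
      moreover have "A j = {}" using False by (simp add: A)
      ultimately show ?thesis by simp
    qed
  qed
  have "(\<Sum>j\<in>coords. g j) = (\<Sum>j<2 * n. g j) + (\<Sum>e<m. g (2 * n + e))"
    using sum.atLeastLessThan_concat[of 0 "2 * n" "2 * n + m" g]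
      sum.shift_bounds_nat_ivl[of g 0 "2 * n" m]
    by (simp add: atLeast0LessThan add.commute)
  also have "(\<Sum>e<m. g (2 * n + e)) = real (card C) / real \<delta>"
  proof -
    have "{..<m} \<inter> C = C" using C by auto
    then show ?thesis by (simp add: g_def sum.If_cases)
  qed
  also have "(\<Sum>j<2 * n. g j) = 2 * (\<Sum>v<n. real (c v) / (\<eta> * real \<delta>))"
  proof -
    have "(\<Sum>j<2 * n. g j) = (\<Sum>j<n. g j) + (\<Sum>j<n. g (n + j))"
      using sum.atLeastLessThan_concat[of 0 n "n + n" g] sum.shift_bounds_nat_ivl[of g 0 n n]
      by (simp add: atLeast0LessThan add.commute mult_2)
    then show ?thesis by (simp add: g_def)
  qed
  also have "(\<Sum>v<n. real (c v) / (\<eta> * real \<delta>)) = real (\<Sum>v<n. c v) / (\<eta> * real \<delta>)"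
    by (simp add: sum_divide_distrib)
  also have "(\<Sum>v<n. c v) = 2 * card C"
    unfolding c_def by (rule sum_incident[OF C(1)])
  also have "2 * (real (2 * card C) / (\<eta> * real \<delta>)) + real (card C) / real \<delta>
    = (4 / \<eta> + 1) * (real (card C) / real \<delta>)"
    using \<eta> \<delta>_pos by (simp add: field_simps)
  also have "\<dots> \<le> (4 / \<eta> + 1) * 2"
    using C \<eta> \<delta>_pos by (intro mult_left_mono) (auto simp: field_simps)
  finally have "- (8 / \<eta> + 2) \<le> - (\<Sum>j\<in>coords. g j)"
    by simp
  then have "exp (- (8 / \<eta> + 2)) \<le> exp (- (\<Sum>j\<in>coords. g j))"
    by simp
  also have "\<dots> = (\<Prod>j\<in>coords. exp (- g j))"
    by (simp add: exp_sum flip: sum_negf)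
  also have "\<dots> \<le> measure_pmf.prob (sample coords) {\<omega>. selected coords \<omega> \<inter> C = {}}"
    unfolding prob by (intro prod_mono) (auto simp: coord)
  finally show ?thesis .
qed

text \<open>Samples with too many surviving edges are discarded, so that the size bounds hold for
  every outcome.\<close>

definition good :: "nat \<Rightarrow> (nat \<Rightarrow> nat) \<Rightarrow> nat set" where
  "good L \<omega> = (if card (surviving coords id \<omega>) \<le> L * n then surviving coords id \<omega> else {})"

section \<open>Repeated samples and the vote on each edge\<close>

definition block :: "(nat \<Rightarrow> nat) \<Rightarrow> nat \<Rightarrow> nat \<Rightarrow> nat" where
  "block R i = (\<lambda>j. R (i * (2 * n + m) + j))"

definition put :: "nat \<Rightarrow> (nat \<Rightarrow> nat) \<Rightarrow> (nat \<Rightarrow> nat) \<Rightarrow> nat \<Rightarrow> nat" where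
  "put k R \<omega> = (\<lambda>i. if k \<le> i \<and> i < k + (2 * n + m) then \<omega> (i - k) else R i)"

text \<open>All samples lie one after another in a single function, the contents of the program's
  array of random numbers; \<open>put\<close> writes the next block and \<open>block\<close> reads
  one back.\<close>

primrec samples :: "nat \<Rightarrow> (nat \<Rightarrow> nat) pmf" where
  "samples 0 = return_pmf (\<lambda>_. 0)"
| "samples (Suc i) = bind_pmf (samples i) (\<lambda>R. map_pmf (put (i * (2 * n + m)) R) (sample coords))"

definition tally :: "nat \<Rightarrow> nat \<Rightarrow> (nat \<Rightarrow> nat) \<Rightarrow> nat \<Rightarrow> nat" where
  "tally L l R e = card {i. i < l \<and> e \<in> good L (block R i)}"

lemma finite_samples [simp]: "finite (set_pmf (samples l))"
  by (induction l) auto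

lemma good_cong:
  assumes "\<And>j. j < 2 * n + m \<Longrightarrow> \<omega> j = \<omega>' j"
  shows "good L \<omega> = good L \<omega>'"
proof -
  have "selected coords \<omega> = selected coords \<omega>'"
    using assms by (auto simp: selected_def)
  then show ?thesis by (simp add: good_def surviving_def)
qed

lemma good_subset: "good L \<omega> \<subseteq> {..<m}"
  by (auto simp: good_def surviving_def)

lemma card_good: "card (good L \<omega>) \<le> L * n"
  by (simp add: good_def)

lemma tally_put:
  "tally L (Suc l) (put (l * (2 * n + m)) R \<omega>) e = tally L l R e + (if e \<in> good L \<omega> then 1 else 0)"
proof -
  let ?R = "put (l * (2 * n + m)) R \<omega>"
  have "good L (block ?R l) = good L \<omega>"
    by (rule good_cong) (simp add: block_def put_def)
  moreover have "good L (block ?R i) = good L (block R i)" if "i < l" for i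
  proof (rule good_cong)
    fix j assume "j < 2 * n + m"
    then have "i * (2 * n + m) + j < Suc i * (2 * n + m)" by simp
    also have "\<dots> \<le> l * (2 * n + m)" using that by (intro mult_le_mono1) simp
    finally show "block ?R i j = block R i j" by (simp add: block_def put_def)
  qed
  ultimately have "{i. i < Suc l \<and> e \<in> good L (block ?R i)} =
    (if e \<in> good L \<omega> then insert l {i. i < l \<and> e \<in> good L (block R i)} else {i. i < l \<and> e \<in> good L (block R i)})"
    by (auto simp: less_Suc_eq)
  then show ?thesis by (simp add: tally_def)
qed

text \<open>The exponential moment at base 1/2. Independent samples multiply, and each contributes
  the factor 1 - P / 2, with P the probability that \<open>e\<close> is good.\<close>

lemma expectation_half_tally:
  assumes "p \<le> measure_pmf.prob (sample coords) {\<omega>. e \<in> good L \<omega>}"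
  shows "measure_pmf.expectation (samples l) (\<lambda>R. (1 / 2) ^ tally L l R e) \<le> (1 - p / 2) ^ l"
proof (induction l)
  case 0
  then show ?case by (simp add: tally_def)
next
  case (Suc l)
  have half: "measure_pmf.expectation (sample coords) (\<lambda>\<omega>. if e \<in> good L \<omega> then 1 / 2 else 1) \<le> 1 - p / 2"
  proof -
    have "measure_pmf.expectation (sample coords) (\<lambda>\<omega>. if e \<in> good L \<omega> then 1 / 2 else (1::real))
      = measure_pmf.expectation (sample coords) (\<lambda>\<omega>. 1 - indicator {\<omega>. e \<in> good L \<omega>} \<omega> / 2)"
      by (intro Bochner_Integration.integral_cong) (auto simp: indicator_def)
    also have "\<dots> = 1 - measure_pmf.prob (sample coords) {\<omega>. e \<in> good L \<omega>} / 2"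
      by (simp add: integrable_measure_pmf_finite)
    finally show ?thesis using assms by simp
  qed
  have "0 \<le> measure_pmf.expectation (sample coords) (\<lambda>\<omega>. if e \<in> good L \<omega> then 1 / 2 else (1::real))"
    by (rule integral_nonneg_AE) simp
  with half have p: "0 \<le> 1 - p / 2" by linarith
  have "measure_pmf.expectation (samples (Suc l)) (\<lambda>R. (1 / 2) ^ tally L (Suc l) R e) =
    (\<Sum>R\<in>set_pmf (samples l). pmf (samples l) R * measure_pmf.expectation (sample coords)
      (\<lambda>\<omega>. (1 / 2) ^ tally L l R e * (if e \<in> good L \<omega> then 1 / 2 else 1)))"
    unfolding samples.simps
    by (subst pmf_expectation_bind[OF finite_samples])
      (auto simp: tally_put power_add if_distrib[where f = "(^) (1 / 2 :: real)"] cong: if_cong intro!: sum.cong)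
  also have "\<dots> = (\<Sum>R\<in>set_pmf (samples l). pmf (samples l) R * (1 / 2) ^ tally L l R e *
      measure_pmf.expectation (sample coords) (\<lambda>\<omega>. if e \<in> good L \<omega> then 1 / 2 else 1))"
    by (simp add: mult.assoc)
  also have "\<dots> \<le> (\<Sum>R\<in>set_pmf (samples l). pmf (samples l) R * (1 / 2) ^ tally L l R e * (1 - p / 2))"
    using half by (intro sum_mono mult_left_mono) auto
  also have "\<dots> = measure_pmf.expectation (samples l) (\<lambda>R. (1 / 2) ^ tally L l R e) * (1 - p / 2)"
    by (subst integral_measure_pmf[OF finite_samples]) (simp_all add: sum_distrib_right)
  also have "\<dots> \<le> (1 - p / 2) ^ l * (1 - p / 2)"
    using Suc.IH p by (rule mult_right_mono)
  finally show ?case by (simp add: mult.commute)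
qed

text \<open>Markov's inequality for the exponential moment: on the event, 2 ^ r * (1/2) ^ tally is
  at least 1.\<close>

lemma prob_tally_less:
  assumes "p \<le> measure_pmf.prob (sample coords) {\<omega>. e \<in> good L \<omega>}"
  shows "measure_pmf.prob (samples l) {R. tally L l R e < r} \<le> 2 ^ r * (1 - p / 2) ^ l"
proof -
  have "measure_pmf.prob (samples l) {R. tally L l R e < r}
    = measure_pmf.expectation (samples l) (indicator {R. tally L l R e < r})"
    by simp
  also have "\<dots> \<le> measure_pmf.expectation (samples l) (\<lambda>R. 2 ^ r * (1 / 2) ^ tally L l R e)"
  proof (intro expectation_mono finite_samples)
    fix R
    have "(1::real) \<le> 2 ^ r * (1 / 2) ^ k" if "k < r" for k
    proof -
      have "(2::real) ^ k \<le> 2 ^ r" using that by (intro power_increasing) auto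
      then show ?thesis by (simp add: power_one_over field_simps)
    qed
    then show "indicator {R. tally L l R e < r} R \<le> (2::real) ^ r * (1 / 2) ^ tally L l R e"
      by (auto simp: indicator_def)
  qed
  also have "\<dots> \<le> 2 ^ r * (1 - p / 2) ^ l"
    using expectation_half_tally[OF assms, of l] by simp
  finally show ?thesis .
qed

text \<open>If a sample avoids \<open>C\<close>, then \<open>S\<close> is a union of components and
  every edge of \<open>C\<close> survives. By Markov's inequality on the expected
  \<open>10 * n\<close> surviving edges, a sample is discarded with probability at most 10 / L, and
  the factor 20 makes this at most half the probability of avoiding \<open>C\<close>.\<close>

lemma prob_good:
  assumes C: "C \<subseteq> {..<m}" "real (card C) \<le> 2 * real \<delta>" and \<eta>: "0 < \<eta>"
    and sparse: "\<And>v. v < n \<Longrightarrow> real (card {e \<in> C. inc v e}) \<le> (1 - \<eta>) * real (deg v)"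
    and S: "\<And>e. e < m \<Longrightarrow> e \<in> C \<longleftrightarrow> (a e \<in> S) \<noteq> (b e \<in> S)"
    and e: "e \<in> C" and L: "20 * exp (8 / \<eta> + 2) \<le> real L"
  shows "exp (- (8 / \<eta> + 2)) / 2 \<le> measure_pmf.prob (sample coords) {\<omega>. e \<in> good L \<omega>}"
proof -
  let ?P = "measure_pmf.prob (sample coords)"
  let ?p = "exp (- (8 / \<eta> + 2))"
  define F where "F = {\<omega>. L * n < card (surviving coords id \<omega>)}"
  have em: "e < m" using e C by auto
  then have n: "0 < n" using a_less[of e] by simp
  have Lpos: "0 < real L" by (rule less_le_trans[OF _ L]) simp
  have "real (L * n) * ?P F = measure_pmf.expectation (sample coords) (\<lambda>\<omega>. real (L * n) * indicator F \<omega>)"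
    by simp
  also have "\<dots> \<le> esurv coords id"
    unfolding esurv_def by (intro expectation_mono finite_sample) (auto simp: F_def indicator_def simp flip: of_nat_mult)
  also have "\<dots> \<le> 10 * real n" by (rule esurv_le)
  finally have "real L * ?P F \<le> 10" using n by simp
  then have "?P F \<le> 10 / real L" using Lpos by (simp add: field_simps)
  also have "\<dots> \<le> 10 / (20 * exp (8 / \<eta> + 2))"
    using L Lpos by (intro divide_left_mono) auto
  also have "\<dots> = ?p / 2"
    unfolding exp_minus by (simp add: field_simps)
  finally have F: "?P F \<le> ?p / 2" .
  have "?p \<le> ?P {\<omega>. selected coords \<omega> \<inter> C = {}}"
    by (rule prob_avoid[OF C \<eta> sparse])
  also have "\<dots> \<le> ?P ({\<omega>. e \<in> good L \<omega>} \<union> F)"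
  proof (intro measure_pmf.finite_measure_mono)
    show "{\<omega>. selected coords \<omega> \<inter> C = {}} \<subseteq> {\<omega>. e \<in> good L \<omega>} \<union> F"
    proof
      fix \<omega> assume "\<omega> \<in> {\<omega>. selected coords \<omega> \<inter> C = {}}"
      then have dis: "selected coords \<omega> \<inter> C = {}" by simp
      have "a e' \<in> S \<longleftrightarrow> b e' \<in> S" if "e' \<in> selected coords \<omega>" for e'
      proof -
        have "e' < m" using that by (auto simp: selected_def sel_def split: if_splits)
        then show ?thesis using S[of e'] dis that by blast
      qed
      then have "(a e, b e) \<notin> conn id (selected coords \<omega>)"
        using conn_id_respects[of "a e" "b e" "selected coords \<omega>" S] S[OF em] e by blast
      then have "e \<in> surviving coords id \<omega>"
        using em by (simp add: surviving_def)
      then show "\<omega> \<in> {\<omega>. e \<in> good L \<omega>} \<union> F"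
        by (auto simp: good_def F_def)
    qed
  qed simp
  also have "\<dots> \<le> ?P {\<omega>. e \<in> good L \<omega>} + ?P F"
    by (rule measure_Un_le) auto
  finally show ?thesis using F by simp
qed

lemma prob_all_tally:
  assumes "finite T" "\<And>e. e \<in> T \<Longrightarrow> p \<le> measure_pmf.prob (sample coords) {\<omega>. e \<in> good L \<omega>}"
  shows "1 - real (card T) * (2 ^ r * (1 - p / 2) ^ l)
    \<le> measure_pmf.prob (samples l) {R. \<forall>e\<in>T. r \<le> tally L l R e}"
proof -
  let ?P = "measure_pmf.prob (samples l)"
  have "?P (\<Union>e\<in>T. {R. tally L l R e < r}) \<le> (\<Sum>e\<in>T. ?P {R. tally L l R e < r})"
    using assms(1) by (intro measure_pmf.finite_measure_subadditive_finite) auto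
  also have "\<dots> \<le> (\<Sum>e\<in>T. 2 ^ r * (1 - p / 2) ^ l)"
    using assms(2) by (intro sum_mono prob_tally_less)
  finally have "?P (\<Union>e\<in>T. {R. tally L l R e < r}) \<le> real (card T) * (2 ^ r * (1 - p / 2) ^ l)"
    by simp
  moreover have "{R. \<forall>e\<in>T. r \<le> tally L l R e} = UNIV - (\<Union>e\<in>T. {R. tally L l R e < r})"
    by (auto simp: not_less)
  ultimately show ?thesis
    using measure_pmf.prob_compl[of "\<Union>e\<in>T. {R. tally L l R e < r}" "samples l"] by simp
qed

text \<open>Double counting of the pairs of a sample and an edge good in it. The bound holds for
  every outcome \<open>R\<close>, since discarded samples contribute nothing and the others at most
  \<open>L * n\<close> edges each.\<close>

lemma card_tally_ge:
  "r * card {e. e < m \<and> r \<le> tally L l R e} \<le> l * (L * n)"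
proof -
  let ?T = "{e. e < m \<and> r \<le> tally L l R e}"
  have "r * card ?T = (\<Sum>e\<in>?T. r)" by simp
  also have "\<dots> \<le> (\<Sum>e\<in>?T. tally L l R e)" by (intro sum_mono) auto
  also have "\<dots> \<le> (\<Sum>e<m. tally L l R e)" by (intro sum_mono2) auto
  also have "\<dots> = (\<Sum>e<m. \<Sum>i<l. if e \<in> good L (block R i) then 1 else 0)"
    by (simp add: tally_def sum.If_cases Int_def)
  also have "\<dots> = (\<Sum>i<l. \<Sum>e<m. if e \<in> good L (block R i) then 1 else 0)"
    by (rule sum.swap)
  also have "\<dots> = (\<Sum>i<l. card (good L (block R i)))"
    using good_subset by (intro sum.cong refl) (simp add: sum.If_cases Int_absorb1)
  also have "\<dots> \<le> (\<Sum>i<l. L * n)" by (intro sum_mono card_good)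
  finally show ?thesis by simp
qed

end

section \<open>Breadth-first search\<close>

context sgraph
begin

text \<open>Invariant of the breadth-first search for the components of \<open>({..<n}, F)\<close>: \<open>lab x = n\<close>
  means that \<open>x\<close> has not been reached, the first \<open>t\<close> entries of the queue \<open>q\<close> are the nodes
  reached, the first \<open>h\<close> of them have been processed, \<open>k\<close> counts the processed edges of \<open>q h\<close>,
  and \<open>p\<close> is the next candidate for a root.\<close>

inductive bfs_inv ::
  "nat set \<Rightarrow> (nat \<Rightarrow> nat) \<Rightarrow> (nat \<Rightarrow> nat) \<Rightarrow> nat \<Rightarrow> nat \<Rightarrow> nat \<Rightarrow> nat \<Rightarrow> nat \<Rightarrow> bool"
  for F lab q cnt p h t k where
  bfs_invI: "\<lbrakk>p \<le> n;
    h \<le> t;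
    inj_on q {..<t};
    (\<And>i. i < t \<Longrightarrow> q i < n);
    (\<And>x. x < n \<Longrightarrow> lab x = n \<or> lab x < cnt);
    (\<And>x. x < n \<Longrightarrow> lab x \<noteq> n \<longleftrightarrow> x \<in> q ` {..<t});
    (\<And>c. c < cnt \<Longrightarrow> \<exists>x<n. lab x = c);
    cnt \<le> n;
    (\<And>x. x < p \<Longrightarrow> lab x \<noteq> n);
    (\<And>i e. i < h \<Longrightarrow> e \<in> F \<Longrightarrow> inc (q i) e \<Longrightarrow> lab (opp (q i) e) = lab (q i));
    (h < t \<Longrightarrow> k \<le> deg (q h));
    (\<And>e. h < t \<Longrightarrow> e \<in> F \<Longrightarrow> inc (q h) e \<Longrightarrow> rank (q h) e < k \<Longrightarrow> lab (opp (q h) e) = lab (q h));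
    (\<not> h < t \<Longrightarrow> k = 0);
    (\<And>i. h \<le> i \<Longrightarrow> i < t \<Longrightarrow> Suc (lab (q i)) = cnt);
    (\<And>x y. x < n \<Longrightarrow> y < n \<Longrightarrow> lab x = lab y \<Longrightarrow> lab x \<noteq> n \<Longrightarrow> (x, y) \<in> conn id F)\<rbrakk>
    \<Longrightarrow> bfs_inv F lab q cnt p h t k"

text \<open>Bounds the rounds of one flat loop, each of which tests a root candidate, looks at one
  edge of the current node, or closes that node; hence \<open>deg v + 1\<close> for every node not
  yet closed.\<close>

definition bfs_measure :: "(nat \<Rightarrow> nat) \<Rightarrow> nat \<Rightarrow> nat \<Rightarrow> nat \<Rightarrow> nat" where
  "bfs_measure q p h k = (n - p) + ((\<Sum>v\<in>{..<n} - q ` {..<h}. deg v + 1) - k)"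

lemma bfs_invD:
  assumes "bfs_inv F lab q cnt p h t k"
  shows "p \<le> n" "h \<le> t" "inj_on q {..<t}" "\<And>i. i < t \<Longrightarrow> q i < n"
    "\<And>x. x < n \<Longrightarrow> lab x = n \<or> lab x < cnt" "\<And>x. x < n \<Longrightarrow> lab x \<noteq> n \<longleftrightarrow> x \<in> q ` {..<t}"
    "\<And>c. c < cnt \<Longrightarrow> \<exists>x<n. lab x = c" "cnt \<le> n" "\<And>x. x < p \<Longrightarrow> lab x \<noteq> n"
    "\<And>i e. i < h \<Longrightarrow> e \<in> F \<Longrightarrow> inc (q i) e \<Longrightarrow> lab (opp (q i) e) = lab (q i)"
    "h < t \<Longrightarrow> k \<le> deg (q h)"
    "\<And>e. h < t \<Longrightarrow> e \<in> F \<Longrightarrow> inc (q h) e \<Longrightarrow> rank (q h) e < k \<Longrightarrow> lab (opp (q h) e) = lab (q h)"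
    "\<not> h < t \<Longrightarrow> k = 0" "\<And>i. h \<le> i \<Longrightarrow> i < t \<Longrightarrow> Suc (lab (q i)) = cnt"
    "\<And>x y. x < n \<Longrightarrow> y < n \<Longrightarrow> lab x = lab y \<Longrightarrow> lab x \<noteq> n \<Longrightarrow> (x, y) \<in> conn id F"
  using assms unfolding bfs_inv.simps by (elim conjE, simp)+

lemma opp_opp: "e < m \<Longrightarrow> inc v e \<Longrightarrow> opp (opp v e) e = v"
  using a_neq_b[of e] by (auto simp: opp_def inc_def)

lemma rank_inj:
  "rank v e = rank v e' \<Longrightarrow> e < m \<Longrightarrow> e' < m \<Longrightarrow> inc v e \<Longrightarrow> inc v e' \<Longrightarrow> e = e'"
  using inj_onD[OF bij_betw_imp_inj_on[OF rank_bij], of v e e'] by simp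

lemma inc_opp: "inc v e \<Longrightarrow> inc (opp v e) e"
  by (auto simp: opp_def inc_def)

lemma sum_deg: "(\<Sum>v<n. deg v) = 2 * m"
  using sum_incident[of "{..<m}"] by (simp add: deg_def)

lemma bfs_measure_init: "bfs_measure q 0 0 0 = 2 * n + 2 * m"
  by (simp only: bfs_measure_def sum.distrib) (simp add: sum_deg)

lemma bfs_inv_init: "(\<And>x. x < n \<Longrightarrow> lab x = n) \<Longrightarrow> bfs_inv F lab q 0 0 0 0 0"
  by (auto simp: bfs_inv.simps)

text \<open>Pigeonhole: an unreached node leaves room in the queue, and as every label in use
  belongs to a node other than \<open>x\<close>, also \<open>cnt < n\<close>. So a fresh label never
  equals \<open>n\<close>, the mark of unreached nodes.\<close>

lemma bfs_tl_less:
  assumes "bfs_inv F lab q cnt p h t k" "x < n" "lab x = n"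
  shows "t < n" "cnt < n" "x \<notin> q ` {..<t}"
proof -
  note D = bfs_invD[OF assms(1)]
  show x: "x \<notin> q ` {..<t}" using assms D(6)[of x] by simp
  have "card (q ` {..<t}) \<le> card ({..<n} - {x})"
    using x D(4) by (intro card_mono) auto
  moreover have "card (q ` {..<t}) = t"
    using D(3) by (simp add: card_image)
  ultimately show "t < n" using assms by simp
  show "cnt < n"
  proof -
    have "{..<cnt} \<subseteq> lab ` ({..<n} - {x})"
    proof
      fix c assume "c \<in> {..<cnt}"
      then obtain y where y: "y < n" "lab y = c" "c < cnt" "cnt \<le> n"
        using D(7)[of c] D(8) by auto
      then have "y \<noteq> x" using assms by auto
      then show "c \<in> lab ` ({..<n} - {x})" using y by auto
    qed
    then have "card {..<cnt} \<le> card ({..<n} - {x})"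
      by (rule surj_card_le[rotated]) simp
    then show ?thesis using assms by simp
  qed
qed

text \<open>A reached neighbour is either processed, and then the labels across \<open>e\<close>
  already agree, or it still waits in the queue, where all entries carry the latest label
  \<open>cnt - 1\<close>.\<close>

lemma bfs_current:
  assumes inv: "bfs_inv F lab q cnt p h t k" and F: "F \<subseteq> {..<m}" and h: "h < t"
    and e: "e \<in> F" "inc (q h) e" "lab (opp (q h) e) \<noteq> n"
  shows "lab (opp (q h) e) = lab (q h)"
proof -
  let ?x = "opp (q h) e"
  note D = bfs_invD[OF inv]
  have em: "e < m" using e F by auto
  have "?x < n" using em by (rule opp_less)
  then obtain i where i: "i < t" "?x = q i"
    using D(6)[of ?x] e(3) by auto
  show ?thesis
  proof (cases "i < h")
    case True
    moreover have "inc (q i) e" using inc_opp[OF e(2)] i by simp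
    ultimately have "lab (opp (q i) e) = lab (q i)"
      using D(10) e(1) by blast
    then show ?thesis using opp_opp[OF em e(2)] i by simp
  next
    case False
    then have "Suc (lab (q i)) = cnt" "Suc (lab (q h)) = cnt"
      using D(14)[of i] D(14)[of h] i h by auto
    then show ?thesis using i by simp
  qed
qed

lemma bfs_edge_skip:
  assumes inv: "bfs_inv F lab q cnt p h t k" and F: "F \<subseteq> {..<m}" and h: "h < t"
    and e: "e < m" "inc (q h) e" "rank (q h) e = k" "e \<notin> F \<or> lab (opp (q h) e) \<noteq> n"
  shows "bfs_inv F lab q cnt p h t (Suc k)"
proof -
  note D = bfs_invD[OF inv]
  have k: "Suc k \<le> deg (q h)" using rank_less[OF e(1,2)] e(3) by simp
  have part: "lab (opp (q h) e') = lab (q h)"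
    if "e' \<in> F" "inc (q h) e'" "rank (q h) e' < Suc k" for e'
  proof (cases "rank (q h) e' = k")
    case True
    then have "e' = e"
      using rank_inj[of "q h" e' e] that e F by auto
    then show ?thesis
      using bfs_current[OF inv F h that(1,2)] e(4) that(1) by auto
  next
    case False
    then show ?thesis using D(12)[OF h that(1,2)] that(3) by simp
  qed
  show ?thesis
  proof (rule bfs_invI)
    show "Suc k \<le> deg (q h)" by (fact k)
    show "lab (opp (q h) e') = lab (q h)" if "e' \<in> F" "inc (q h) e'" "rank (q h) e' < Suc k" for e'
      by (rule part[OF that])
  qed (fact D | use h in simp)+
qed

lemma bfs_edge_new:
  assumes inv: "bfs_inv F lab q cnt p h t k" and F: "F \<subseteq> {..<m}" and h: "h < t"
    and e: "e \<in> F" "inc (q h) e" "rank (q h) e = k" "opp (q h) e = x" "lab x = n"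
  shows "bfs_inv F (lab(x := cnt - 1)) (q(t := x)) cnt p h (Suc t) (Suc k)"
proof -
  have em: "e < m" using e F by auto
  have x: "x < n" using opp_less[OF em] e by auto
  note D = bfs_invD[OF inv]
  note new = bfs_tl_less[OF inv x e(5)]
  have cnt: "Suc (lab (q h)) = cnt" using D(14)[of h] h by simp
  have qx: "q i \<noteq> x" if "i < t" for i using new(3) that by auto
  have qn: "q i < n" if "i < t" for i using D(4) that by simp
  have lq: "lab (q i) \<noteq> n" if "i < t" for i using that D(6)[OF qn[OF that]] by blast
  have k: "Suc k \<le> deg (q h)" using rank_less[OF em e(2)] e(3) by simp
  have inj: "inj_on (q(t := x)) {..<Suc t}"
    using D(3) new(3) by (auto simp: inj_on_def less_Suc_eq)
  have vis: "(lab(x := cnt - 1)) y \<noteq> n \<longleftrightarrow> y \<in> (q(t := x)) ` {..<Suc t}" if "y < n" for y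
  proof -
    have "(q(t := x)) ` {..<Suc t} = insert x (q ` {..<t})"
      by (auto simp: lessThan_Suc)
    then show ?thesis
      using D(6)[OF that] cnt new(2) by auto
  qed
  have labels: "\<exists>y<n. (lab(x := cnt - 1)) y = c" if c: "c < cnt" for c
  proof -
    obtain y where "y < n" "lab y = c" using D(7)[OF c] by blast
    moreover have "y \<noteq> x" using calculation e(5) c new(2) by auto
    ultimately show ?thesis by auto
  qed
  have closed: "(lab(x := cnt - 1)) (opp (q i) e') = (lab(x := cnt - 1)) (q i)"
    if "i < h" "e' \<in> F" "inc (q i) e'" for i e'
  proof -
    have "lab (opp (q i) e') = lab (q i)" using D(10)[OF that] .
    then have "opp (q i) e' \<noteq> x" using e(5) lq[of i] that(1) h by force
    then show ?thesis using \<open>lab (opp (q i) e') = lab (q i)\<close> qx[of i] that h by simp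
  qed
  have part: "(lab(x := cnt - 1)) (opp (q h) e') = (lab(x := cnt - 1)) (q h)"
    if "e' \<in> F" "inc (q h) e'" "rank (q h) e' < Suc k" for e'
  proof (cases "rank (q h) e' = k")
    case True
    then have "e' = e"
      using rank_inj[of "q h" e' e] that e em F by auto
    then show ?thesis
      using e cnt qx[OF h] by auto
  next
    case False
    then have *: "lab (opp (q h) e') = lab (q h)" using D(12)[OF h that(1,2)] that(3) by simp
    then have "opp (q h) e' \<noteq> x" using e(5) lq[OF h] by auto
    then show ?thesis using * qx[OF h] by simp
  qed
  have cur: "Suc ((lab(x := cnt - 1)) ((q(t := x)) i)) = cnt" if "h \<le> i" "i < Suc t" for i
    using that cnt qx D(14)[of i] by (cases "i = t") auto
  have ux: "(q h, x) \<in> conn id F" "(x, q h) \<in> conn id F"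
    using e inc_opp[OF e(2)] by (auto intro: conn_edge)
  have sound0: "(y, z) \<in> conn id F" if "lab y = lab z" "lab y \<noteq> n" "y < n" "z < n" for y z
    using D(15) that by blast
  have sound: "(y, z) \<in> conn id F"
    if yz: "y < n" "z < n" "(lab(x := cnt - 1)) y = (lab(x := cnt - 1)) z" "(lab(x := cnt - 1)) y \<noteq> n" for y z
  proof -
    have l: "lab (q h) = cnt - 1" using cnt by simp
    consider "y = x" "z = x" | "y = x" "z \<noteq> x" | "y \<noteq> x" "z = x" | "y \<noteq> x" "z \<noteq> x" by blast
    then show ?thesis
    proof cases
      case 1
      then show ?thesis by (simp add: conn_same)
    next
      case 2
      then have "(q h, z) \<in> conn id F" using yz l qn[OF h] by (intro sound0) auto
      then show ?thesis using ux(2) conn_trans 2 by blast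
    next
      case 3
      then have "(y, q h) \<in> conn id F" using yz l qn[OF h] by (intro sound0) auto
      then show ?thesis using ux(1) conn_trans 3 by blast
    next
      case 4
      then show ?thesis using yz by (intro sound0) auto
    qed
  qed
  show ?thesis
  proof (rule bfs_invI)
    show "(q(t := x)) i < n" if "i < Suc t" for i using qn x that by (auto simp: less_Suc_eq)
    show "(lab(x := cnt - 1)) y = n \<or> (lab(x := cnt - 1)) y < cnt" if "y < n" for y
      using D(5)[OF that] cnt by auto
    show "(lab(x := cnt - 1)) y \<noteq> n" if "y < p" for y
      using D(9)[OF that] new(2) cnt by auto
    show "(lab(x := cnt - 1)) (opp ((q(t := x)) i) e') = (lab(x := cnt - 1)) ((q(t := x)) i)"
      if "i < h" "e' \<in> F" "inc ((q(t := x)) i) e'" for i e'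
      using closed[of i e'] that h by simp
    show "(lab(x := cnt - 1)) (opp ((q(t := x)) h) e') = (lab(x := cnt - 1)) ((q(t := x)) h)"
      if "e' \<in> F" "inc ((q(t := x)) h) e'" "rank ((q(t := x)) h) e' < Suc k" for e'
      using part[of e'] that h by simp
    show "Suc k \<le> deg ((q(t := x)) h)" using k h by simp
  qed (fact D(1,8) inj vis labels cur sound | use h in simp)+
qed

lemma bfs_head:
  assumes inv: "bfs_inv F lab q cnt p h t k" and F: "F \<subseteq> {..<m}" and h: "h < t"
    and k: "deg (q h) \<le> k"
  shows "bfs_inv F lab q cnt p (Suc h) t 0"
proof -
  note D = bfs_invD[OF inv]
  have closed: "lab (opp (q i) e) = lab (q i)" if "i < Suc h" "e \<in> F" "inc (q i) e" for i e
  proof (cases "i = h")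
    case True
    have "rank (q h) e < k"
      using that True F k rank_less[of e "q h"] by auto
    then show ?thesis using D(12)[OF h that(2)] that(3) True by simp
  next
    case False
    then show ?thesis using D(10)[of i e] that by simp
  qed
  have cur: "Suc (lab (q i)) = cnt" if "Suc h \<le> i" "i < t" for i
    using D(14)[of i] that by simp
  show ?thesis
    by (rule bfs_invI) (fact D closed cur | use h in simp)+
qed

lemma bfs_root_skip:
  assumes "bfs_inv F lab q cnt p h t k" "p < n" "lab p \<noteq> n"
  shows "bfs_inv F lab q cnt (Suc p) h t k"
proof -
  note D = bfs_invD[OF assms(1)]
  have vis: "lab x \<noteq> n" if "x < Suc p" for x
    using D(9)[of x] that assms(3) by (auto simp: less_Suc_eq)
  show ?thesis
    by (rule bfs_invI) (fact D vis | use assms(2) in simp)+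
qed

text \<open>A root is opened only when the queue is empty, so that all waiting nodes share one
  label, the newest.\<close>

lemma bfs_root_new:
  assumes inv: "bfs_inv F lab q cnt p h t k" and p: "p < n" "lab p = n" and h: "\<not> h < t" and F: "F \<subseteq> {..<m}"
  shows "bfs_inv F (lab(p := cnt)) (q(t := p)) (Suc cnt) (Suc p) h (Suc t) k"
proof -
  note D = bfs_invD[OF inv]
  note new = bfs_tl_less[OF inv p]
  have h': "h = t" "k = 0" using D(2,13) h by auto
  have qp: "q i \<noteq> p" if "i < t" for i using new(3) that by auto
  have qn: "q i < n" if "i < t" for i using D(4) that by simp
  have lq: "lab (q i) \<noteq> n" if "i < t" for i using that D(6)[OF qn[OF that]] by blast
  have inj: "inj_on (q(t := p)) {..<Suc t}"
    using D(3) new(3) by (auto simp: inj_on_def less_Suc_eq)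
  have vis: "(lab(p := cnt)) y \<noteq> n \<longleftrightarrow> y \<in> (q(t := p)) ` {..<Suc t}" if "y < n" for y
  proof -
    have "(q(t := p)) ` {..<Suc t} = insert p (q ` {..<t})"
      by (auto simp: lessThan_Suc)
    then show ?thesis
      using D(6)[OF that] new(2) by auto
  qed
  have labels: "\<exists>y<n. (lab(p := cnt)) y = c" if c: "c < Suc cnt" for c
  proof (cases "c = cnt")
    case False
    then obtain y where "y < n" "lab y = c" using D(7)[of c] c by auto
    moreover have "y \<noteq> p" using calculation p(2) c new(2) by auto
    ultimately show ?thesis by auto
  qed (use p in auto)
  have closed: "(lab(p := cnt)) (opp (q i) e') = (lab(p := cnt)) (q i)"
    if "i < t" "e' \<in> F" "inc (q i) e'" for i e'
  proof -
    have *: "lab (opp (q i) e') = lab (q i)" using D(10)[of i e'] that h' by simp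
    then have "opp (q i) e' \<noteq> p" using p(2) lq[OF that(1)] by force
    then show ?thesis using * qp[OF that(1)] by simp
  qed
  have ne: "lab y \<noteq> cnt" if "y < n" for y
    using D(5)[OF that] new(2) by auto
  have sound: "(y, z) \<in> conn id F"
    if yz: "y < n" "z < n" "(lab(p := cnt)) y = (lab(p := cnt)) z" "(lab(p := cnt)) y \<noteq> n" for y z
  proof (cases "y = p \<or> z = p")
    case True
    then have "y = z" using yz ne[of y] ne[of z] by (auto split: if_splits)
    then show ?thesis by (simp add: conn_same)
  next
    case False
    then show ?thesis using yz D(15)[of y z] by simp
  qed
  show ?thesis
  proof (rule bfs_invI)
    show "(q(t := p)) i < n" if "i < Suc t" for i using qn p that by (auto simp: less_Suc_eq)
    show "(lab(p := cnt)) y = n \<or> (lab(p := cnt)) y < Suc cnt" if "y < n" for y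
      using D(5)[OF that] by auto
    show "(lab(p := cnt)) y \<noteq> n" if "y < Suc p" for y
      using D(9)[of y] that new(2) by (auto simp: less_Suc_eq)
    show "(lab(p := cnt)) (opp ((q(t := p)) i) e) = (lab(p := cnt)) ((q(t := p)) i)"
      if "i < h" "e \<in> F" "inc ((q(t := p)) i) e" for i e
      using closed[of i e] that h' by simp
    show "Suc ((lab(p := cnt)) ((q(t := p)) i)) = Suc cnt" if "h \<le> i" "i < Suc t" for i
      using that h' by simp
  qed (fact inj vis labels sound | use p new h' in simp)+
qed

text \<open>With all candidates tried and the queue empty, labels agree across every edge of
  \<open>F\<close> and hence along paths; the converse is the last clause of the invariant.\<close>

lemma bfs_exit:
  assumes inv: "bfs_inv F lab q cnt n h t k" and F: "F \<subseteq> {..<m}" and h: "\<not> h < t"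
  shows "\<And>x y. x < n \<Longrightarrow> y < n \<Longrightarrow> lab x = lab y \<longleftrightarrow> (x, y) \<in> conn id F"
    and "lab ` {..<n} = {..<cnt}"
proof -
  note D = bfs_invD[OF inv]
  have all: "lab x \<noteq> n" "lab x < cnt" "x \<in> q ` {..<t}" if "x < n" for x
    using D(5,6,9)[of x] that by auto
  have h': "h = t" using D(2) h by simp
  have step: "lab (a e) = lab (b e)" if "e \<in> F" for e
  proof -
    have "a e < n" using that F a_less by auto
    then obtain i where i: "i < t" "a e = q i" using all by blast
    then have "lab (opp (q i) e) = lab (q i)"
      using D(10)[of i e] that h' by (simp add: inc_def)
    then show ?thesis using i by (simp add: opp_def)
  qed
  have "lab x = lab y" if "(x, y) \<in> conn id F" for x y
    using that unfolding conn_def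
    by (induction rule: rtrancl_induct) (use step in \<open>auto simp: inc_def\<close>)
  then show "lab x = lab y \<longleftrightarrow> (x, y) \<in> conn id F" if "x < n" "y < n" for x y
    using D(15)[of x y] all that by blast
  show "lab ` {..<n} = {..<cnt}"
    using D(7) all by force
qed

lemma bfs_measure_edge:
  assumes "bfs_inv F lab q cnt p h t k" "h < t" "k < deg (q h)"
    and "\<And>i. i < h \<Longrightarrow> q' i = q i"
  shows "bfs_measure q' p h (Suc k) < bfs_measure q p h k"
proof -
  have "q h \<notin> q ` {..<h}" "q h < n"
    using bfs_invD(3,4)[OF assms(1)] assms(2) by (auto dest!: inj_onD)
  then have "deg (q h) + 1 \<le> (\<Sum>v\<in>{..<n} - q ` {..<h}. deg v + 1)"
    by (intro member_le_sum) auto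
  moreover have "q' ` {..<h} = q ` {..<h}" using assms by (intro image_cong) auto
  ultimately show ?thesis using assms by (simp add: bfs_measure_def)
qed

lemma bfs_measure_head:
  assumes "bfs_inv F lab q cnt p h t k" "h < t"
  shows "bfs_measure q p (Suc h) 0 < bfs_measure q p h k"
proof -
  have h: "q h \<notin> q ` {..<h}" "q h < n" "k \<le> deg (q h)"
    using bfs_invD(3,4,11)[OF assms(1)] assms(2) by (auto dest!: inj_onD)
  have "{..<n} - q ` {..<Suc h} = {..<n} - q ` {..<h} - {q h}"
    by (auto simp: lessThan_Suc)
  moreover have "(\<Sum>v\<in>{..<n} - q ` {..<h}. deg v + 1) =
      (deg (q h) + 1) + (\<Sum>v\<in>{..<n} - q ` {..<h} - {q h}. deg v + 1)"
    using h by (intro sum.remove) auto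
  ultimately show ?thesis using h by (simp add: bfs_measure_def)
qed

lemma bfs_measure_root:
  assumes "p < n" "\<And>i. i < h \<Longrightarrow> q' i = q i"
  shows "bfs_measure q' (Suc p) h k < bfs_measure q p h k"
proof -
  have "q' ` {..<h} = q ` {..<h}" using assms by (intro image_cong) auto
  then show ?thesis using assms by (simp add: bfs_measure_def)
qed

end

section \<open>The program\<close>

text \<open>Registers: 4 minimum degree, 5 bit length of \<open>n\<close>, 6 index of a sample, 7 loop counter,
  8 scratch, 9 next position in the array of random numbers, 10 to 15 breadth-first search,
  16 number of surviving edges, 18 number of samples.  Arrays: 7 degrees, 8 and 9 ranks of an edge
  at its two endpoints, 10 incidence lists, 11 random numbers, 12 queue, 13 tallies.  The incidence
  list of \<open>v\<close> occupies the cells from \<open>v * n\<close> on; the unused cells in between cost no time.\<close>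

definition setup_adj :: "instr list" where
  "setup_adj =
    [While (Op Less (Reg 7) (Reg 1))
      [Store 8 (Reg 7) (Cell 7 (Cell 0 (Reg 7))),
       Store 9 (Reg 7) (Cell 7 (Cell 1 (Reg 7))),
       Store 10 (Op Add (Op Mul (Cell 0 (Reg 7)) (Reg 0)) (Cell 7 (Cell 0 (Reg 7)))) (Reg 7),
       Store 10 (Op Add (Op Mul (Cell 1 (Reg 7)) (Reg 0)) (Cell 7 (Cell 1 (Reg 7)))) (Reg 7),
       Store 7 (Cell 0 (Reg 7)) (Op Add (Cell 7 (Cell 0 (Reg 7))) (Num 1)),
       Store 7 (Cell 1 (Reg 7)) (Op Add (Cell 7 (Cell 1 (Reg 7))) (Num 1)),
       Assign 7 (Op Add (Reg 7) (Num 1))]]"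

text \<open>One round of the search, without inner loops. The other endpoint of an edge at
  \<open>v\<close> is computed as the sum of both endpoints minus \<open>v\<close>.\<close>

definition bfs_step :: "instr list" where
  "bfs_step =
      [If (Op Less (Reg 11) (Reg 12))
        [If (Op Less (Reg 13) (Cell 7 (Cell 12 (Reg 11))))
          [Assign 15 (Cell 10 (Op Add (Op Mul (Cell 12 (Reg 11)) (Reg 0)) (Reg 13))),
           Assign 14 (Op Sub (Op Add (Cell 0 (Reg 15)) (Cell 1 (Reg 15))) (Cell 12 (Reg 11))),
           If (Cell 2 (Reg 15))
            [If (Op Equal (Cell 3 (Reg 14)) (Reg 0))
              [Store 3 (Reg 14) (Op Sub (Reg 2) (Num 1)), Store 12 (Reg 12) (Reg 14),
               Assign 12 (Op Add (Reg 12) (Num 1))] []] [],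
           Assign 13 (Op Add (Reg 13) (Num 1))]
          [Assign 11 (Op Add (Reg 11) (Num 1)), Assign 13 (Num 0)]]
        [If (Op Equal (Cell 3 (Reg 10)) (Reg 0))
          [Store 3 (Reg 10) (Reg 2), Assign 2 (Op Add (Reg 2) (Num 1)),
           Store 12 (Reg 12) (Reg 10), Assign 12 (Op Add (Reg 12) (Num 1))] [],
         Assign 10 (Op Add (Reg 10) (Num 1))]]"

definition label :: "instr list" where
  "label =
    [Assign 7 (Num 0),
     While (Op Less (Reg 7) (Reg 0)) [Store 3 (Reg 7) (Reg 0), Assign 7 (Op Add (Reg 7) (Num 1))],
     Assign 2 (Num 0), Assign 10 (Num 0), Assign 11 (Num 0), Assign 12 (Num 0), Assign 13 (Num 0),
     While (Op Add (Op Less (Reg 10) (Reg 0)) (Op Less (Reg 11) (Reg 12)))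
      bfs_step]"

text \<open>\<open>c1 * lg\<close> is the number of samples, \<open>c2 * lg\<close> the vote
  threshold and \<open>c3 * n\<close> the limit on surviving edges. The bounds on \<open>B\<close>
  exclude wrap-around, in turn for addresses of incidence lists, for counters and coordinates, for
  positions in the array of random numbers, and for the program's constants and the values derived
  from them.\<close>

locale ram_graph = sgraph_deg +
  fixes B c1 c2 c3 lg :: nat
  assumes \<delta>_attained: "\<exists>v<n. deg v = \<delta>" and lg: "n < 2 ^ lg" "2 ^ (lg - 1) \<le> n"
    and B_nn: "n * n + n < B" and B_nm: "2 * n + m + 2 * \<delta> + 10 < B"
    and B_draw: "(c1 * lg + 1) * (2 * n + m) < B"
    and B_const: "lg + c1 * lg + c1 + c2 * lg + c2 + c3 * n + c3 + 1 < B"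
begin

definition input :: "ram_state \<Rightarrow> bool" where
  "input s \<longleftrightarrow> regs s 0 = n \<and> regs s 1 = m \<and> arrs s 0 = a \<and> arrs s 1 = b"

definition adj_ok :: "ram_state \<Rightarrow> bool" where
  "adj_ok s \<longleftrightarrow> (\<forall>v. arrs s 7 v = deg v) \<and>
     (\<forall>e<m. arrs s 8 e = rank (a e) e \<and> arrs s 9 e = rank (b e) e) \<and>
     (\<forall>e<m. \<forall>v<n. inc v e \<longrightarrow> arrs s 10 (v * n + rank v e) = e)"

lemma input_frame: "input s0 \<Longrightarrow> frame X A s0 s \<Longrightarrow> X \<inter> {0, 1} = {} \<Longrightarrow> A \<inter> {0, 1} = {} \<Longrightarrow> input s"
  by (auto simp: input_def frame_def)

lemma adj_ok_frame: "adj_ok s0 \<Longrightarrow> frame X A s0 s \<Longrightarrow> A \<inter> {7, 8, 9, 10} = {} \<Longrightarrow> adj_ok s"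
  by (auto simp: adj_ok_def frame_def)

lemma rank_Suc: "rank v (Suc e) = rank v e + (if inc v e then 1 else 0)"
proof -
  have "{e'. e' < Suc e \<and> inc v e'} = (if inc v e then insert e {e'. e' < e \<and> inc v e'} else {e'. e' < e \<and> inc v e'})"
    by (auto simp: less_Suc_eq)
  then show ?thesis by (simp add: rank_def)
qed

lemma rank_m: "rank v m = deg v"
  by (simp add: rank_def deg_def)

text \<open>Ranks are below \<open>n\<close>, so division by \<open>n\<close> recovers the node from
  an address.\<close>

lemma pos_inj:
  assumes "v < n" "v' < n" "e < m" "e' < m" "inc v e" "inc v' e'" "v * n + rank v e = v' * n + rank v' e'"
  shows "v = v' \<and> e = e'"
proof -
  have r: "rank v e < n" "rank v' e' < n"
    using rank_less assms deg_less by (meson order_less_trans)+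
  have "v = (v * n + rank v e) div n" "v' = (v' * n + rank v' e') div n"
    using r by simp_all
  then have "v = v'" using assms by simp
  then show ?thesis using assms rank_inj by auto
qed

lemma mult_add_less:
  assumes "v < n" "k < n" shows "v * n + k < B" "v * n < B"
proof -
  have "v * n + k < Suc v * n" using assms by simp
  also have "\<dots> \<le> n * n" using assms by (intro mult_le_mono1) simp
  finally show "v * n + k < B" using B_nn by linarith
  then show "v * n < B" by linarith
qed

text \<open>Array 7 is a running counter: before edge \<open>e\<close> it holds
  \<open>rank v e\<close> for every \<open>v\<close>. The ranks of \<open>e\<close> can be read off
  from it, and after the last edge the counters are the degrees.\<close>

lemma wp_setup_adj:
  assumes "input s0" "regs s0 7 = 0" "arrs s0 7 = (\<lambda>_. 0)"
  shows "wp B setup_adj (8 * m + 1) (\<lambda>s. frame {7} {7, 8, 9, 10} s0 s \<and> adj_ok s) s0"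
  unfolding setup_adj_def
proof (rule wp_While[where T = 7 and \<mu> = "\<lambda>s. m - regs s 7" and I = "\<lambda>s. frame {7} {7, 8, 9, 10} s0 s \<and>
    regs s 7 \<le> m \<and> (\<forall>v. arrs s 7 v = rank v (regs s 7)) \<and>
    (\<forall>e<regs s 7. arrs s 8 e = rank (a e) e \<and> arrs s 9 e = rank (b e) e) \<and>
    (\<forall>e<regs s 7. \<forall>v<n. inc v e \<longrightarrow> arrs s 10 (v * n + rank v e) = e)"], goal_cases)
  case 1
  then show ?case using assms by (simp add: rank_def)
next
  case 2
  then show ?case using assms by simp
next
  case (3 s)
  then have fr: "frame {7} {7, 8, 9, 10} s0 s" by simp
  have inp: "input s" using assms(1) fr by (rule input_frame) auto
  define e where "e = regs s 7"
  have s: "regs s 0 = n" "regs s 1 = m" "arrs s 0 = a" "arrs s 1 = b" "regs s 7 = e"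
    using inp by (simp_all add: input_def e_def)
  have e: "e < m" using 3 s by (simp split: if_splits)
  have ab: "a e < n" "b e < n" "a e \<noteq> b e" using e a_less b_less a_neq_b by auto
  have rk: "rank (a e) e < n" "rank (b e) e < n"
    using e ab rank_less[of e] deg_less by (auto simp: inc_def intro: order_less_trans)
  note mul = mult_add_less[OF ab(1) rk(1)] mult_add_less[OF ab(2) rk(2)]
  have d: "\<And>v. arrs s 7 v = rank v e"
    and r: "\<And>e'. e' < e \<Longrightarrow> arrs s 8 e' = rank (a e') e'" "\<And>e'. e' < e \<Longrightarrow> arrs s 9 e' = rank (b e') e'"
    and adj: "\<And>e' v. e' < e \<Longrightarrow> v < n \<Longrightarrow> inc v e' \<Longrightarrow> arrs s 10 (v * n + rank v e') = e'"
    using 3 s by auto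
  have small: "rank (a e) e + 1 < B" "rank (b e) e + 1 < B" "e + 1 < B" "1 < B"
    using rk B_nm e by auto
  have posa: "v * n + rank v e' = a e * n + rank (a e) e \<longleftrightarrow> v = a e \<and> e' = e" if "e' < Suc e" "v < n" "inc v e'" for v e'
    using pos_inj[of v "a e" e' e] that ab e by (auto simp: inc_def)
  have posb: "v * n + rank v e' = b e * n + rank (b e) e \<longleftrightarrow> v = b e \<and> e' = e" if "e' < Suc e" "v < n" "inc v e'" for v e'
    using pos_inj[of v "b e" e' e] that ab e by (auto simp: inc_def)
  show ?case
    using fr e r adj ab posa posb
    by (simp add: wp_simps s d mul small del: One_nat_def)
      (auto simp: rank_Suc less_Suc_eq inc_def)
next
  case (4 s)
  then have "input s" using assms(1) by (auto intro: input_frame)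
  then have "regs s 7 = m" using 4 by (simp add: input_def split: if_splits)
  then show ?case using 4 by (auto simp: adj_ok_def rank_m)
qed

lemma edge_of_rank:
  assumes "k < deg v"
  obtains e where "e < m" "inc v e" "rank v e = k"
proof -
  have "k \<in> rank v ` {e. e < m \<and> inc v e}"
    using assms rank_bij[of v] by (simp add: bij_betw_def)
  then show ?thesis using that by auto
qed

lemma opp_eq: "e < m \<Longrightarrow> inc v e \<Longrightarrow> opp v e = a e + b e - v"
  by (auto simp: opp_def inc_def)

text \<open>What stays fixed once the setup is done; all later segments write to other registers and
  arrays.\<close>

definition static :: "ram_state \<Rightarrow> bool" where
  "static s \<longleftrightarrow> input s \<and> adj_ok s \<and> regs s 4 = \<delta> \<and> regs s 5 = lg \<and> regs s 18 = c1 * lg"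

lemma B_gt_1: "1 < B" "0 < B" "2 < B"
  using B_nm by auto

lemma static_frame:
  "static s0 \<Longrightarrow> frame X A s0 s \<Longrightarrow> X \<inter> {0, 1, 4, 5, 18} = {} \<Longrightarrow> A \<inter> {0, 1, 7, 8, 9, 10} = {} \<Longrightarrow> static s"
  by (auto simp: static_def input_def adj_ok_def frame_def)

lemma static_data:
  assumes "static s"
  shows "regs s 0 = n" "regs s 1 = m" "arrs s 0 = a" "arrs s 1 = b" "\<And>v. arrs s 7 v = deg v"
    "\<And>e. e < m \<Longrightarrow> arrs s 8 e = rank (a e) e" "\<And>e. e < m \<Longrightarrow> arrs s 9 e = rank (b e) e"
    "regs s 5 = lg" "regs s 18 = c1 * lg"
  using assms by (auto simp: static_def input_def adj_ok_def)

definition F :: "ram_state \<Rightarrow> nat set" where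
  "F s = {e. e < m \<and> arrs s 2 e \<noteq> 0}"

definition labelled :: "nat set \<Rightarrow> ram_state \<Rightarrow> bool" where
  "labelled D s \<longleftrightarrow> (\<forall>x<n. \<forall>y<n. arrs s 3 x = arrs s 3 y \<longleftrightarrow> (x, y) \<in> conn id D) \<and>
     arrs s 3 ` {..<n} = {..<regs s 2}"

text \<open>A round of the search takes at most 10 steps besides its test, and the measure starts at
  \<open>2 * n + 2 * m\<close>, which gives \<open>22 * n + 22 * m + 1\<close>; resetting the labels
  costs \<open>3 * n + 1\<close>.\<close>

lemma wp_label:
  assumes st: "static s0"
  shows "wp B label (25 * n + 22 * m + 8)
    (\<lambda>s. frame {2, 7, 10, 11, 12, 13, 14, 15} {3, 12} s0 s \<and> labelled (F s0) s) s0"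
proof -
  let ?X = "{2, 7, 10, 11, 12, 13, 14, 15}" and ?A = "{3, 12}"
  have F: "F s0 \<subseteq> {..<m}" by (auto simp: F_def)
  have B1: "1 < B" "0 < B" using B_nm by auto
  define I where "I s \<longleftrightarrow> frame ?X ?A s0 s \<and>
    bfs_inv (F s0) (arrs s 3) (arrs s 12) (regs s 2) (regs s 10) (regs s 11) (regs s 12) (regs s 13)" for s :: ram_state
  define \<mu> where "\<mu> s = bfs_measure (arrs s 12) (regs s 10) (regs s 11) (regs s 13)" for s :: ram_state
  have data: "regs s 0 = n" "regs s 1 = m" "arrs s 0 = a" "arrs s 1 = b" "arrs s 2 = arrs s0 2"
    "\<And>v. arrs s 7 v = deg v" "\<And>e v. e < m \<Longrightarrow> v < n \<Longrightarrow> inc v e \<Longrightarrow> arrs s 10 (v * n + rank v e) = e"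
    if "frame ?X ?A s0 s" for s :: ram_state
  proof -
    have "static s" using st that by (rule static_frame) auto
    then show "regs s 0 = n" "regs s 1 = m" "arrs s 0 = a" "arrs s 1 = b"
      "\<And>v. arrs s 7 v = deg v" "\<And>e v. e < m \<Longrightarrow> v < n \<Longrightarrow> inc v e \<Longrightarrow> arrs s 10 (v * n + rank v e) = e"
      by (auto simp: static_def input_def adj_ok_def)
    show "arrs s 2 = arrs s0 2" using that by (rule frame_arr) auto
  qed
  have init: "wp B [While (Op Less (Reg 7) (Reg 0)) [Store 3 (Reg 7) (Reg 0), Assign 7 (Op Add (Reg 7) (Num 1))]]
      (3 * n + 1) (\<lambda>s. frame ?X ?A s0 s \<and> (\<forall>x<n. arrs s 3 x = n)) s1"
    if "frame ?X ?A s0 s1" "regs s1 7 = 0" for s1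
  proof (rule wp_While[where T = 2 and \<mu> = "\<lambda>s. n - regs s 7" and
      I = "\<lambda>s. frame ?X ?A s0 s \<and> regs s 7 \<le> n \<and> (\<forall>x<regs s 7. arrs s 3 x = n)"], goal_cases)
    case (3 s)
    note s = data[of s]
    have "regs s 7 < n" "regs s 7 + 1 < B" using 3 s B_nm by (auto split: if_splits)
    then show ?case
      using 3 s B1 by (simp add: wp_simps less_Suc_eq)
  next
    case (4 s)
    then show ?case using data[of s] by (auto split: if_splits)
  qed (use that in auto)
  have body: "wp B
      bfs_step
      10 (\<lambda>s'. I s' \<and> \<mu> s' < \<mu> s) s"
    if I: "I s" and cond: "eval_expr B s (Op Add (Op Less (Reg 10) (Reg 0)) (Op Less (Reg 11) (Reg 12))) \<noteq> 0" for s
  proof -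
    define lab where "lab = arrs s 3"
    define q where "q = arrs s 12"
    define cnt where "cnt = regs s 2"
    define p where "p = regs s 10"
    define h where "h = regs s 11"
    define t where "t = regs s 12"
    define k where "k = regs s 13"
    have fr: "frame ?X ?A s0 s" and inv: "bfs_inv (F s0) lab q cnt p h t k"
      using I by (simp_all add: I_def lab_def q_def cnt_def p_def h_def t_def k_def)
    note d = data[OF fr] and D = bfs_invD[OF inv]
    note st = lab_def[symmetric] q_def[symmetric] cnt_def[symmetric] p_def[symmetric] h_def[symmetric]
      t_def[symmetric] k_def[symmetric]
    have \<mu>: "\<mu> s = bfs_measure q p h k" by (simp add: \<mu>_def st)
    have tn: "t \<le> n"
    proof -
      have "card (q ` {..<t}) \<le> card {..<n}" using D(4) by (intro card_mono) auto
      then show ?thesis using D(3) by (simp add: card_image)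
    qed
    have small: "t + 1 < B" "h + 1 < B" "p + 1 < B" "cnt + 1 < B"
      using tn D(1,2,8) B_nm by auto
    show ?thesis
    proof (cases "h < t")
      case ht: True
      define u where "u = q h"
      have u: "u < n" using D(4)[OF ht] by (simp add: u_def)
      show ?thesis
      proof (cases "k < deg u")
        case True
        obtain e where e: "e < m" "inc u e" "rank u e = k" using edge_of_rank[OF True] .
        define x where "x = opp u e"
        have x: "x < n" using e by (simp add: x_def opp_less)
        have kn: "k < n" using True deg_less[OF u] by simp
        have k1: "k + 1 < B" using kn B_nm by simp
        have ed: "arrs s 10 (u * n + k) = e" using d(7)[OF e(1) u e(2)] e(3) by simp
        have ab: "a e + b e < B" using a_less[OF e(1)] b_less[OF e(1)] B_nm by simp
        have xe: "a e + b e - u = x" using opp_eq[OF e(1,2)] by (simp add: x_def)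
        note mul = mult_add_less[OF u kn]
        have skip: "bfs_inv (F s0) lab q cnt p h t (k + 1)" if "e \<notin> F s0 \<or> lab x \<noteq> n"
          using bfs_edge_skip[OF inv F ht e(1)] e(2,3) that by (simp add: u_def x_def)
        have new: "bfs_inv (F s0) (lab(x := cnt - 1)) (q(t := x)) cnt p h (t + 1) (k + 1)" if "e \<in> F s0" "lab x = n"
          using bfs_edge_new[OF inv F ht that(1) _ _ _ that(2)] e(2,3) by (simp add: u_def x_def)
        have meas: "bfs_measure q' p h (k + 1) < bfs_measure q p h k" if "\<And>i. i < h \<Longrightarrow> q' i = q i" for q'
          using bfs_measure_edge[OF inv ht _ that] True by (simp add: u_def)
        have eF: "e \<in> F s0 \<longleftrightarrow> arrs s0 2 e \<noteq> 0" using e(1) by (simp add: F_def)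
        show ?thesis
        proof (cases "e \<in> F s0 \<and> lab x = n")
          case True
          then show ?thesis
            using new meas[of "q(t := x)"] ht \<open>k < deg u\<close> fr
            by (simp add: bfs_step_def wp_simps st d u_def[symmetric] ed xe ab mul small k1 B1 I_def \<mu> eF \<mu>_def del: One_nat_def)
        next
          case False
          then have "bfs_inv (F s0) lab q cnt p h t (k + 1)" "lab x \<noteq> n \<or> arrs s0 2 e = 0"
            using skip eF by auto
          then show ?thesis
            using meas[of q] ht \<open>k < deg u\<close> fr
            by (elim disjE) (simp_all add: bfs_step_def wp_simps st d u_def[symmetric] ed xe ab mul small k1 B1 I_def \<mu> \<mu>_def del: One_nat_def)
        qed
      next
        case False
        then have "bfs_inv (F s0) lab q cnt p (h + 1) t 0"
          using bfs_head[OF inv F ht] by (simp add: u_def)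
        then show ?thesis
          using bfs_measure_head[OF inv ht, unfolded Suc_eq_plus1] False ht fr
          by (simp add: bfs_step_def wp_simps st d u_def[symmetric] small B1 I_def \<mu> \<mu>_def del: One_nat_def)
      qed
    next
      case False
      then have pn: "p < n"
        using cond by (simp add: st d split: if_splits)
      show ?thesis
      proof (cases "lab p = n")
        case True
        then show ?thesis
          using bfs_root_new[OF inv pn True False F, unfolded Suc_eq_plus1] bfs_measure_root[OF pn, of h "q(t := p)" q k, unfolded Suc_eq_plus1] False fr D(2)
          by (simp add: bfs_step_def wp_simps st d small B1 I_def \<mu> \<mu>_def del: One_nat_def)
      next
        case lab: False
        then show ?thesis
          using bfs_root_skip[OF inv pn lab, unfolded Suc_eq_plus1] bfs_measure_root[OF pn, of h q q k, unfolded Suc_eq_plus1] False fr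
          by (simp add: bfs_step_def wp_simps st d small B1 I_def \<mu> \<mu>_def del: One_nat_def)
      qed
    qed
  qed
  have post: "frame ?X ?A s0 s \<and> labelled (F s0) s"
    if I: "I s" and stop: "eval_expr B s (Op Add (Op Less (Reg 10) (Reg 0)) (Op Less (Reg 11) (Reg 12))) = 0" for s
  proof -
    have fr: "frame ?X ?A s0 s"
      and inv: "bfs_inv (F s0) (arrs s 3) (arrs s 12) (regs s 2) (regs s 10) (regs s 11) (regs s 12) (regs s 13)"
      using I by (simp_all add: I_def)
    have "regs s 10 = n" "\<not> regs s 11 < regs s 12"
      using stop bfs_invD(1)[OF inv] data(1)[OF fr] B_nm by (auto split: if_splits)
    then show ?thesis
      unfolding labelled_def using bfs_exit[OF _ F] inv fr by blast
  qed
  let ?W = "While (Op Add (Op Less (Reg 10) (Reg 0)) (Op Less (Reg 11) (Reg 12))) bfs_step"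
  let ?Q = "\<lambda>s. frame ?X ?A s0 s \<and> labelled (F s0) s"
  show ?thesis
    unfolding label_def
  proof (subst wp_Assign, simp, rule wp_Cons[OF init])
    show "frame ?X ?A s0 (set_reg 7 (eval_expr B s0 (Num 0)) s0)"
      "regs (set_reg 7 (eval_expr B s0 (Num 0)) s0) 7 = 0" by simp_all
    fix s1 assume s1: "frame ?X ?A s0 s1 \<and> (\<forall>x<n. arrs s1 3 x = n)"
    define s2 where "s2 = set_reg 13 0 (set_reg 12 0 (set_reg 11 0 (set_reg 10 0 (set_reg 2 0 s1))))"
    have "I s2"
      using s1 bfs_inv_init by (simp add: s2_def I_def)
    moreover have "\<mu> s2 = 2 * n + 2 * m"
      by (simp add: s2_def \<mu>_def bfs_measure_init)
    ultimately have "wp B [?W] (22 * n + 22 * m + 1)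
      ?Q s2"
      by (intro wp_While[where I = I and T = 10 and \<mu> = \<mu>] body post) auto
    then show "wp B [Assign 2 (Num 0), Assign 10 (Num 0), Assign 11 (Num 0), Assign 12 (Num 0), Assign 13 (Num 0),
     ?W] (22 * n + 22 * m + 6)
      ?Q s1"
      by (simp add: wp_Assign s2_def)
  qed simp
qed

end

section \<open>Minimum degree, bit length and the drawing of random numbers\<close>

definition setup_min :: "instr list" where
  "setup_min =
    [Assign 4 (Reg 0), Assign 7 (Num 0),
     While (Op Less (Reg 7) (Reg 0))
      [If (Op Less (Cell 7 (Reg 7)) (Reg 4)) [Assign 4 (Cell 7 (Reg 7))] [],
       Assign 7 (Op Add (Reg 7) (Num 1))]]"

definition setup_log :: "nat \<Rightarrow> instr list" where
  "setup_log c1 =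
    [Assign 8 (Reg 0),
     While (Reg 8) [Assign 8 (Op Div (Reg 8) (Num 2)), Assign 5 (Op Add (Reg 5) (Num 1))],
     Assign 18 (Op Mul (Num c1) (Reg 5))]"

text \<open>The largest value of the coordinate whose index is in register 7.\<close>

definition range_expr :: expr where
  "range_expr =
    Op Add (Op Mul (Op Less (Reg 7) (Op Mul (Num 2) (Reg 0)))
              (Op Sub (Cell 7 (Op Mod (Reg 7) (Reg 0))) (Num 1)))
           (Op Mul (Op Sub (Num 1) (Op Less (Reg 7) (Op Mul (Num 2) (Reg 0))))
              (Op Sub (Op Mul (Num 2) (Reg 4)) (Num 1)))"

text \<open>The scratch register is cleared in every round so that, at the loop head, states reached
  by different draws differ only in the array of random numbers.\<close>

definition draw_loop :: instr where
  "draw_loop =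
    While (Op Less (Reg 7) (Op Add (Op Mul (Num 2) (Reg 0)) (Reg 1)))
     [Rand 8 range_expr, Store 11 (Reg 9) (Reg 8), Assign 9 (Op Add (Reg 9) (Num 1)),
      Assign 7 (Op Add (Reg 7) (Num 1)), Assign 8 (Num 0)]"

definition draws_loop :: instr where
  "draws_loop =
    While (Op Less (Reg 6) (Reg 18))
     [draw_loop, Assign 7 (Num 0), Assign 6 (Op Add (Reg 6) (Num 1))]"

context ram_graph
begin

lemma wp_setup_min:
  assumes inp: "input s0" and adj: "adj_ok s0"
  shows "wp B setup_min (4 * n + 3) (\<lambda>s. frame {4, 7} {} s0 s \<and> regs s 4 = \<delta>) s0"
proof -
  have data: "regs s 0 = n" "\<And>v. arrs s 7 v = deg v" if "frame {4, 7} {} s0 s" for s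
  proof -
    have "input s" using inp that by (rule input_frame) auto
    moreover have "adj_ok s" using adj that by (rule adj_ok_frame) auto
    ultimately show "regs s 0 = n" "\<And>v. arrs s 7 v = deg v" by (auto simp: input_def adj_ok_def)
  qed
  have "wp B [While (Op Less (Reg 7) (Reg 0))
      [If (Op Less (Cell 7 (Reg 7)) (Reg 4)) [Assign 4 (Cell 7 (Reg 7))] [],
       Assign 7 (Op Add (Reg 7) (Num 1))]] (4 * n + 1) (\<lambda>s. frame {4, 7} {} s0 s \<and> regs s 4 = \<delta>)
    (set_reg 7 0 (set_reg 4 n s0))"
  proof (rule wp_While[where T = 3 and \<mu> = "\<lambda>s. n - regs s 7" and I = "\<lambda>s. frame {4, 7} {} s0 s \<and>
      regs s 7 \<le> n \<and> (\<forall>v<regs s 7. regs s 4 \<le> deg v) \<and> (regs s 4 = n \<or> (\<exists>v<n. regs s 4 = deg v))"], goal_cases)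
    case (3 s)
    then have fr: "frame {4, 7} {} s0 s" by simp
    have "regs s 7 < n" using 3 data[OF fr] by (simp split: if_splits)
    moreover have "regs s 7 + 1 < B" using calculation B_nm by simp
    ultimately show ?case
      using 3 B_gt_1 by (auto simp: wp_simps data[OF fr] less_Suc_eq)
  next
    case (4 s)
    then have fr: "frame {4, 7} {} s0 s" by simp
    obtain v where v: "v < n" "deg v = \<delta>" using \<delta>_attained by blast
    have "regs s 7 = n" using 4 data[OF fr] by (simp split: if_splits)
    then have "regs s 4 \<le> \<delta>" using 4 v by auto
    \<comment> \<open>The initial value \<open>n\<close> exceeds every degree, so it has been
      replaced by one.\<close>
    moreover have "\<delta> < n" using v deg_less[of v] by simp
    ultimately have "regs s 4 = \<delta>" using 4 \<delta>_le by force
    then show ?case using fr by simp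
  qed (auto simp: data)
  then show ?thesis
    unfolding setup_min_def using data[OF frame_refl] by (simp add: wp_simps)
qed

lemma wp_setup_log:
  assumes inp: "input s0" and "regs s0 5 = 0"
  shows "wp B (setup_log c1) (3 * lg + 3) (\<lambda>s. frame {5, 8, 18} {} s0 s \<and> regs s 5 = lg \<and> regs s 18 = c1 * lg) s0"
proof -
  have n: "regs s0 0 = n" using inp by (simp add: input_def)
  have loop: "wp B [While (Reg 8) [Assign 8 (Op Div (Reg 8) (Num 2)), Assign 5 (Op Add (Reg 5) (Num 1))]]
      (3 * lg + 1) (\<lambda>s. frame {5, 8, 18} {} s0 s \<and> regs s 5 = lg) (set_reg 8 n s0)"
  proof (rule wp_While[where T = 2 and \<mu> = "\<lambda>s. lg - regs s 5" and I = "\<lambda>s. frame {5, 8, 18} {} s0 s \<and>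
      regs s 8 = n div 2 ^ regs s 5 \<and> regs s 5 \<le> lg"], goal_cases)
    case (3 s)
    then have "2 ^ regs s 5 \<le> n"
      by (simp add: div_greater_zero_iff)
    then have "(2::nat) ^ regs s 5 < 2 ^ lg" using lg by linarith
    then have "regs s 5 < lg" by simp
    moreover have "regs s 5 + 1 < B" using calculation B_const by simp
    moreover have "n div 2 ^ regs s 5 div 2 = n div (2 * 2 ^ regs s 5)"
      by (metis div_mult2_eq mult.commute)
    ultimately show ?case
      using 3 B_gt_1 by (auto simp: wp_simps)
  next
    case (4 s)
    then have "n < 2 ^ regs s 5"
      by (simp add: div_eq_0_iff)
    then have "(2::nat) ^ (lg - 1) < 2 ^ regs s 5" using lg by linarith
    then have "lg - 1 < regs s 5" by simp
    then show ?case using 4 by auto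
  qed (use assms in auto)
  have "c1 < B" "c1 * lg < B" using B_const by auto
  then have "wp B [Assign 18 (Op Mul (Num c1) (Reg 5))] 1
      (\<lambda>s. frame {5, 8, 18} {} s0 s \<and> regs s 5 = lg \<and> regs s 18 = c1 * lg) s"
    if "frame {5, 8, 18} {} s0 s \<and> regs s 5 = lg" for s
    using that by (simp add: wp_simps)
  then have "wp B [While (Reg 8) [Assign 8 (Op Div (Reg 8) (Num 2)), Assign 5 (Op Add (Reg 5) (Num 1))],
      Assign 18 (Op Mul (Num c1) (Reg 5))] (3 * lg + 2)
      (\<lambda>s. frame {5, 8, 18} {} s0 s \<and> regs s 5 = lg \<and> regs s 18 = c1 * lg) (set_reg 8 n s0)"
    by (rule wp_Cons[OF loop]) simp_all
  then show ?thesis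
    unfolding setup_log_def by (simp add: wp_Assign n)
qed

text \<open>Normal form of the states at the loop heads of the random phase: all randomness sits in
  \<open>R\<close>, so a distribution of states is the image of a distribution of arrays.\<close>

definition drawn :: "ram_state \<Rightarrow> nat \<Rightarrow> nat \<Rightarrow> nat \<Rightarrow> (nat \<Rightarrow> nat) \<Rightarrow> ram_state" where
  "drawn s i j k R = s\<lparr>regs := (regs s)(6 := i, 7 := j, 8 := 0, 9 := k), arrs := (arrs s)(11 := R)\<rparr>"

lemma regs_drawn [simp]:
  "regs (drawn s i j k R) x = (if x = 9 then k else if x = 8 then 0 else if x = 7 then j else if x = 6 then i else regs s x)"
  and arrs_drawn [simp]: "arrs (drawn s i j k R) x = (if x = 11 then R else arrs s x)"
  by (simp_all add: drawn_def)

lemma ram_state_eqI: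
  "(\<And>x. regs s x = regs s' x) \<Longrightarrow> (\<And>x. arrs s x = arrs s' x) \<Longrightarrow> s = (s' :: ram_state)"
  by (cases s, cases s') (simp add: fun_eq_iff)

lemma eval_range:
  assumes "static s" "j < 2 * n + m"
  shows "eval_expr B (drawn s i j k R) range_expr = bnd j"
proof -
  have s: "regs s 0 = n" "regs s 1 = m" "regs s 4 = \<delta>" "\<And>v. arrs s 7 v = deg v"
    using assms by (auto simp: static_def input_def adj_ok_def)
  have "j mod n < n" if "j < 2 * n" using that by simp
  then have "deg (j mod n) < n" if "j < 2 * n" using that deg_less by simp
  then have "deg (j mod n) - 1 < B" if "j < 2 * n" using that B_nm by force
  then show ?thesis
    using B_nm by (simp add: range_expr_def s bnd_def)
qed

text \<open>Induction on the number of coordinates still to be drawn: drawing coordinate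
  \<open>j\<close> and then the others is the product distribution on \<open>{j..<2 * n + m}\<close>
  split at \<open>j\<close>.\<close>

lemma pexec_draw_loop:
  assumes "static s" "j \<le> 2 * n + m" "k + (2 * n + m) < B"
  shows "pexec B [draw_loop] (drawn s i j (k + j) R) (6 * (2 * n + m - j) + 1)
    (map_pmf (\<lambda>\<omega>. drawn s i (2 * n + m) (k + (2 * n + m))
       (\<lambda>x. if k + j \<le> x \<and> x < k + (2 * n + m) then \<omega> (x - k) else R x)) (sample {j..<2 * n + m}))"
  using assms(2)
proof (induction "2 * n + m - j" arbitrary: j R)
  case 0
  let ?M = "2 * n + m"
  have s: "regs s 0 = n" "regs s 1 = m"
    using assms(1) by (auto simp: static_def input_def)
  have j: "j = ?M" using 0 by simp
  have R: "(\<lambda>x. if k + ?M \<le> x \<and> x < k + ?M then \<omega> (x - k) else R x) = R" for \<omega> :: "nat \<Rightarrow> nat"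
    by auto
  have "eval_expr B (drawn s i j (k + j) R) (Op Less (Reg 7) (Op Add (Op Mul (Num 2) (Reg 0)) (Reg 1))) = 0"
    using B_nm j s by simp
  then have "exec B [draw_loop] (drawn s i j (k + j) R) (Suc 0) (drawn s i j (k + j) R)"
    unfolding draw_loop_def by (rule pexec_While_False) (rule pexec_Nil)
  then show ?case using j R by (simp add: sample_def)
next
  case (Suc d)
  let ?M = "2 * n + m"
  have s: "regs s 0 = n" "regs s 1 = m"
    using assms(1) by (auto simp: static_def input_def)
  have j: "j < ?M" using Suc by simp
  let ?st = "drawn s i j (k + j) R"
  define p where "p = (\<lambda>x. map_pmf (\<lambda>\<omega>. drawn s i ?M (k + ?M)
       (\<lambda>y. if k + Suc j \<le> y \<and> y < k + ?M then \<omega> (y - k) else (R(k + j := x)) y)) (sample {Suc j..<?M}))"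
  have cond: "eval_expr B ?st (Op Less (Reg 7) (Op Add (Op Mul (Num 2) (Reg 0)) (Reg 1))) \<noteq> 0"
    using B_nm j s by simp
  have tail: "pexec B [Store 11 (Reg 9) (Reg 8), Assign 9 (Op Add (Reg 9) (Num 1)),
      Assign 7 (Op Add (Reg 7) (Num 1)), Assign 8 (Num 0), draw_loop] (set_reg 8 x ?st)
      (Suc (Suc (Suc (Suc (6 * (?M - Suc j) + 1))))) (p x)" for x
  proof -
    have small: "k + j + 1 < B" "j + 1 < B" using j assms(3) by auto
    define s1 where "s1 = set_cell 11 (k + j) x (set_reg 8 x ?st)"
    have "set_reg 8 0 (set_reg 7 (j + 1) (set_reg 9 (k + j + 1) s1)) = drawn s i (Suc j) (k + Suc j) (R(k + j := x))"
      by (rule ram_state_eqI) (simp_all add: s1_def)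
    moreover have "pexec B [draw_loop] (drawn s i (Suc j) (k + Suc j) (R(k + j := x))) (6 * (?M - Suc j) + 1) (p x)"
      unfolding p_def using Suc.hyps j by (intro Suc.hyps(1)) auto
    ultimately show ?thesis
      using small B_gt_1 by (intro pexec_Store pexec_Assign) (simp add: s1_def del: One_nat_def)
  qed
  have "pexec B [draw_loop] ?st (Suc (Suc (Suc (Suc (Suc (Suc (6 * (?M - Suc j) + 1)))))))
    (bind_pmf (pmf_of_set {0..eval_expr B ?st range_expr}) p)"
    unfolding draw_loop_def
    by (rule pexec_While_True[OF cond], simp only: append_Cons append_Nil, rule pexec_Rand,
        rule tail[unfolded draw_loop_def])
  moreover have "bind_pmf (pmf_of_set {0..eval_expr B ?st range_expr}) p =
    map_pmf (\<lambda>\<omega>. drawn s i ?M (k + ?M)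
       (\<lambda>x. if k + j \<le> x \<and> x < k + ?M then \<omega> (x - k) else R x)) (sample {j..<?M})"
  proof -
    have U: "{j..<?M} = insert j {Suc j..<?M}" using j by auto
    have upd: "(\<lambda>y. if k + Suc j \<le> y \<and> y < k + ?M then \<omega> (y - k) else (R(k + j := x)) y)
       = (\<lambda>y. if k + j \<le> y \<and> y < k + ?M then (fun_upd \<omega> j x) (y - k) else R y)" for x and \<omega> :: "nat \<Rightarrow> nat"
      using j by (auto simp: fun_eq_iff)
    have "sample (insert j {Suc j..<?M}) =
      bind_pmf (pmf_of_set {0..bnd j}) (\<lambda>x. map_pmf (\<lambda>\<omega>. fun_upd \<omega> j x) (sample {Suc j..<?M}))"
      by (simp add: sample_def Pi_pmf_insert' map_pmf_def)
    then show ?thesis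
      unfolding p_def upd U eval_range[OF assms(1) j]
      by (simp add: map_bind_pmf pmf.map_comp comp_def)
  qed
  moreover have "Suc (Suc (Suc (Suc (Suc (Suc (6 * (?M - Suc j) + 1)))))) = 6 * (?M - j) + 1"
    using j by simp
  ultimately show ?case by simp
qed

text \<open>The loop is still pending after \<open>i\<close> rounds, so the induction adds a round
  at the end, just as \<open>samples\<close> appends a block. A round takes one test,
  \<open>6 * (2 * n + m) + 1\<close> steps for the draws and two assignments.\<close>

lemma run_draws_loop:
  assumes "static s" "i \<le> c1 * lg"
  shows "run B (i * (6 * (2 * n + m) + 4)) (draws_loop # rest, drawn s 0 0 0 (\<lambda>_. 0))
    = map_pmf (\<lambda>R. (draws_loop # rest, drawn s i 0 (i * (2 * n + m)) R)) (samples i)"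
  using assms(2)
proof (induction i)
  case 0
  then show ?case by simp
next
  case (Suc i)
  let ?M = "2 * n + m"
  have s: "regs s 18 = c1 * lg" using assms by (auto simp: static_def)
  have "Suc i * ?M \<le> c1 * lg * ?M" using Suc.prems by (rule mult_le_mono1)
  then have iM: "i * ?M + ?M < B" using B_draw by simp
  have i: "i + 1 < B" using Suc.prems B_const by simp
  have step: "run B (6 * ?M + 4) (draws_loop # rest, drawn s i 0 (i * ?M) R)
    = map_pmf (\<lambda>\<omega>. (draws_loop # rest, drawn s (Suc i) 0 (Suc i * ?M) (put (i * ?M) R \<omega>))) (sample coords)" for R
  proof -
    let ?st = "drawn s i 0 (i * ?M) R"
    have cond: "eval_expr B ?st (Op Less (Reg 6) (Reg 18)) \<noteq> 0"
      using s Suc.prems by simp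
    have inner: "pexec B [draw_loop] ?st (6 * ?M + 1)
        (map_pmf (\<lambda>\<omega>. drawn s i ?M (Suc i * ?M) (put (i * ?M) R \<omega>)) (sample coords))"
      using pexec_draw_loop[OF assms(1), of 0 "i * ?M" i R] iM
      by (simp add: put_def atLeast0LessThan add.commute[of "i * ?M"])
    have tail: "exec B [Assign 7 (Num 0), Assign 6 (Op Add (Reg 6) (Num 1))] (drawn s i ?M k R') (Suc (Suc 0))
        (drawn s (Suc i) 0 k R')" for k R'
    proof -
      have "set_reg 6 (i + 1) (set_reg 7 0 (drawn s i ?M k R')) = drawn s (Suc i) 0 k R'"
        by (rule ram_state_eqI) simp_all
      then show ?thesis
        using i B_gt_1 pexec_Nil[of B "drawn s (Suc i) 0 k R'"]
        by (intro pexec_Assign) (simp del: One_nat_def)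
    qed
    have "pexec B ([draw_loop] @ [Assign 7 (Num 0), Assign 6 (Op Add (Reg 6) (Num 1))]) ?st (6 * ?M + 1 + Suc (Suc 0))
       (bind_pmf (map_pmf (\<lambda>\<omega>. drawn s i ?M (Suc i * ?M) (put (i * ?M) R \<omega>)) (sample coords))
         (\<lambda>s1. return_pmf (drawn s (Suc i) 0 (Suc i * ?M) (arrs s1 11))))"
    proof (rule pexec_append[OF inner])
      fix s1 assume "s1 \<in> set_pmf (map_pmf (\<lambda>\<omega>. drawn s i ?M (Suc i * ?M) (put (i * ?M) R \<omega>)) (sample coords))"
      then obtain R' where s1: "s1 = drawn s i ?M (Suc i * ?M) R'" by auto
      show "exec B [Assign 7 (Num 0), Assign 6 (Op Add (Reg 6) (Num 1))] s1 (Suc (Suc 0))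
         (drawn s (Suc i) 0 (Suc i * ?M) (arrs s1 11))"
        using tail[of "Suc i * ?M" R'] by (simp only: s1 arrs_drawn simp_thms if_True)
    qed
    then have body: "pexec B [draw_loop, Assign 7 (Num 0), Assign 6 (Op Add (Reg 6) (Num 1))] ?st (6 * ?M + 3)
       (map_pmf (\<lambda>\<omega>. drawn s (Suc i) 0 (Suc i * ?M) (put (i * ?M) R \<omega>)) (sample coords))"
      by (simp add: numeral_3_eq_3 pmf.map_comp comp_def flip: map_pmf_def)
    have "run B (Suc (6 * ?M + 3)) (draws_loop # rest, ?st)
      = run B (6 * ?M + 3) ([draw_loop, Assign 7 (Num 0), Assign 6 (Op Add (Reg 6) (Num 1))] @ (draws_loop # rest), ?st)"
      using cond by (simp only: run.simps draws_loop_def step.simps bind_return_pmf if_True simp_thms append_Cons append_Nil)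
    also have "\<dots> = map_pmf (Pair (draws_loop # rest)) (map_pmf (\<lambda>\<omega>. drawn s (Suc i) 0 (Suc i * ?M) (put (i * ?M) R \<omega>)) (sample coords))"
      using body unfolding pexec_def by blast
    finally show ?thesis by (simp add: pmf.map_comp comp_def add.commute[of 4] eval_nat_numeral)
  qed
  have "run B (Suc i * (6 * ?M + 4)) (draws_loop # rest, drawn s 0 0 0 (\<lambda>_. 0))
    = bind_pmf (run B (i * (6 * ?M + 4)) (draws_loop # rest, drawn s 0 0 0 (\<lambda>_. 0))) (run B (6 * ?M + 4))"
    by (simp only: mult_Suc add.commute[of "6 * ?M + 4"] run_add)
  also have "\<dots> = bind_pmf (samples i) (\<lambda>R. run B (6 * ?M + 4) (draws_loop # rest, drawn s i 0 (i * ?M) R))"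
    using Suc by (simp add: bind_map_pmf)
  finally show ?case
    by (simp only: step samples.simps map_bind_pmf pmf.map_comp comp_def)
qed

end

section \<open>Tallying the samples and writing the output\<close>

definition same_label :: expr where
  "same_label = Op Equal (Cell 3 (Cell 0 (Reg 7))) (Cell 3 (Cell 1 (Reg 7)))"

definition for_edges :: "instr list \<Rightarrow> instr list" where
  "for_edges cs =
    [Assign 7 (Num 0),
     While (Op Less (Reg 7) (Reg 1)) (cs @ [Assign 7 (Op Add (Reg 7) (Num 1))])]"

text \<open>A disjunction written as a sum of truth values: an edge is selected by one of the two
  picks of either endpoint or by its own coordinate. Register 8 holds the offset of the current
  block.\<close>

definition selected_expr :: expr where
  "selected_expr =
        Op Add (Op Equal (Cell 11 (Op Add (Reg 8) (Cell 0 (Reg 7)))) (Cell 8 (Reg 7)))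
        (Op Add (Op Equal (Cell 11 (Op Add (Reg 8) (Op Add (Reg 0) (Cell 0 (Reg 7))))) (Cell 8 (Reg 7)))
        (Op Add (Op Equal (Cell 11 (Op Add (Reg 8) (Cell 1 (Reg 7)))) (Cell 9 (Reg 7)))
        (Op Add (Op Equal (Cell 11 (Op Add (Reg 8) (Op Add (Reg 0) (Cell 1 (Reg 7))))) (Cell 9 (Reg 7)))
                (Op Equal (Cell 11 (Op Add (Reg 8) (Op Add (Op Mul (Num 2) (Reg 0)) (Reg 7)))) (Num 0)))))"

definition flag_selected :: "instr list" where
  "flag_selected =
    Assign 8 (Op Mul (Reg 6) (Op Add (Op Mul (Num 2) (Reg 0)) (Reg 1))) #
    for_edges
      [Store 2 (Reg 7)
        selected_expr]"

definition count_surviving :: "instr list" where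
  "count_surviving =
    Assign 16 (Num 0) # for_edges [If same_label [] [Assign 16 (Op Add (Reg 16) (Num 1))]]"

definition add_surviving :: "nat \<Rightarrow> instr list" where
  "add_surviving c3 =
    [If (Op Less (Op Mul (Num c3) (Reg 0)) (Reg 16)) []
      (for_edges [If same_label [] [Store 13 (Reg 7) (Op Add (Cell 13 (Reg 7)) (Num 1))]])]"

definition samples_loop :: "nat \<Rightarrow> instr list" where
  "samples_loop c3 =
    [While (Op Less (Reg 6) (Reg 18))
      (flag_selected @ label @ count_surviving @ add_surviving c3 @ [Assign 6 (Op Add (Reg 6) (Num 1))])]"

definition flag_rare :: "nat \<Rightarrow> instr list" where
  "flag_rare c2 = for_edges [Store 2 (Reg 7) (Op Less (Cell 13 (Reg 7)) (Op Mul (Num c2) (Reg 5)))]"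

definition list_edges :: "instr list" where
  "list_edges =
    Assign 3 (Num 0) #
    for_edges
      [If same_label []
        [Store 4 (Reg 3) (Reg 7), Store 5 (Reg 3) (Cell 3 (Cell 0 (Reg 7))),
         Store 6 (Reg 3) (Cell 3 (Cell 1 (Reg 7))), Assign 3 (Op Add (Reg 3) (Num 1))]]"

context ram_graph
begin

text \<open>\<open>I e\<close> is the invariant on entering round \<open>e\<close>; the body has to
  establish the next one for the state with the counter already advanced.\<close>

lemma wp_for_edges:
  assumes start: "I 0 (set_reg 7 0 s0)"
    and body: "\<And>e s. e < m \<Longrightarrow> I e s \<Longrightarrow> regs s 7 = e \<Longrightarrow>
      wp B cs T (\<lambda>s'. regs s' 7 = e \<and> I (e + 1) (set_reg 7 (e + 1) s')) s"
    and st: "\<And>e s. I e s \<Longrightarrow> static s" and T': "Suc (Suc T) * m + 2 \<le> T'"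
  shows "wp B (for_edges cs) T' (I m) s0"
proof -
  let ?J = "\<lambda>s. regs s 7 \<le> m \<and> I (regs s 7) s"
  have "wp B [While (Op Less (Reg 7) (Reg 1)) (cs @ [Assign 7 (Op Add (Reg 7) (Num 1))])]
     (Suc (Suc T) * m + 1) (I m) (set_reg 7 0 s0)"
  proof (rule wp_While[where I = ?J and T = "Suc T" and \<mu> = "\<lambda>s. m - regs s 7"])
    fix s assume J: "?J s" and cond: "eval_expr B s (Op Less (Reg 7) (Reg 1)) \<noteq> 0"
    have e: "regs s 7 < m" using J static_data[OF st[of "regs s 7" s]] cond by (simp split: if_splits)
    have eB: "regs s 7 + 1 < B" using e B_nm by simp
    show "wp B (cs @ [Assign 7 (Op Add (Reg 7) (Num 1))]) (Suc T) (\<lambda>s'. ?J s' \<and> m - regs s' 7 < m - regs s 7) s"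
    proof (rule wp_append[OF body[OF e _ refl]])
      show "I (regs s 7) s" using J by simp
      fix s1 assume "regs s1 7 = regs s 7 \<and> I (regs s 7 + 1) (set_reg 7 (regs s 7 + 1) s1)"
      then show "wp B [Assign 7 (Op Add (Reg 7) (Num 1))] 1 (\<lambda>s'. ?J s' \<and> m - regs s' 7 < m - regs s 7) s1"
        using e eB B_gt_1 by (simp add: wp_simps diff_less_mono2 del: One_nat_def)
    qed simp
  next
    fix s assume J: "?J s" and stop: "eval_expr B s (Op Less (Reg 7) (Reg 1)) = 0"
    then have "regs s 7 = m" using static_data[OF st[of "regs s 7" s]] by (simp split: if_splits)
    then show "I m s" using J by simp
  qed (use start in auto)
  then have "wp B (for_edges cs) (Suc (Suc T) * m + 2) (I m) s0"
    unfolding for_edges_def by (simp add: wp_Assign)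
  then show ?thesis by (rule wp_mono[OF _ _ T'])
qed

lemma selected_iff:
  assumes "e < m"
  shows "e \<in> selected coords \<omega> \<longleftrightarrow> \<omega> (a e) = rank (a e) e \<or> \<omega> (n + a e) = rank (a e) e \<or>
    \<omega> (b e) = rank (b e) e \<or> \<omega> (n + b e) = rank (b e) e \<or> \<omega> (2 * n + e) = 0"
proof -
  have ab: "a e < n" "b e < n" using assms a_less b_less by auto
  have "e \<in> selected coords \<omega> \<longleftrightarrow> (\<exists>j<2 * n. inc (j mod n) e \<and> rank (j mod n) e = \<omega> j) \<or> \<omega> (2 * n + e) = 0"
    using assms by (auto simp: selected_def sel_def split: if_splits)
  also have "(\<exists>j<2 * n. inc (j mod n) e \<and> rank (j mod n) e = \<omega> j) \<longleftrightarrow>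
     (\<exists>v<n. inc v e \<and> (rank v e = \<omega> v \<or> rank v e = \<omega> (n + v)))"
  proof
    assume "\<exists>j<2 * n. inc (j mod n) e \<and> rank (j mod n) e = \<omega> j"
    then obtain j where j: "j < 2 * n" "inc (j mod n) e" "rank (j mod n) e = \<omega> j" by blast
    show "\<exists>v<n. inc v e \<and> (rank v e = \<omega> v \<or> rank v e = \<omega> (n + v))"
    proof (cases "j < n")
      case True
      then show ?thesis using j by auto
    next
      case False
      then have "j mod n = j - n" using j by (simp add: le_mod_geq)
      then show ?thesis using j False by (intro exI[of _ "j - n"]) auto
    qed
  next
    assume "\<exists>v<n. inc v e \<and> (rank v e = \<omega> v \<or> rank v e = \<omega> (n + v))"
    then obtain v where v: "v < n" "inc v e" "rank v e = \<omega> v \<or> rank v e = \<omega> (n + v)" by blast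
    show "\<exists>j<2 * n. inc (j mod n) e \<and> rank (j mod n) e = \<omega> j"
    proof (cases "rank v e = \<omega> v")
      case True
      then show ?thesis using v by (intro exI[of _ v]) auto
    next
      case False
      then show ?thesis using v by (intro exI[of _ "n + v"]) auto
    qed
  qed
  finally show ?thesis using ab by (auto simp: inc_def)
qed

lemma wp_flag_selected:
  assumes st: "static s0" and i: "regs s0 6 = i" "i < c1 * lg" and R: "arrs s0 11 = R"
  shows "wp B flag_selected (3 * m + 3) (\<lambda>s. frame {7, 8} {2} s0 s \<and> F s = {e. e < m \<and> e \<in> selected coords (block R i)}) s0"
proof -
  let ?M = "2 * n + m"
  let ?I = "\<lambda>k s. frame {7, 8} {2} s0 s \<and> regs s 8 = i * ?M \<and>
    (\<forall>e<k. arrs s 2 e \<noteq> 0 \<longleftrightarrow> e \<in> selected coords (block R i))"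
  have "Suc i * ?M \<le> c1 * lg * ?M" using i by (intro mult_le_mono1) simp
  then have iM: "i * ?M + ?M < B" using B_draw by simp
  have "wp B (for_edges
      [Store 2 (Reg 7)
        selected_expr])
     (3 * m + 2) (?I m) (set_reg 8 (i * ?M) s0)"
  proof (rule wp_for_edges[where T = 1 and I = ?I])
    fix e s assume e: "e < m" and I: "?I e s" and r7: "regs s 7 = e"
    then have fr: "frame {7, 8} {2} s0 s" by simp
    have sts: "static s" using st fr by (rule static_frame) auto
    note d = static_data[OF sts]
    have R': "arrs s 11 = R" using frame_arr[OF fr, of 11] R by simp
    have ab: "a e < n" "b e < n" using e a_less b_less by auto
    have lt: "i * ?M + a e < B" "i * ?M + (n + a e) < B" "i * ?M + b e < B" "i * ?M + (n + b e) < B"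
      "i * ?M + (2 * n + e) < B" "n + a e < B" "n + b e < B" "2 * n + e < B" "2 * n < B"
      using ab e iM by simp_all
    let ?v = "eval_expr B s
        selected_expr"
    have v: "?v \<noteq> 0 \<longleftrightarrow> e \<in> selected coords (block R i)"
    proof -
      define p where "p x = (if x then 1 else 0 :: nat)" for x
      \<comment> \<open>A sum of five truth values stays below \<open>B\<close>, so it vanishes only
        if all of them do.\<close>
      have five: "(p x1 + (p x2 + (p x3 + (p x4 + p x5) mod B) mod B) mod B) mod B \<noteq> 0 \<longleftrightarrow> x1 \<or> x2 \<or> x3 \<or> x4 \<or> x5"
        for x1 x2 x3 x4 x5
        using B_nm by (simp add: p_def)
      have V: "?v = (p (R (i * ?M + a e) = rank (a e) e) + (p (R (i * ?M + (n + a e)) = rank (a e) e) +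
         (p (R (i * ?M + b e) = rank (b e) e) + (p (R (i * ?M + (n + b e)) = rank (b e) e) +
          p (R (i * ?M + (2 * n + e)) = 0)) mod B) mod B) mod B) mod B"
        using I by (simp only: selected_expr_def eval_expr.simps apply_op.simps d(1-4) d(6,7)[OF e] R' r7
            mod_less lt p_def B_gt_1 mod_0)
      have "?v \<noteq> 0 \<longleftrightarrow> R (i * ?M + a e) = rank (a e) e \<or> R (i * ?M + (n + a e)) = rank (a e) e \<or>
         R (i * ?M + b e) = rank (b e) e \<or> R (i * ?M + (n + b e)) = rank (b e) e \<or> R (i * ?M + (2 * n + e)) = 0"
        unfolding V by (rule five)
      then show ?thesis
        by (simp only: selected_iff[OF e] block_def)
    qed
    show "wp B
      [Store 2 (Reg 7)
        selected_expr] 1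
      (\<lambda>s'. regs s' 7 = e \<and> ?I (e + 1) (set_reg 7 (e + 1) s')) s"
      using I r7 v by (simp add: wp_simps less_Suc_eq)
  qed (use st in \<open>auto intro: static_frame\<close>)
  then have "wp B flag_selected (3 * m + 3) (?I m) s0"
    unfolding flag_selected_def using static_data[OF st] i iM B_gt_1 by (simp add: wp_Assign)
  then show ?thesis by (rule wp_mono) (auto simp: F_def)
qed

lemma same_label_eval:
  assumes "static s" "regs s 7 = e" "e < m"
  shows "eval_expr B s same_label = (if arrs s 3 (a e) = arrs s 3 (b e) then 1 else 0)"
  using assms static_data[OF assms(1)] by (simp add: same_label_def)

lemma wp_count_surviving:
  assumes st: "static s0"
  shows "wp B count_surviving (4 * m + 3)
    (\<lambda>s. frame {7, 16} {} s0 s \<and> regs s 16 = card {e. e < m \<and> arrs s0 3 (a e) \<noteq> arrs s0 3 (b e)}) s0"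
proof -
  let ?S = "\<lambda>k. {e. e < k \<and> arrs s0 3 (a e) \<noteq> arrs s0 3 (b e)}"
  let ?I = "\<lambda>k s. frame {7, 16} {} s0 s \<and> regs s 16 = card (?S k)"
  have "wp B (for_edges [If same_label [] [Assign 16 (Op Add (Reg 16) (Num 1))]]) (4 * m + 2) (?I m) (set_reg 16 0 s0)"
  proof (rule wp_for_edges[where T = 2 and I = ?I])
    fix e s assume e: "e < m" and I: "?I e s" and r7: "regs s 7 = e"
    then have fr: "frame {7, 16} {} s0 s" by simp
    have sts: "static s" using st fr by (rule static_frame) auto
    have arr: "arrs s 3 = arrs s0 3" using fr by (rule frame_arr) auto
    have "?S (e + 1) = (if arrs s0 3 (a e) = arrs s0 3 (b e) then ?S e else insert e (?S e))"
      by (auto simp: less_Suc_eq)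
    then have card: "card (?S (e + 1)) = (if arrs s0 3 (a e) = arrs s0 3 (b e) then card (?S e) else card (?S e) + 1)"
      by simp
    have "card (?S e) \<le> card {..<e}" by (intro card_mono) auto
    then have "card (?S e) + 1 < B" using e B_nm by simp
    then show "wp B [If same_label [] [Assign 16 (Op Add (Reg 16) (Num 1))]] 2
       (\<lambda>s'. regs s' 7 = e \<and> ?I (e + 1) (set_reg 7 (e + 1) s')) s"
      using I r7 B_gt_1 unfolding card
      by (simp add: wp_simps same_label_eval[OF sts r7 e] arr del: eval_expr.simps(4) One_nat_def) simp
  qed (use st in \<open>auto intro: static_frame\<close>)
  then show ?thesis
    unfolding count_surviving_def by (simp add: wp_Assign)
qed

lemma wp_add_surviving:
  assumes st: "static s0"
    and small: "\<And>e. e < m \<Longrightarrow> arrs s0 13 e + 1 < B"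
  shows "wp B (add_surviving c3) (4 * m + 3) (\<lambda>s. frame {7} {13} s0 s \<and>
    (\<forall>e<m. arrs s 13 e = arrs s0 13 e + (if regs s0 16 \<le> c3 * n \<and> arrs s0 3 (a e) \<noteq> arrs s0 3 (b e) then 1 else 0))) s0"
proof -
  let ?P = "\<lambda>e. arrs s0 3 (a e) \<noteq> arrs s0 3 (b e)"
  let ?I = "\<lambda>k s. frame {7} {13} s0 s \<and> (\<forall>e<m. arrs s 13 e = arrs s0 13 e + (if e < k \<and> ?P e then 1 else 0))"
  have loop: "wp B (for_edges [If same_label [] [Store 13 (Reg 7) (Op Add (Cell 13 (Reg 7)) (Num 1))]]) (4 * m + 2) (?I m) s0"
  proof (rule wp_for_edges[where T = 2 and I = ?I])
    fix e s assume e: "e < m" and I: "?I e s" and r7: "regs s 7 = e"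
    then have fr: "frame {7} {13} s0 s" by simp
    have sts: "static s" using st fr by (rule static_frame) auto
    have arr: "arrs s 3 = arrs s0 3" using fr by (rule frame_arr) auto
    have "arrs s 13 e = arrs s0 13 e" using I e by simp
    then show "wp B [If same_label [] [Store 13 (Reg 7) (Op Add (Cell 13 (Reg 7)) (Num 1))]] 2
       (\<lambda>s'. regs s' 7 = e \<and> ?I (e + 1) (set_reg 7 (e + 1) s')) s"
      using I r7 B_gt_1 small[OF e]
      by (auto simp: wp_simps same_label_eval[OF sts r7 e] arr less_Suc_eq)
  qed (use st in \<open>auto intro: static_frame\<close>)
  have "c3 * n < B" "c3 < B" using B_const by auto
  then show ?thesis
    using static_data[OF st] loop
    by (auto simp: add_surviving_def wp_simps not_less intro: wp_mono)
qed

lemma tally_le: "tally L l R e \<le> l"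
proof -
  have "tally L l R e \<le> card {..<l}"
    unfolding tally_def by (intro card_mono) auto
  then show ?thesis by simp
qed

lemma tally_Suc: "tally L (Suc l) R e = tally L l R e + (if e \<in> good L (block R l) then 1 else 0)"
proof -
  have "{i. i < Suc l \<and> e \<in> good L (block R i)} = (if e \<in> good L (block R l)
    then insert l {i. i < l \<and> e \<in> good L (block R i)} else {i. i < l \<and> e \<in> good L (block R i)})"
    by (auto simp: less_Suc_eq)
  then show ?thesis by (simp add: tally_def)
qed

lemma wp_samples_loop:
  assumes st: "static s0" and r6: "regs s0 6 = 0" and R: "arrs s0 11 = R" and cnt: "arrs s0 13 = (\<lambda>_. 0)"
  shows "wp B (samples_loop c3) ((25 * n + 33 * m + 19) * (c1 * lg) + 1)
    (\<lambda>s. static s \<and> (\<forall>e<m. arrs s 13 e = tally c3 (c1 * lg) R e)) s0"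
  unfolding samples_loop_def
proof (rule wp_While[where T = "25 * n + 33 * m + 18" and \<mu> = "\<lambda>s. c1 * lg - regs s 6" and
    I = "\<lambda>s. static s \<and> regs s 6 \<le> c1 * lg \<and> arrs s 11 = R \<and>
      (\<forall>e<m. arrs s 13 e = tally c3 (regs s 6) R e)"], goal_cases)
  case 1
  then show ?case using assms by (simp add: tally_def)
next
  case 2
  then show ?case using r6 by simp
next
  case (3 s)
  let ?Q = "\<lambda>s'. (static s' \<and> regs s' 6 \<le> c1 * lg \<and> arrs s' 11 = R \<and>
    (\<forall>e<m. arrs s' 13 e = tally c3 (regs s' 6) R e)) \<and> c1 * lg - regs s' 6 < c1 * lg - regs s 6"
  define i where "i = regs s 6"
  have st: "static s" using 3 by simp
  have i: "i < c1 * lg" using 3 static_data[OF st] by (simp add: i_def split: if_splits)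
  show ?case
  proof (rule wp_append[OF wp_flag_selected[OF st i_def[symmetric] i]])
    show "arrs s 11 = R" using 3 by simp
    fix s1 assume s1: "frame {7, 8} {2} s s1 \<and> F s1 = {e. e < m \<and> e \<in> selected coords (block R i)}"
    have st1: "static s1" using st s1 by (auto intro: static_frame)
    show "wp B (label @ count_surviving @ add_surviving c3 @ [Assign 6 (Op Add (Reg 6) (Num 1))]) (25 * n + 30 * m + 15)
      ?Q s1"
    proof (rule wp_append[OF wp_label[OF st1]])
      fix s2 assume s2: "frame {2, 7, 10, 11, 12, 13, 14, 15} {3, 12} s1 s2 \<and> labelled (F s1) s2"
      have st2: "static s2" using st1 s2 by (auto intro: static_frame)
      show "wp B (count_surviving @ add_surviving c3 @ [Assign 6 (Op Add (Reg 6) (Num 1))]) (8 * m + 7)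
      ?Q s2"
      proof (rule wp_append[OF wp_count_surviving[OF st2]])
        fix s3 assume s3: "frame {7, 16} {} s2 s3 \<and> regs s3 16 = card {e. e < m \<and> arrs s2 3 (a e) \<noteq> arrs s2 3 (b e)}"
        have st3: "static s3" using st2 s3 by (auto intro: static_frame)
        have arr3: "arrs s3 x = arrs s2 x" for x using s3 by (auto simp: frame_def)
        have s3': "arrs s3 11 = R" "arrs s3 13 = arrs s 13" "regs s3 6 = i"
          using s1 s2 s3 3 by (auto simp: frame_def i_def)
        have le: "arrs s 13 e \<le> i" if "e < m" for e
          using 3 that tally_le[of c3 i R e] by (simp add: i_def)
        have "i + 1 < B" using i B_const by simp
        then have lt: "arrs s3 13 e + 1 < B" if "e < m" for e using le[OF that] s3' by simp
        \<comment> \<open>Labels agree exactly on the components of the selected edges, so the edges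
          counted are the surviving ones in the sense of the analysis, with the labelling
          \<open>id\<close>.\<close>
        have surv: "{e. e < m \<and> arrs s3 3 (a e) \<noteq> arrs s3 3 (b e)} = surviving coords id (block R i)"
        proof -
          have "(a e, b e) \<in> conn id {e. e < m \<and> e \<in> selected coords (block R i)} \<longleftrightarrow> arrs s3 3 (a e) = arrs s3 3 (b e)" if "e < m" for e
            using s2 s1 that a_less b_less by (auto simp: labelled_def arr3)
          moreover have "{e. e < m \<and> e \<in> selected coords (block R i)} = selected coords (block R i)"
            by (auto simp: selected_def sel_def split: if_splits)
          ultimately show ?thesis by (auto simp: surviving_def)
        qed
        have good: "e \<in> good c3 (block R i) \<longleftrightarrow> regs s3 16 \<le> c3 * n \<and> arrs s3 3 (a e) \<noteq> arrs s3 3 (b e)" if "e < m" for e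
          using that s3 by (auto simp: good_def simp flip: surv simp: arr3)
        show "wp B (add_surviving c3 @ [Assign 6 (Op Add (Reg 6) (Num 1))]) (4 * m + 4)
      ?Q s3"
        proof (rule wp_append[OF wp_add_surviving[OF st3 lt]])
          fix s4 assume s4: "frame {7} {13} s3 s4 \<and> (\<forall>e<m. arrs s4 13 e = arrs s3 13 e +
            (if regs s3 16 \<le> c3 * n \<and> arrs s3 3 (a e) \<noteq> arrs s3 3 (b e) then 1 else 0))"
          have fr: "frame {6, 7} {13} s3 (set_reg 6 (i + 1) s4)" using s4 by (auto simp: frame_def)
          then have "static (set_reg 6 (i + 1) s4)" using st3 by (auto intro: static_frame)
          moreover have "arrs s4 11 = R" "regs s4 6 = i" using s4 s3' by (auto simp: frame_def)
          moreover have "arrs s4 13 e = tally c3 (i + 1) R e" if "e < m" for e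
            using s4 that s3' 3 good[OF that] by (simp add: tally_Suc i_def)
          ultimately show "wp B [Assign 6 (Op Add (Reg 6) (Num 1))] 1
      ?Q s4"
            using i \<open>i + 1 < B\<close> B_gt_1 by (simp add: wp_simps i_def[symmetric] diff_less_mono2 del: One_nat_def)
        qed simp_all
      qed simp
    qed simp
  qed simp
next
  case (4 s)
  then show ?case using static_data[of s] by (auto split: if_splits)
qed

definition rare :: "(nat \<Rightarrow> nat) \<Rightarrow> nat set" where
  "rare R = {e. e < m \<and> tally c3 (c1 * lg) R e < c2 * lg}"

lemma wp_flag_rare:
  assumes st: "static s0" and tal: "\<And>e. e < m \<Longrightarrow> arrs s0 13 e = tally c3 (c1 * lg) R e"
  shows "wp B (flag_rare c2) (3 * m + 2) (\<lambda>s. frame {7} {2} s0 s \<and> F s = rare R) s0"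
proof -
  let ?I = "\<lambda>k s. frame {7} {2} s0 s \<and> (\<forall>e<k. arrs s 2 e \<noteq> 0 \<longleftrightarrow> arrs s0 13 e < c2 * lg)"
  have c: "c2 * lg < B" "c2 < B" using B_const by auto
  have "wp B (flag_rare c2) (3 * m + 2) (?I m) s0"
    unfolding flag_rare_def
  proof (rule wp_for_edges[where T = 1 and I = ?I])
    fix e s assume e: "e < m" and I: "?I e s" and r7: "regs s 7 = e"
    then have fr: "frame {7} {2} s0 s" by simp
    have sts: "static s" using st fr by (rule static_frame) auto
    have "arrs s 13 = arrs s0 13" using fr by (rule frame_arr) auto
    then show "wp B [Store 2 (Reg 7) (Op Less (Cell 13 (Reg 7)) (Op Mul (Num c2) (Reg 5)))] 1
      (\<lambda>s'. regs s' 7 = e \<and> ?I (e + 1) (set_reg 7 (e + 1) s')) s"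
      using I r7 c static_data[OF sts] by (simp add: wp_simps less_Suc_eq)
  qed (use st in \<open>auto intro: static_frame\<close>)
  then show ?thesis by (rule wp_mono) (auto simp: F_def rare_def tal)
qed

lemma wp_list_edges:
  assumes st: "static s0"
  shows "wp B list_edges (7 * m + 3) (\<lambda>s. frame {3, 7} {4, 5, 6} s0 s \<and>
    bij_betw (arrs s 4) {..<regs s 3} {e. e < m \<and> arrs s0 3 (a e) \<noteq> arrs s0 3 (b e)} \<and>
    (\<forall>j<regs s 3. arrs s 5 j = arrs s0 3 (a (arrs s 4 j)) \<and> arrs s 6 j = arrs s0 3 (b (arrs s 4 j)))) s0"
proof -
  let ?S = "\<lambda>k. {e. e < k \<and> arrs s0 3 (a e) \<noteq> arrs s0 3 (b e)}"
  let ?I = "\<lambda>k s. frame {3, 7} {4, 5, 6} s0 s \<and> bij_betw (arrs s 4) {..<regs s 3} (?S k) \<and>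
    (\<forall>j<regs s 3. arrs s 5 j = arrs s0 3 (a (arrs s 4 j)) \<and> arrs s 6 j = arrs s0 3 (b (arrs s 4 j)))"
  let ?cs = "[If same_label [] [Store 4 (Reg 3) (Reg 7), Store 5 (Reg 3) (Cell 3 (Cell 0 (Reg 7))),
         Store 6 (Reg 3) (Cell 3 (Cell 1 (Reg 7))), Assign 3 (Op Add (Reg 3) (Num 1))]]"
  have "wp B (for_edges ?cs) (7 * m + 2) (?I m) (set_reg 3 0 s0)"
  proof (rule wp_for_edges[where T = 5 and I = ?I])
    fix e s assume e: "e < m" and I: "?I e s" and r7: "regs s 7 = e"
    then have fr: "frame {3, 7} {4, 5, 6} s0 s" and bij: "bij_betw (arrs s 4) {..<regs s 3} (?S e)" by simp_all
    have sts: "static s" using st fr by (rule static_frame) auto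
    note d = static_data[OF sts]
    have arr: "arrs s 3 = arrs s0 3" using fr by (rule frame_arr) auto
    have Suc: "?S (e + 1) = (if arrs s0 3 (a e) = arrs s0 3 (b e) then ?S e else insert e (?S e))"
      by (auto simp: less_Suc_eq)
    have "card {..<regs s 3} = card (?S e)" using bij by (rule bij_betw_same_card)
    also have "\<dots> \<le> card {..<e}" by (intro card_mono) auto
    finally have r3: "regs s 3 + 1 < B" using e B_nm by simp
    have "bij_betw ((arrs s 4)(regs s 3 := e)) {..<regs s 3} (?S e)"
      using bij by (rule iffD1[OF bij_betw_cong, rotated]) simp
    then have "bij_betw ((arrs s 4)(regs s 3 := e)) (insert (regs s 3) {..<regs s 3}) (insert (((arrs s 4)(regs s 3 := e)) (regs s 3)) (?S e))"
      by (subst notIn_Un_bij_betw3[symmetric, of "regs s 3", simplified]) auto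
    then have bij': "bij_betw ((arrs s 4)(regs s 3 := e)) {..<regs s 3 + 1} (insert e (?S e))"
      by (simp add: lessThan_Suc)
    show "wp B ?cs 5
       (\<lambda>s'. regs s' 7 = e \<and> ?I (e + 1) (set_reg 7 (e + 1) s')) s"
    proof (cases "arrs s0 3 (a e) = arrs s0 3 (b e)")
      case True
      then show ?thesis
        using I r7 unfolding Suc by (simp add: wp_simps same_label_eval[OF sts r7 e] arr)
    next
      case False
      then show ?thesis
        using I r7 r3 B_gt_1 bij' unfolding Suc
        by (simp add: wp_simps same_label_eval[OF sts r7 e] arr d del: One_nat_def)
    qed
  qed (use st in \<open>auto simp: bij_betw_def intro: static_frame\<close>)
  then show ?thesis
    unfolding list_edges_def by (simp add: wp_Assign)
qed

text \<open>The output conventions in terms of labels and connectivity;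
  \<open>output_ok_encodes\<close> translates them to the contracted graph.\<close>

definition output_ok :: "nat set \<Rightarrow> ram_state \<Rightarrow> bool" where
  "output_ok D s \<longleftrightarrow> F s = D \<and> labelled D s \<and>
    bij_betw (arrs s 4) {..<regs s 3} {e. e < m \<and> arrs s 3 (a e) \<noteq> arrs s 3 (b e)} \<and>
    (\<forall>j<regs s 3. arrs s 5 j = arrs s 3 (a (arrs s 4 j)) \<and> arrs s 6 j = arrs s 3 (b (arrs s 4 j)))"

lemma wp_output:
  assumes st: "static s0" and tal: "\<And>e. e < m \<Longrightarrow> arrs s0 13 e = tally c3 (c1 * lg) R e"
  shows "wp B (flag_rare c2 @ label @ list_edges) (25 * n + 32 * m + 13) (output_ok (rare R)) s0"
proof (rule wp_append[OF wp_flag_rare[OF st tal]])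
  fix s1 assume s1: "frame {7} {2} s0 s1 \<and> F s1 = rare R"
  have st1: "static s1" using st s1 by (auto intro: static_frame)
  show "wp B (label @ list_edges) (25 * n + 29 * m + 11) (output_ok (rare R)) s1"
  proof (rule wp_append[OF wp_label[OF st1]])
    fix s2 assume s2: "frame {2, 7, 10, 11, 12, 13, 14, 15} {3, 12} s1 s2 \<and> labelled (F s1) s2"
    have st2: "static s2" using st1 s2 by (auto intro: static_frame)
    have F2: "F s2 = rare R" using s1 s2 by (auto simp: F_def frame_def)
    show "wp B list_edges (7 * m + 3) (output_ok (rare R)) s2"
    proof (rule wp_mono[OF wp_list_edges[OF st2]])
      fix s3 assume s3: "frame {3, 7} {4, 5, 6} s2 s3 \<and>
        bij_betw (arrs s3 4) {..<regs s3 3} {e. e < m \<and> arrs s2 3 (a e) \<noteq> arrs s2 3 (b e)} \<and>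
        (\<forall>j<regs s3 3. arrs s3 5 j = arrs s2 3 (a (arrs s3 4 j)) \<and> arrs s3 6 j = arrs s2 3 (b (arrs s3 4 j)))"
      then have "arrs s3 3 = arrs s2 3" "arrs s3 2 = arrs s2 2" "regs s3 2 = regs s2 2"
        by (auto simp: frame_def)
      then show "output_ok (rare R) s3"
        using s1 s2 s3 F2 by (simp add: output_ok_def labelled_def F_def)
    qed simp
  qed simp
qed (simp_all)

lemma wp_main:
  assumes st: "static s0" and r6: "regs s0 6 = 0" and R: "arrs s0 11 = R" and cnt: "arrs s0 13 = (\<lambda>_. 0)"
  shows "wp B (samples_loop c3 @ flag_rare c2 @ label @ list_edges)
    ((25 * n + 33 * m + 19) * (c1 * lg) + (25 * n + 32 * m + 14)) (output_ok (rare R)) s0"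
  by (rule wp_append[OF wp_samples_loop[OF assms] wp_output]) auto

end

section \<open>The whole program\<close>

definition main_part :: "nat \<Rightarrow> nat \<Rightarrow> instr list" where
  "main_part c2 c3 = samples_loop c3 @ flag_rare c2 @ label @ list_edges"

definition program :: "nat \<Rightarrow> nat \<Rightarrow> nat \<Rightarrow> instr list" where
  "program c1 c2 c3 =
    (setup_adj @ setup_min @ setup_log c1 @ [Assign 7 (Num 0), Assign 8 (Num 0)]) @
    draws_loop # Assign 6 (Num 0) # main_part c2 c3"

text \<open>The halted configuration is a fixed point, so a time bound becomes an exact time, and
  all random outcomes get one common \<open>T\<close>.\<close>

lemma run_wp:
  assumes "wp B cs T Q s"
  obtains s' where "run B T (cs, s) = return_pmf ([], s')" "Q s'"
proof -
  obtain t s' where t: "t \<le> T" "exec B cs s t s'" "Q s'"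
    using assms unfolding wp_def by blast
  have "run B (t + (T - t)) (cs, s) = return_pmf ([], s')"
    using t(2) unfolding pexec_def run_add
    by (metis append_Nil2 bind_return_pmf map_return_pmf run_halted)
  then show ?thesis using that t by simp
qed

lemma wp_While_False:
  "0 < T \<Longrightarrow> eval_expr B s e = 0 \<Longrightarrow> wp B (While e cs1 # cs) T Q s \<longleftrightarrow> wp B cs (T - 1) Q s"
  by (subst wp_step[where ds = "[]"]) auto

context ram_graph
begin

definition blank :: "ram_state \<Rightarrow> bool" where
  "blank s \<longleftrightarrow> (\<forall>x\<ge>2. regs s x = 0) \<and> (\<forall>x\<ge>2. arrs s x = (\<lambda>_. 0))"

lemma wp_setup:
  assumes inp: "input s" and bl: "blank s"
  shows "wp B (setup_adj @ setup_min @ setup_log c1 @ [Assign 7 (Num 0), Assign 8 (Num 0)])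
    (8 * m + 4 * n + 3 * lg + 9) (\<lambda>s'. \<exists>s1. static s1 \<and> arrs s1 13 = (\<lambda>_. 0) \<and> s' = drawn s1 0 0 0 (\<lambda>_. 0)) s"
    (is "wp _ _ _ ?Q _")
proof (rule wp_append[OF wp_setup_adj[OF inp]])
  show "regs s 7 = 0" "arrs s 7 = (\<lambda>_. 0)" using bl by (auto simp: blank_def)
  fix s1 assume s1: "frame {7} {7, 8, 9, 10} s s1 \<and> adj_ok s1"
  have inp1: "input s1" using inp s1 by (auto intro: input_frame)
  show "wp B (setup_min @ setup_log c1 @ [Assign 7 (Num 0), Assign 8 (Num 0)]) (4 * n + 3 * lg + 8)
    ?Q s1"
  proof (rule wp_append[OF wp_setup_min[OF inp1]])
    show "adj_ok s1" using s1 by simp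
    fix s2 assume s2: "frame {4, 7} {} s1 s2 \<and> regs s2 4 = \<delta>"
    have inp2: "input s2" using inp1 s2 by (auto intro: input_frame)
    have adj2: "adj_ok s2" using s1 s2 by (auto intro: adj_ok_frame)
    show "wp B (setup_log c1 @ [Assign 7 (Num 0), Assign 8 (Num 0)]) (3 * lg + 5)
      ?Q s2"
    proof (rule wp_append[OF wp_setup_log[OF inp2]])
      show "regs s2 5 = 0" using bl s1 s2 by (simp add: blank_def frame_def)
      fix s3 assume s3: "frame {5, 8, 18} {} s2 s3 \<and> regs s3 5 = lg \<and> regs s3 18 = c1 * lg"
      have "input s3" using inp2 s3 by (auto intro: input_frame)
      moreover have "adj_ok s3" using adj2 s3 by (auto intro: adj_ok_frame)
      moreover have "regs s3 4 = \<delta>" using s2 s3 by (simp add: frame_def)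
      ultimately have st: "static s3" using s3 by (simp add: static_def)
      have z: "regs s3 6 = 0" "regs s3 9 = 0" "arrs s3 11 = (\<lambda>_. 0)" "arrs s3 13 = (\<lambda>_. 0)"
        using bl s1 s2 s3 by (simp_all add: blank_def frame_def)
      have "set_reg 8 0 (set_reg 7 0 s3) = drawn s3 0 0 0 (\<lambda>_. 0)"
        by (rule ram_state_eqI) (simp_all add: z)
      then show "wp B [Assign 7 (Num 0), Assign 8 (Num 0)] 2
        ?Q s3"
        using st z B_gt_1 by (auto simp: wp_simps)
    qed simp
  qed simp
qed simp

lemma run_program:
  assumes inp: "input s" and bl: "blank s"
  obtains t f where "t \<le> (8 * m + 4 * n + 3 * lg + 9) + c1 * lg * (6 * (2 * n + m) + 4) +
      ((25 * n + 33 * m + 19) * (c1 * lg) + (25 * n + 32 * m + 16))"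
    and "run B t (program c1 c2 c3, s) = map_pmf (\<lambda>R. ([], f R)) (samples (c1 * lg))"
    and "\<And>R. output_ok (rare R) (f R)"
proof -
  let ?l = "c1 * lg" and ?M = "2 * n + m"
  let ?rest = "Assign 6 (Num 0) # main_part c2 c3"
  define T where "T = (25 * n + 33 * m + 19) * (c1 * lg) + (25 * n + 32 * m + 16)"
  obtain t1 s1 where t1: "t1 \<le> 8 * m + 4 * n + 3 * lg + 9" and st: "static s1" and z: "arrs s1 13 = (\<lambda>_. 0)"
    and ex: "exec B (setup_adj @ setup_min @ setup_log c1 @ [Assign 7 (Num 0), Assign 8 (Num 0)]) s t1 (drawn s1 0 0 0 (\<lambda>_. 0))"
    using wp_setup[OF inp bl] unfolding wp_def by blast
  define fin where "fin R = drawn s1 ?l 0 (?l * ?M) R" for R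
  have run1: "run B (t1 + ?l * (6 * ?M + 4)) (program c1 c2 c3, s) = map_pmf (\<lambda>R. (draws_loop # ?rest, fin R)) (samples ?l)"
    using ex run_draws_loop[OF st order_refl, of ?rest]
    unfolding pexec_def program_def run_add fin_def by (simp add: bind_return_pmf)
  \<comment> \<open>For a fixed array of random numbers the rest is deterministic; its final state
    becomes the function \<open>f\<close> of \<open>R\<close>.\<close>
  have "\<exists>s'. run B T (draws_loop # ?rest, fin R) = return_pmf ([], s') \<and> output_ok (rare R) s'" for R
  proof -
    have fr: "frame {6, 7, 8, 9} {11} s1 (set_reg 6 0 (fin R))"
      by (auto simp: frame_def fin_def)
    have st': "static (set_reg 6 0 (fin R))" using st fr by (rule static_frame) auto
    have "wp B (main_part c2 c3) (T - 2) (output_ok (rare R)) (set_reg 6 0 (fin R))"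
      unfolding main_part_def by (rule wp_mono[OF wp_main[OF st']]) (simp_all add: fin_def z T_def)
    moreover have "eval_expr B (fin R) (Op Less (Reg 6) (Reg 18)) = 0"
      using static_data(9)[OF st] by (simp add: fin_def)
    moreover have "2 \<le> T" by (simp add: T_def)
    ultimately have "wp B (draws_loop # ?rest) T (output_ok (rare R)) (fin R)"
      unfolding draws_loop_def using B_gt_1 by (simp add: wp_While_False wp_Assign numeral_2_eq_2)
    then show ?thesis by (rule run_wp) blast
  qed
  then obtain f where f: "\<And>R. run B T (draws_loop # ?rest, fin R) = return_pmf ([], f R)" "\<And>R. output_ok (rare R) (f R)"
    by metis
  have "run B (t1 + ?l * (6 * ?M + 4) + T) (program c1 c2 c3, s) = map_pmf (\<lambda>R. ([], f R)) (samples ?l)"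
    unfolding run_add[of B "t1 + ?l * (6 * ?M + 4)" T] run1 by (simp add: bind_map_pmf f flip: map_pmf_def)
  then show ?thesis
    using that[of "t1 + ?l * (6 * ?M + 4) + T" f] f(2) t1 by (simp add: T_def)
qed

end

section \<open>The contracted graph\<close>

abbreviation keeps_small_cuts :: "real \<Rightarrow> ('v, 'e) mgraph \<Rightarrow> 'e set \<Rightarrow> bool" where
  "keeps_small_cuts \<epsilon> G D \<equiv>
     \<forall>S. alpha_min_cut (2 - \<epsilon>) G S \<and> \<not> trivial_cut G S \<longrightarrow> preserves_cut G D S"

context ram_graph
begin

context
  fixes G :: "(nat, nat) mgraph"
  assumes nodes: "nodes G = {..<n}" and edges: "edges G = {..<m}"
    and ends: "\<And>e. e < m \<Longrightarrow> ends G e = {a e, b e}"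
begin

lemma mem_ends: "e < m \<Longrightarrow> v \<in> ends G e \<longleftrightarrow> inc v e"
  by (simp add: ends inc_def)

text \<open>\<open>conn\<close> is a relation on all naturals, \<open>joined\<close> one on the
  nodes; edges only relate nodes, so the two differ only in the range.\<close>

lemma joined_iff:
  assumes "D \<subseteq> {..<m}"
  shows "(x, y) \<in> joined G D \<longleftrightarrow> x < n \<and> y < n \<and> (x, y) \<in> conn id D"
proof -
  let ?S = "{(x, y). \<exists>e\<in>D. x \<in> ends G e \<and> y \<in> ends G e}"
  have "({(x, y). id x = id y} \<union> {(x, y). \<exists>e\<in>D. inc x e \<and> inc y e}) = ?S\<^sup>="
    using assms by (auto simp: mem_ends subset_iff)
  then have "conn id D = ?S\<^sup>*"
    unfolding conn_def by simp
  then show ?thesis by (simp add: joined_def nodes)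
qed

lemma equiv_joined:
  assumes "D \<subseteq> {..<m}"
  shows "equiv {..<n} (joined G D)"
proof (rule equivI)
  have sym: "sym (conn id D)"
    unfolding conn_def by (rule sym_rtrancl) (auto simp: sym_def)
  show "joined G D \<subseteq> {..<n} \<times> {..<n}" by (auto simp: joined_iff[OF assms])
  show "refl_on {..<n} (joined G D)"
    by (auto simp: refl_on_def joined_iff[OF assms] conn_same)
  show "sym (joined G D)" using sym by (auto simp: sym_def joined_iff[OF assms])
  show "trans (joined G D)" by (auto simp: trans_def joined_iff[OF assms] intro: conn_trans)
qed

lemma class_eq_iff:
  assumes "D \<subseteq> {..<m}" "x < n" "y < n"
  shows "joined G D `` {x} = joined G D `` {y} \<longleftrightarrow> (x, y) \<in> conn id D"
  using eq_equiv_class_iff[OF equiv_joined[OF assms(1)], of x y] assms by (simp add: joined_iff)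

lemma contract_edges:
  assumes "D \<subseteq> {..<m}"
  shows "edges (contract G D) = {e. e < m \<and> (a e, b e) \<notin> conn id D}"
proof -
  have "card ((\<lambda>v. joined G D `` {v}) ` ends G e) = 2 \<longleftrightarrow> (a e, b e) \<notin> conn id D" if "e < m" for e
    using class_eq_iff[OF assms, of "a e" "b e"] a_less b_less that by (auto simp: ends card_insert_if)
  then show ?thesis by (auto simp: contract_def edges)
qed

lemma contract_card_edges:
  assumes "D \<subseteq> {..<m}"
  shows "card (edges (contract G D)) \<le> card ({..<m} - D)"
proof (rule card_mono)
  have "(a e, b e) \<in> conn id D" if "e \<in> D" for e
    using that by (intro conn_edge) (auto simp: inc_def)
  then show "edges (contract G D) \<subseteq> {..<m} - D"
    unfolding contract_edges[OF assms] by auto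
qed simp

lemma contract_card_nodes:
  assumes "D \<subseteq> {..<m}"
  shows "real (card (nodes (contract G D))) \<le> 2 / real \<delta> * (2 * real (card ({..<m} - D)) + real n)"
proof -
  have "(a e, b e) \<in> joined G D" if "e \<in> D" for e
    using that assms a_less b_less by (auto simp: joined_iff[OF assms] inc_def intro!: conn_edge)
  then show ?thesis
    using card_quotient_le[OF equiv_joined[OF assms] assms] by (simp add: contract_def nodes)
qed

lemma output_ok_encodes:
  assumes ok: "output_ok D s"
  shows "contracted G s = D" "encodes_output (contract G D) s"
proof -
  have D: "D = F s" using ok by (simp add: output_ok_def)
  then show "contracted G s = D" by (auto simp: contracted_def edges F_def)
  have Dm: "D \<subseteq> {..<m}" by (auto simp: D F_def)
  let ?lab = "arrs s 3" and ?r = "joined G D"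
  have lab: "?lab x = ?lab y \<longleftrightarrow> (x, y) \<in> conn id D" if "x < n" "y < n" for x y
    using ok that by (simp add: output_ok_def labelled_def)
  have img: "?lab ` {..<n} = {..<regs s 2}"
    using ok by (simp add: output_ok_def labelled_def)
  \<comment> \<open>The label of an arbitrary member, which suffices as labels are constant on
    components.\<close>
  define f where "f X = ?lab (SOME v. v \<in> X)" for X
  have f: "f (?r `` {v}) = ?lab v" if "v < n" for v
  proof -
    have "v \<in> ?r `` {v}" using that by (simp add: joined_iff[OF Dm] conn_same)
    define u where "u = (SOME u. u \<in> ?r `` {v})"
    have "u \<in> ?r `` {v}" unfolding u_def by (rule someI) (fact \<open>v \<in> ?r `` {v}\<close>)
    then have "?lab v = ?lab u" using lab[OF that, of u] by (simp add: joined_iff[OF Dm])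
    then show ?thesis by (simp add: f_def u_def)
  qed
  have nds: "nodes (contract G D) = (\<lambda>v. ?r `` {v}) ` {..<n}"
    by (auto simp: contract_def nodes quotient_def)
  show "encodes_output (contract G D) s"
    unfolding encodes_output_def
  proof (intro exI conjI)
    show "bij_betw f (nodes (contract G D)) {..<regs s 2}"
      unfolding bij_betw_def
    proof
      show "inj_on f (nodes (contract G D))"
        unfolding nds by (rule inj_onI) (clarsimp simp: f lab class_eq_iff[OF Dm])
      show "f ` nodes (contract G D) = {..<regs s 2}"
        unfolding nds img[symmetric] by (auto simp: f image_image)
    qed
    show "\<forall>X\<in>nodes (contract G D). \<forall>v\<in>X. ?lab v = f X"
    proof (intro ballI)
      fix X v assume "X \<in> nodes (contract G D)" "v \<in> X"
      then obtain u where u: "u < n" "X = ?r `` {u}" "v < n" "(u, v) \<in> conn id D"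
        by (auto simp: nds joined_iff[OF Dm])
      then show "?lab v = f X" using lab[of u v] f[of u] by simp
    qed
    have eq: "edges (contract G D) = {e. e < m \<and> ?lab (a e) \<noteq> ?lab (b e)}"
      using a_less b_less by (auto simp: contract_edges[OF Dm] lab)
    then show bij: "bij_betw (arrs s 4) {..<regs s 3} (edges (contract G D))"
      using ok by (simp add: output_ok_def)
    show "\<forall>j<regs s 3. {arrs s 5 j, arrs s 6 j} = f ` ends (contract G D) (arrs s 4 j)"
    proof (intro allI impI)
      fix j assume j: "j < regs s 3"
      then have "arrs s 4 j \<in> edges (contract G D)" using bij by (auto simp: bij_betw_def)
      then have "arrs s 4 j < m" by (simp add: eq)
      then show "{arrs s 5 j, arrs s 6 j} = f ` ends (contract G D) (arrs s 4 j)"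
        using ok j a_less b_less by (simp add: output_ok_def contract_def ends f)
    qed
  qed
qed

section \<open>Non-trivial small cuts are sparse at every node\<close>

lemma mem_cut_edges: "e < m \<Longrightarrow> e \<in> cut_edges G S \<longleftrightarrow> (a e \<in> S) \<noteq> (b e \<in> S)"
  using a_neq_b by (auto simp: cut_edges_def edges ends Int_insert_left)

lemma cut_edges_subset: "cut_edges G S \<subseteq> {..<m}"
  by (auto simp: cut_edges_def edges)

lemma edge_connectivity_le:
  assumes "is_cut G S"
  shows "edge_connectivity G \<le> card (cut_edges G S)"
proof -
  have "finite {S. is_cut G S}"
    by (rule finite_subset[of _ "Pow {..<n}"]) (auto simp: is_cut_def nodes)
  then show ?thesis
    unfolding edge_connectivity_def using assms by (intro Min_le) auto
qed

lemma edge_connectivity_le_\<delta>: "edge_connectivity G \<le> \<delta>"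
proof -
  obtain v where v: "v < n" "deg v = \<delta>" using \<delta>_attained by blast
  have "1 < n" using deg_less[OF v(1)] v(2) \<delta>_pos by simp
  then have "{v} \<noteq> {..<n}" by (metis card_lessThan is_singletonI is_singleton_altdef less_irrefl)
  then have "is_cut G {v}" using v by (auto simp: is_cut_def nodes)
  then have "edge_connectivity G \<le> card (cut_edges G {v})" by (rule edge_connectivity_le)
  also have "cut_edges G {v} = {e. e < m \<and> inc v e}"
    using cut_edges_subset[of "{v}"] a_neq_b a_neq_b[THEN not_sym] by (auto simp: mem_cut_edges inc_def)
  finally show ?thesis using v by (simp add: deg_def)
qed

text \<open>Moving \<open>v\<close> to the other side of a non-trivial cut yields a cut again.\<close>

lemma cut_sparse:
  assumes S: "alpha_min_cut (2 - \<epsilon>) G S" "\<not> trivial_cut G S" and \<epsilon>: "\<epsilon> \<le> 1" and v: "v < n"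
  shows "real (card {e \<in> cut_edges G S. inc v e}) \<le> (1 - \<epsilon> / 2) * real (deg v)"
proof -
  let ?C = "cut_edges G S" and ?l = "edge_connectivity G"
  define Cv where "Cv = {e \<in> ?C. inc v e}"
  define Ev where "Ev = {e. e < m \<and> inc v e}"
  define S' where "S' = (if v \<in> S then S - {v} else insert v S)"
  have cut: "S \<noteq> {}" "S \<subset> {..<n}" and small: "real (card ?C) \<le> (2 - \<epsilon>) * real ?l"
    using S by (auto simp: alpha_min_cut_def is_cut_def nodes)
  have nontriv: "card S \<noteq> 1" "card ({..<n} - S) \<noteq> 1"
    using S by (auto simp: trivial_cut_def alpha_min_cut_def nodes)
  have "is_cut G S'"
  proof (cases "v \<in> S")
    case True
    have "S - {v} \<noteq> {}" using nontriv(1) True by (metis card_1_singleton_iff One_nat_def insert_Diff)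
    then show ?thesis using True cut by (auto simp: S'_def is_cut_def nodes)
  next
    case False
    have "insert v S \<noteq> {..<n}"
    proof
      assume "insert v S = {..<n}"
      then have "{..<n} - S = {v}" using False by auto
      then show False using nontriv(2) by simp
    qed
    then show ?thesis using False cut v by (auto simp: S'_def is_cut_def nodes)
  qed
  then have "?l \<le> card (cut_edges G S')" by (rule edge_connectivity_le)
  \<comment> \<open>Moving \<open>v\<close> replaces the cut edges at \<open>v\<close> by the other
    edges at \<open>v\<close>.\<close>
  also have "cut_edges G S' = (?C - Cv) \<union> (Ev - Cv)"
  proof (rule set_eqI)
    fix e
    show "e \<in> cut_edges G S' \<longleftrightarrow> e \<in> (?C - Cv) \<union> (Ev - Cv)"
    proof (cases "e < m")
      case True
      then show ?thesis
        using a_neq_b[OF True] by (auto simp: mem_cut_edges Cv_def Ev_def S'_def inc_def)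
    next
      case False
      then show ?thesis using cut_edges_subset by (auto simp: Ev_def)
    qed
  qed
  also have "card ((?C - Cv) \<union> (Ev - Cv)) \<le> card (?C - Cv) + card (Ev - Cv)"
    by (rule card_Un_le)
  finally have "?l \<le> (card ?C - card Cv) + (deg v - card Cv)" and "card Cv \<le> card ?C" "card Cv \<le> deg v"
  proof -
    assume *: "?l \<le> card (?C - Cv) + card (Ev - Cv)"
    have fin: "finite ?C" using cut_edges_subset finite_subset by blast
    have sub: "Cv \<subseteq> ?C" "Cv \<subseteq> Ev" using cut_edges_subset by (auto simp: Cv_def Ev_def)
    show "card Cv \<le> card ?C" "card Cv \<le> deg v"
      using card_mono[OF fin sub(1)] card_mono[OF _ sub(2)] by (auto simp: Ev_def deg_def)
    have "finite Cv" using fin sub(1) finite_subset by blast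
    then show "?l \<le> (card ?C - card Cv) + (deg v - card Cv)"
      using * sub by (simp add: card_Diff_subset Ev_def deg_def)
  qed
  then have "real ?l + 2 * real (card Cv) \<le> real (card ?C) + real (deg v)"
    by linarith
  also have "\<dots> \<le> (2 - \<epsilon>) * real ?l + real (deg v)"
    using small by simp
  finally have "2 * real (card Cv) \<le> (1 - \<epsilon>) * real ?l + real (deg v)"
    by (simp add: algebra_simps)
  \<comment> \<open>The connectivity is at most the minimum degree, so \<open>deg v\<close> may
    replace it as \<open>\<epsilon> \<le> 1\<close>. The right side becomes (2 - \<epsilon>) * deg
    v, twice the claimed bound.\<close>
  also have "(1 - \<epsilon>) * real ?l \<le> (1 - \<epsilon>) * real (deg v)"
    using \<epsilon> edge_connectivity_le_\<delta> \<delta>_le[OF v] by (intro mult_left_mono) auto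
  finally show ?thesis by (simp add: Cv_def algebra_simps)
qed

text \<open>It suffices to fix one non-trivial small cut through every edge that lies on one, so the union
  bound ranges over edges rather than cuts.\<close>

lemma prob_preserved:
  assumes \<epsilon>: "0 < \<epsilon>" "\<epsilon> \<le> 1" and c3: "20 * exp (16 / \<epsilon> + 2) \<le> real c3"
    and c12: "c1 = k * c2" "(1 - exp (- (16 / \<epsilon> + 2)) / 4) ^ k \<le> 1 / 4"
  shows "1 - real m * (1 / real n) ^ c2 \<le> measure_pmf.prob (samples (c1 * lg))
    {R. keeps_small_cuts \<epsilon> G (rare R)}"
proof -
  define p where "p = exp (- (16 / \<epsilon> + 2)) / 2"
  define T where "T = {e. e < m \<and> (\<exists>S. alpha_min_cut (2 - \<epsilon>) G S \<and> \<not> trivial_cut G S \<and> e \<in> cut_edges G S)}"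
  have "0 \<le> 16 / \<epsilon>" using \<epsilon> by simp
  then have "exp (- (16 / \<epsilon> + 2)) \<le> 1" by (simp only: exp_le_one_iff)
  then have p1: "0 \<le> 1 - p / 2" unfolding p_def by linarith
  have good: "p \<le> measure_pmf.prob (sample coords) {\<omega>. e \<in> good c3 \<omega>}" if "e \<in> T" for e
  proof -
    obtain S where S: "alpha_min_cut (2 - \<epsilon>) G S" "\<not> trivial_cut G S" "e \<in> cut_edges G S"
      using \<open>e \<in> T\<close> by (auto simp: T_def)
    have "real (card (cut_edges G S)) \<le> (2 - \<epsilon>) * real (edge_connectivity G)"
      using S(1) by (simp add: alpha_min_cut_def)
    also have "\<dots> \<le> 2 * real \<delta>"
      using \<epsilon> edge_connectivity_le_\<delta> by (intro mult_mono) auto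
    finally have card: "real (card (cut_edges G S)) \<le> 2 * real \<delta>" .
    \<comment> \<open>\<open>cut_sparse\<close> provides \<open>\<eta> = \<epsilon> / 2\<close>,
      which turns 8 / \<eta> into 16 / \<epsilon>.\<close>
    have "exp (- (8 / (\<epsilon> / 2) + 2)) / 2 \<le> measure_pmf.prob (sample coords) {\<omega>. e \<in> good c3 \<omega>}"
      using S(3) \<epsilon> c3 by (intro prob_good[OF cut_edges_subset card, of "\<epsilon> / 2" S] mem_cut_edges cut_sparse[OF S(1,2)]) auto
    then show ?thesis by (simp add: p_def)
  qed
  have "real (card T) * (2 ^ (c2 * lg) * (1 - p / 2) ^ (c1 * lg)) \<le> real m * (1 / real n) ^ c2"
  proof (rule mult_mono)
    have "card T \<le> card {..<m}" by (rule card_mono) (auto simp: T_def)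
    then show "real (card T) \<le> real m" by simp
    \<comment> \<open>The failure bound of a single edge: the choice of \<open>k\<close> gives 2 *
      (1 - p / 2) ^ k \<le> 1/2, so the bound is at most 2 ^ (- c2 * lg), and
      \<open>n < 2 ^ lg\<close> turns this into n ^ (- c2).\<close>
    have "(2::real) ^ (c2 * lg) * (1 - p / 2) ^ (c1 * lg) = ((2 * (1 - p / 2) ^ k) ^ c2) ^ lg"
      by (simp add: c12(1) power_mult power_mult_distrib)
    also have "\<dots> \<le> ((1 / 2) ^ c2) ^ lg"
      using c12(2) p1 by (intro power_mono) (auto simp: p_def)
    also have "\<dots> = (1 / 2 ^ lg) ^ c2"
      by (simp add: power_one_over mult.commute flip: power_mult)
    also have "\<dots> \<le> (1 / real n) ^ c2"
    proof (intro power_mono divide_left_mono)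
      have "real n \<le> real (2 ^ lg)" using lg(1) by (intro of_nat_mono) simp
      then show "real n \<le> 2 ^ lg" by simp
      have "0 < n" using lg(2) by (rule less_le_trans[rotated]) simp
      then show "0 < (2::real) ^ lg * real n" by simp
    qed auto
    finally show "2 ^ (c2 * lg) * (1 - p / 2) ^ (c1 * lg) \<le> (1 / real n) ^ c2" .
  qed (use p1 in auto)
  then have "1 - real m * (1 / real n) ^ c2 \<le> 1 - real (card T) * (2 ^ (c2 * lg) * (1 - p / 2) ^ (c1 * lg))"
    by simp
  also have "\<dots> \<le> measure_pmf.prob (samples (c1 * lg)) {R. \<forall>e\<in>T. c2 * lg \<le> tally c3 (c1 * lg) R e}"
    by (rule prob_all_tally) (auto simp: T_def intro: good[unfolded T_def])
  also have "\<dots> \<le> measure_pmf.prob (samples (c1 * lg))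
      {R. keeps_small_cuts \<epsilon> G (rare R)}"
  proof (rule measure_pmf.finite_measure_mono)
    show "{R. \<forall>e\<in>T. c2 * lg \<le> tally c3 (c1 * lg) R e} \<subseteq>
      {R. keeps_small_cuts \<epsilon> G (rare R)}"
      using cut_edges_subset by (fastforce simp: preserves_cut_def rare_def T_def)
  qed simp
  finally show ?thesis .
qed

text \<open>The number of samples is \<open>k\<close> times the vote threshold, so
  \<open>card_tally_ge\<close> leaves at most \<open>k * c3 * n\<close> edges for every outcome;
  \<open>c2\<close> cancels, so the desired error exponent does not enter.\<close>

lemma sizes:
  assumes c12: "c1 = k * c2" "1 \<le> c2" "1 \<le> lg"
  shows "card (edges (contract G (rare R))) \<le> k * c3 * n"
    and "real (card (nodes (contract G (rare R)))) \<le> (4 * real (k * c3) + 2) * (real n / real \<delta>)"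
proof -
  have sub: "rare R \<subseteq> {..<m}" by (auto simp: rare_def)
  have "{..<m} - rare R = {e. e < m \<and> c2 * lg \<le> tally c3 (c1 * lg) R e}"
    by (auto simp: rare_def)
  then have "(c2 * lg) * card ({..<m} - rare R) \<le> (c2 * lg) * (k * c3 * n)"
    using card_tally_ge[of "c2 * lg" c3 "c1 * lg" R] by (simp add: c12(1) ac_simps)
  then have card: "card ({..<m} - rare R) \<le> k * c3 * n"
    using c12 by simp
  then show "card (edges (contract G (rare R))) \<le> k * c3 * n"
    using contract_card_edges[OF sub] by simp
  have "real (card (nodes (contract G (rare R)))) \<le> 2 / real \<delta> * (2 * real (card ({..<m} - rare R)) + real n)"
    by (rule contract_card_nodes[OF sub])
  also have "\<dots> \<le> 2 / real \<delta> * (2 * real (k * c3 * n) + real n)"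
    using card by (intro mult_left_mono) (auto simp flip: of_nat_mult)
  also have "\<dots> = (4 * real (k * c3) + 2) * (real n / real \<delta>)"
    by (simp add: field_simps)
  finally show "real (card (nodes (contract G (rare R)))) \<le> (4 * real (k * c3) + 2) * (real n / real \<delta>)" .
qed

end

end

text \<open>The bit length exceeds the binary logarithm by at most 1, which \<open>n \<ge> 2\<close>
  absorbs at a factor 2; replacing ln 2 by 1/2 costs another.\<close>

lemma lg_le_ln:
  assumes "2 \<le> n" "2 ^ (l - 1) \<le> n"
  shows "real l \<le> 4 * ln (real n)"
proof -
  have "real (2 ^ (l - 1)) \<le> real n" using assms(2) by (simp only: of_nat_le_iff)
  then have "ln (2 ^ (l - 1)) \<le> ln (real n)" using assms(1) by (subst ln_le_cancel_iff) auto
  then have 1: "real (l - 1) * ln 2 \<le> ln (real n)" by (simp add: ln_realpow)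
  have 2: "ln 2 \<le> ln (real n)" using assms(1) by simp
  have "real l \<le> real (l - 1) + 1" by simp
  then have "real l * ln 2 \<le> (real (l - 1) + 1) * ln 2" by (rule mult_right_mono) simp
  also have "\<dots> \<le> 2 * ln (real n)" using 1 2 by (simp add: algebra_simps)
  finally have "real l * ln 2 \<le> 2 * ln (real n)" .
  moreover have "real l * (1 / 2) \<le> real l * ln 2"
    using ln2_ge_two_thirds by (intro mult_left_mono) auto
  ultimately show ?thesis by simp
qed

text \<open>All quantities are at most a constant \<open>A\<close> times n ^ 3. The constant is
  traded for a power of \<open>n\<close> by A < 2 ^ A \<le> n ^ A, so a condition of the form n ^ K
  \<le> 2 ^ w with K = A + 3 is enough.\<close>

lemma graph_bounds:
  fixes n m d l c1 c2 c3 w :: nat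
  assumes n: "2 \<le> n" and m: "m \<le> n * n" and d: "d < n" and l: "l \<le> n"
    and B: "n ^ (2 * c1 + 2 * c2 + 2 * c3 + 30) \<le> 2 ^ w"
  shows "n * n + n < 2 ^ w" "2 * n + m + 2 * d + 10 < 2 ^ w" "(c1 * l + 1) * (2 * n + m) < 2 ^ w"
    "l + c1 * l + c1 + c2 * l + c2 + c3 * n + c3 + 1 < 2 ^ w"
proof -
  define A where "A = 2 * c1 + 2 * c2 + 2 * c3 + 27"
  define q where "q = n ^ 3"
  have "A < 2 ^ A" by (rule less_exp)
  also have "(2::nat) ^ A \<le> n ^ A" using n by (rule power_mono) simp
  finally have "A * q < n ^ A * q" using n by (simp add: q_def)
  also have "n ^ A * q = n ^ (A + 3)" by (simp add: q_def power_add)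
  also have "A + 3 = 2 * c1 + 2 * c2 + 2 * c3 + 30" by (simp add: A_def)
  also note B
  finally have Aq: "A * q < 2 ^ w" .
  have nn: "n * n \<le> q" using n by (simp add: q_def power3_eq_cube)
  have "n * 1 \<le> n * n" using n by (intro mult_le_mono2) simp
  then have nq: "n \<le> q" using nn by linarith
  have q1: "1 \<le> q" using nq n by simp
  have "n * n + n \<le> 2 * q" using nn nq by simp
  also have "2 * q \<le> A * q" by (intro mult_le_mono1) (simp add: A_def)
  finally show "n * n + n < 2 ^ w" using Aq by simp
  have "2 * n + m + 2 * d + 10 \<le> 15 * q" using nn nq m d q1 by simp
  also have "\<dots> \<le> A * q" by (intro mult_le_mono1) (simp add: A_def)
  finally show "2 * n + m + 2 * d + 10 < 2 ^ w" using Aq by simp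
  have "2 * n + m \<le> 2 * (n * n)" using m mult_le_mono1[OF n, of n] by linarith
  moreover have "c1 * l + 1 \<le> (c1 + 1) * n"
    unfolding add_mult_distrib using n mult_le_mono2[OF l, of c1] by linarith
  ultimately have "(c1 * l + 1) * (2 * n + m) \<le> ((c1 + 1) * n) * (2 * (n * n))" by (intro mult_le_mono)
  also have "\<dots> = (2 * c1 + 2) * q" by (simp add: q_def power3_eq_cube algebra_simps)
  also have "\<dots> \<le> A * q" by (intro mult_le_mono1) (simp add: A_def)
  finally show "(c1 * l + 1) * (2 * n + m) < 2 ^ w" using Aq by simp
  have "l \<le> q" using l nq by simp
  then have "l + c1 * l + c1 + c2 * l + c2 + c3 * n + c3 + 1
    \<le> q + c1 * q + c1 * q + c2 * q + c2 * q + c3 * q + c3 * q + q"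
    using nq q1 by (intro add_mono mult_le_mono2 order_refl) auto
  also have "\<dots> = (2 * c1 + 2 * c2 + 2 * c3 + 2) * q" by (simp add: algebra_simps)
  also have "\<dots> \<le> A * q" by (intro mult_le_mono1) (simp add: A_def)
  finally show "l + c1 * l + c1 + c2 * l + c2 + c3 * n + c3 + 1 < 2 ^ w" using Aq by simp
qed

lemma input_sgraph:
  assumes simple: "simple_graph G" and enc: "encodes_input G s"
  shows "sgraph (regs s 0) (regs s 1) (arrs s 0) (arrs s 1)"
proof
  have N: "nodes G = {..<regs s 0}" and E: "edges G = {..<regs s 1}"
    and ends: "\<And>e. e < regs s 1 \<Longrightarrow> ends G e = {arrs s 0 e, arrs s 1 e}"
    using enc by (auto simp: encodes_input_def)
  have wf: "ends G e \<subseteq> {..<regs s 0}" "card (ends G e) = 2" if "e < regs s 1" for e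
    using simple that by (auto simp: simple_graph_def multigraph_def N E)
  show "arrs s 0 e < regs s 0" "arrs s 1 e < regs s 0" "arrs s 0 e \<noteq> arrs s 1 e" if "e < regs s 1" for e
    using wf[OF that] by (auto simp: ends[OF that] card_insert_if split: if_splits)
  show "e = e'" if "e < regs s 1" "e' < regs s 1" "{arrs s 0 e, arrs s 1 e} = {arrs s 0 e', arrs s 1 e'}" for e e'
    using simple that ends by (auto simp: simple_graph_def E inj_on_def)
qed

lemma contraction_program:
  fixes G :: "(nat, nat) mgraph"
  assumes simple: "simple_graph G" and enc: "encodes_input G s"
    and n: "n = card (nodes G)" and m: "m = card (edges G)" and \<delta>: "\<delta> = min_degree G" "1 \<le> \<delta>"
    and B: "n ^ (2 * c1 + 2 * c2 + 2 * c3 + 30) \<le> 2 ^ w"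
    and \<epsilon>: "0 < \<epsilon>" "\<epsilon> \<le> 1" and c3: "20 * exp (16 / \<epsilon> + 2) \<le> real c3"
    and c12: "c1 = k * c2" "(1 - exp (- (16 / \<epsilon> + 2)) / 4) ^ k \<le> 1 / 4" and c2: "\<gamma> + 2 \<le> real c2"
    and \<gamma>: "1 \<le> \<gamma>"
  obtains t f and ps :: "(nat \<Rightarrow> nat) pmf" where "real t \<le> 544 * (real c1 + 1) * real m * ln (real n)"
    and "run (2 ^ w) t (program c1 c2 c3, s) = map_pmf (\<lambda>R. ([], f R)) ps"
    and "\<And>R. encodes_output (contract G (contracted G (f R))) (f R)"
    and "\<And>R. real (card (nodes (contract G (contracted G (f R))))) \<le> (4 * real (k * c3) + 2) * (real n / real \<delta>)"
    and "\<And>R. real (card (edges (contract G (contracted G (f R))))) \<le> real (k * c3) * real n"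
    and "1 - real n powr (- \<gamma>) \<le> measure_pmf.prob ps
      {R. keeps_small_cuts \<epsilon> G (contracted G (f R))}"
proof -
  define a where "a = arrs s 0"
  define b where "b = arrs s 1"
  have N: "nodes G = {..<n}" and E: "edges G = {..<m}" and r: "regs s 0 = n" "regs s 1 = m"
    and ends: "\<And>e. e < m \<Longrightarrow> ends G e = {a e, b e}"
    using enc n m by (auto simp: encodes_input_def a_def b_def)
  interpret sgraph n m a b
    using input_sgraph[OF simple enc] unfolding r a_def b_def .
  have degree: "degree G v = deg v" for v
    unfolding degree_def deg_def E by (rule arg_cong[where f = card]) (auto simp: ends inc_def)
  have "nodes G \<noteq> {}" using simple by (simp add: simple_graph_def multigraph_def)
  then have n0: "0 < n" by (auto simp: N)
  have mind: "\<delta> = Min (deg ` {..<n})"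
    using \<delta>(1) by (simp add: min_degree_def degree N)
  have \<delta>le: "\<delta> \<le> deg v" if "v < n" for v
    unfolding mind using that by (intro Min_le) auto
  have "\<delta> \<in> deg ` {..<n}" unfolding mind using n0 by (intro Min_in) auto
  then obtain v where v: "v < n" "deg v = \<delta>" by auto
  then have \<delta>n: "\<delta> < n" using deg_less by auto
  then have n2: "2 \<le> n" using \<delta>(2) by simp
  \<comment> \<open>Minimum degree at least 1 gives \<open>n \<le> 2 * m\<close>, by which the terms
    in \<open>n\<close> are absorbed into the running time.\<close>
  have "n * 1 \<le> (\<Sum>v<n. deg v)"
    using \<delta>le \<delta>(2) by (intro order_trans[OF _ sum_bounded_below[of "{..<n}" 1 deg]]) (auto intro: order_trans)
  then have nm: "n \<le> 2 * m" by (simp add: sum_deg)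
  have "(\<Sum>v<n. deg v) \<le> (\<Sum>v<n. n)"
    using deg_less by (intro sum_mono) (simp add: less_imp_le)
  then have mn: "m \<le> n * n" by (simp add: sum_deg)
  obtain l where l: "2 ^ l \<le> n" "n < 2 ^ (l + 1)"
    using ex_power_ivl1[of 2 n] n2 by auto
  define lg where "lg = l + 1"
  have lgb: "n < 2 ^ lg" "2 ^ (lg - 1) \<le> n" "1 \<le> lg" using l by (simp_all add: lg_def)
  have "l < 2 ^ l" by (rule less_exp)
  then have lgn: "lg \<le> n" using order_trans[OF Suc_leI l(1), of l] by (simp add: lg_def)
  interpret ram_graph n m a b \<delta> "2 ^ w" c1 c2 c3 lg
    by unfold_locales (use \<delta>(2) \<delta>le v lgb graph_bounds[OF n2 mn \<delta>n lgn B] in auto)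
  have inp: "input s" unfolding input_def by (intro conjI r a_def[symmetric] b_def[symmetric])
  have bl: "blank s" using enc by (auto simp: blank_def encodes_input_def)
  obtain t f where t: "t \<le> (8 * m + 4 * n + 3 * lg + 9) + c1 * lg * (6 * (2 * n + m) + 4) +
      ((25 * n + 33 * m + 19) * (c1 * lg) + (25 * n + 32 * m + 16))"
    and run: "run (2 ^ w) t (program c1 c2 c3, s) = map_pmf (\<lambda>R. ([], f R)) (samples (c1 * lg))"
    and ok: "\<And>R. output_ok (rare R) (f R)"
    by (rule run_program[OF inp bl]) (rule that; assumption)
  note out = output_ok_encodes[OF N E ends ok]
  have c2': "1 \<le> c2" using c2 \<gamma> by linarith
  show ?thesis
  proof (rule that[of t f "samples (c1 * lg)"])
    show "real t \<le> 544 * (real c1 + 1) * real m * ln (real n)"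
    proof -
      have m1: "1 \<le> m" using nm n2 by simp
      have "c1 * lg * (6 * (2 * n + m) + 4) + (25 * n + 33 * m + 19) * (c1 * lg)
          = c1 * lg * (37 * n + 39 * m + 23)" by (simp add: algebra_simps)
      \<comment> \<open>37 * 2 + 39 + 23 = 136, by \<open>n \<le> 2 * m\<close> and
        \<open>m \<ge> 1\<close>; the factor 4 of \<open>lg_le_ln\<close> later makes it
        544.\<close>
      also have "\<dots> \<le> c1 * lg * (136 * m)"
        using nm m1 by (intro mult_le_mono2) simp
      finally have "t \<le> 136 * m + c1 * lg * (136 * m)"
        using t nm m1 lgn by linarith
      also have "\<dots> \<le> lg * (136 * m) + c1 * lg * (136 * m)"
        using lgb(3) by simp
      also have "\<dots> = 136 * (c1 + 1) * m * lg" by (simp add: algebra_simps)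
      finally have "real t \<le> real (136 * (c1 + 1) * m * lg)" by (simp only: of_nat_le_iff)
      also have "\<dots> = 136 * (real c1 + 1) * real m * real lg" by simp
      also have "\<dots> \<le> 136 * (real c1 + 1) * real m * (4 * ln (real n))"
        using lg_le_ln[OF n2 lgb(2)] by (intro mult_left_mono) auto
      also have "\<dots> = 544 * (real c1 + 1) * real m * ln (real n)"
        by (simp add: algebra_simps)
      finally show ?thesis .
    qed
    show "run (2 ^ w) t (program c1 c2 c3, s) = map_pmf (\<lambda>R. ([], f R)) (samples (c1 * lg))"
      by (rule run)
    show "encodes_output (contract G (contracted G (f R))) (f R)" for R
      using out by simp
    show "real (card (nodes (contract G (contracted G (f R))))) \<le> (4 * real (k * c3) + 2) * (real n / real \<delta>)" for R
      using sizes(2)[OF N E ends c12(1) c2' lgb(3), of R] out(1)[of R] by simp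
    show "real (card (edges (contract G (contracted G (f R))))) \<le> real (k * c3) * real n" for R
      using sizes(1)[OF N E ends c12(1) c2' lgb(3), of R] out(1)[of R] by (simp flip: of_nat_mult)
    show "1 - real n powr (- \<gamma>) \<le> measure_pmf.prob (samples (c1 * lg))
      {R. keeps_small_cuts \<epsilon> G (contracted G (f R))}"
    proof -
      \<comment> \<open>The union bound over at most \<open>n * n\<close> edges costs two powers of
        \<open>n\<close>, hence \<open>\<gamma> + 2 \<le> c2\<close>.\<close>
      have "real m * (1 / real n) ^ c2 \<le> real n ^ 2 * (1 / real n) ^ c2"
        using mn by (intro mult_right_mono) (auto simp: power2_eq_square simp flip: of_nat_mult)
      also have "\<dots> = real n powr (2 - real c2)"
        using n2 by (simp add: powr_diff powr_realpow power_one_over divide_inverse power_inverse flip: powr_numeral)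
      also have "\<dots> \<le> real n powr (- \<gamma>)"
        using n2 c2 by (intro powr_mono) auto
      finally show ?thesis
        using prob_preserved[OF N E ends \<epsilon> c3 c12] by (simp add: out)
    qed
  qed
qed

theorem theorem2p1:
  fixes \<epsilon> \<gamma> :: real
  assumes "0 < \<epsilon>" and "\<epsilon> \<le> 1" and "\<gamma> \<ge> 1"
  shows "\<exists>(P :: instr list) (K :: nat) (c :: real).
    \<forall>(G :: (nat, nat) mgraph) (s :: ram_state) (w :: nat) (n :: nat) (m :: nat) (\<delta> :: nat).
      simple_graph G \<and> n = card (nodes G) \<and> m = card (edges G) \<and> \<delta> = min_degree G \<and> \<delta> \<ge> 1 \<and>
      encodes_input G s \<and> n ^ K \<le> 2 ^ w \<longrightarrow>
      (\<exists>t :: nat. real t \<le> c * real m * ln (real n) \<and>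
        (\<forall>(cs, s') \<in> set_pmf (run (2 ^ w) t (P, s)).
           cs = [] \<and>
           encodes_output (contract G (contracted G s')) s' \<and>
           real (card (nodes (contract G (contracted G s')))) \<le> c * (real n / real \<delta>) \<and>
           real (card (edges (contract G (contracted G s')))) \<le> c * real n) \<and>
        measure_pmf.prob (run (2 ^ w) t (P, s))
          {(cs, s'). \<forall>S. alpha_min_cut (2 - \<epsilon>) G S \<and> \<not> trivial_cut G S \<longrightarrow>
             preserves_cut G (contracted G s') S}
          \<ge> 1 - c * real n powr (- \<gamma>))"
proof -
  define q where "q = 1 - exp (- (16 / \<epsilon> + 2)) / 4"
  have "0 \<le> 16 / \<epsilon>" using assms(1) by simp
  then have "exp (- (16 / \<epsilon> + 2)) \<le> 1" by (simp only: exp_le_one_iff)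
  then have "0 < q" "q < 1" unfolding q_def using exp_gt_zero[of "- (16 / \<epsilon> + 2)"] by linarith+
  \<comment> \<open>\<open>k\<close> is the ratio of samples to vote threshold. It depends on
    \<open>\<epsilon>\<close> only, as does \<open>c3\<close>, while \<open>c2\<close> carries
    \<open>\<gamma>\<close>.\<close>
  then obtain k where k: "q ^ k < 1 / 4"
    using real_arch_pow_inv[of "1 / 4" q] by auto
  have kq: "(1 - exp (- (16 / \<epsilon> + 2)) / 4) ^ k \<le> 1 / 4"
    using k by (simp add: q_def)
  define c2 where "c2 = nat \<lceil>\<gamma>\<rceil> + 2"
  define c1 where "c1 = k * c2"
  define c3 where "c3 = nat \<lceil>20 * exp (16 / \<epsilon> + 2)\<rceil>"
  have c2: "\<gamma> + 2 \<le> real c2" unfolding c2_def by linarith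
  have c3: "20 * exp (16 / \<epsilon> + 2) \<le> real c3" unfolding c3_def by linarith
  define c where "c = 544 * (real c1 + 1) + (4 * real (k * c3) + 2)"
  show ?thesis
  proof (rule exI[of _ "program c1 c2 c3"], rule exI[of _ "2 * c1 + 2 * c2 + 2 * c3 + 30"],
      rule exI[of _ c], intro allI impI, goal_cases)
    case (1 G s w n m \<delta>)
    have G: "simple_graph G" "encodes_input G s" "n = card (nodes G)" "m = card (edges G)" "\<delta> = min_degree G" "1 \<le> \<delta>"
      "n ^ (2 * c1 + 2 * c2 + 2 * c3 + 30) \<le> 2 ^ w"
      using 1 by blast+
    obtain t f and ps :: "(nat \<Rightarrow> nat) pmf" where tf: "real t \<le> 544 * (real c1 + 1) * real m * ln (real n)"
      "run (2 ^ w) t (program c1 c2 c3, s) = map_pmf (\<lambda>R. ([], f R)) ps"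
      "\<And>R. encodes_output (contract G (contracted G (f R))) (f R)"
      "\<And>R. real (card (nodes (contract G (contracted G (f R))))) \<le> (4 * real (k * c3) + 2) * (real n / real \<delta>)"
      "\<And>R. real (card (edges (contract G (contracted G (f R))))) \<le> real (k * c3) * real n"
      "1 - real n powr (- \<gamma>) \<le> measure_pmf.prob ps
        {R. keeps_small_cuts \<epsilon> G (contracted G (f R))}"
      by (rule contraction_program[OF G assms(1,2) c3 c1_def kq c2 assms(3)]) (rule that; assumption)
    have "n \<noteq> 0"
      using 1 by (auto simp: simple_graph_def multigraph_def)
    then have ln: "0 \<le> ln (real n)" by simp
    show ?case
    proof (intro exI[of _ t] conjI, goal_cases)
      case 1
      have "544 * (real c1 + 1) * (real m * ln (real n)) \<le> c * (real m * ln (real n))"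
        using ln by (intro mult_right_mono) (auto simp: c_def)
      then show ?case
        using tf(1) by (simp add: mult.assoc)
    next
      case 2
      have nodes: "real (card (nodes (contract G (contracted G (f R))))) \<le> c * (real n / real \<delta>)" for R
        by (rule order_trans[OF tf(4)], rule mult_right_mono) (auto simp: c_def)
      have edges: "real (card (edges (contract G (contracted G (f R))))) \<le> c * real n" for R
        by (rule order_trans[OF tf(5)], rule mult_right_mono) (auto simp: c_def)
      show ?case
        unfolding tf(2) using tf(3) nodes edges by auto
    next
      case 3
      have "1 * real n powr (- \<gamma>) \<le> c * real n powr (- \<gamma>)"
        by (intro mult_right_mono) (auto simp: c_def)
      then show ?case
        using tf(6) by (simp add: tf(2) vimage_def)
    qed
  qed
qed

end
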